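(* The groups $\mathbb{Z} \wr \mathbb{Z}^n$ (for every $n\in\mathbb{N}$), $\mathbb{Z}_2 \wr (\mathbb{Z}_2 \wr \mathbb{Z})$, and $\mathbb{Z} \wr (\mathbb{Z}_2 \wr \mathbb{Z})$ all belong to $\mathcal{G}$.
   Context: $\mathbb{N}=\{0,1,2,\ldots\}$ and $\mathbb{Z}_2$ is the group with two elements. For a finite set (alphabet) $\Sigma$, the full shift $\Sigma^{\mathbb{Z}}$ carries the product topology and the shift homeomorphism $\sigma(x)_i = x_{i+1}$. $\mathrm{Aut}(\Sigma^{\mathbb{Z}})$ is the group (under composition) of homeomorphisms $f:\Sigma^{\mathbb{Z}}\to\Sigma^{\mathbb{Z}}$ with $f\circ\sigma=\sigma\circ f$. $\mathcal{G}$ is the class of groups $G$ that embed (as abstract groups, by an injective homomorphism) in $\mathrm{Aut}(\Sigma^{\mathbb{Z}})$, where $\Sigma$ is a finite alphabet with at least two elements; it is known that this class does not depend on the choice of such $\Sigma$. For groups $K,H$, the wreath product $K \wr H$ is the restricted one: the semidirect product $K^{(H)} \rtimes H$, where $K^{(H)}$ is the group of finitely supported functions $H\to K$ and $H$ acts by the regular action on coordinates. *)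

theory Defs
  imports "HOL-Analysis.Function_Topology" "HOL-Algebra.Product_Groups" "HOL-Algebra.Bij"
begin

section \<open>Automorphism groups of full shifts\<close>

definition full_shift :: "'a set \<Rightarrow> (int \<Rightarrow> 'a) topology" where
  "full_shift A = product_topology (\<lambda>i. discrete_topology A) UNIV"

lemma topspace_full_shift: "topspace (full_shift A) = {x. \<forall>i. x i \<in> A}"
  by (auto simp: full_shift_def PiE_def)

definition shift :: "(int \<Rightarrow> 'a) \<Rightarrow> int \<Rightarrow> 'a" where
  "shift x = (\<lambda>i. x (i + 1))"

text \<open>As in \<^const>\<open>BijGroup\<close>, the maps are taken extensional, i.e. they are
  \<^const>\<open>undefined\<close> outside the full shift, so that each automorphism is represented exactly
  once.  Multiplication is composition: the product of \<open>f\<close> and \<open>g\<close> applies \<open>g\<close> first.\<close>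

definition shift_Aut :: "'a set \<Rightarrow> ((int \<Rightarrow> 'a) \<Rightarrow> (int \<Rightarrow> 'a)) monoid" where
  "shift_Aut A = BijGroup (topspace (full_shift A))
     \<lparr>carrier := {f \<in> extensional (topspace (full_shift A)).
        homeomorphic_map (full_shift A) (full_shift A) f \<and>
        (\<forall>x \<in> topspace (full_shift A). f (shift x) = shift (f x))}\<rparr>"

lemma shift_in_full_shift: "x \<in> topspace (full_shift A) \<Longrightarrow> shift x \<in> topspace (full_shift A)"
  by (simp add: topspace_full_shift shift_def)

lemma subgroup_shift_Aut: "subgroup (carrier (shift_Aut A)) (BijGroup (topspace (full_shift A)))"
proof -
  define X where "X = full_shift A"
  define S where "S = topspace X"
  define C where "C = carrier (shift_Aut A)"
  have C: "C = {f \<in> extensional S. homeomorphic_map X X f \<and> (\<forall>x \<in> S. f (shift x) = shift (f x))}"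
    by (simp add: C_def shift_Aut_def S_def X_def)
  have sh: "shift x \<in> S" if "x \<in> S" for x
    using that by (simp add: S_def X_def shift_in_full_shift)
  have CB: "C \<subseteq> Bij S"
    by (auto simp: C Bij_def bij_betw_def S_def homeomorphic_eq_everything_map)
  interpret B: group "BijGroup S" by (rule group_BijGroup)
  have mapsto: "f x \<in> S" if "f \<in> C" "x \<in> S" for f x
    using that CB Bij_imp_funcset by blast
  have "subgroup C (BijGroup S)"
  proof (rule B.subgroupI)
    show "C \<subseteq> carrier (BijGroup S)" using CB by (simp add: BijGroup_def)
    have "homeomorphic_map X X (\<lambda>x\<in>S. x)"
      by (rule homeomorphic_map_eq[of X X id]) (auto simp: S_def)
    hence "(\<lambda>x\<in>S. x) \<in> C" by (auto simp: C sh)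
    thus "C \<noteq> {}" by blast
  next
    fix f g assume fg: "f \<in> C" "g \<in> C"
    have "homeomorphic_map X X (compose S f g)"
      by (rule homeomorphic_map_eq[of X X "f \<circ> g"])
         (use fg in \<open>auto simp: C S_def compose_eq intro: homeomorphic_map_compose\<close>)
    moreover have "compose S f g (shift x) = shift (compose S f g x)" if "x \<in> S" for x
      using fg that sh mapsto[OF fg(2) that] by (simp add: C compose_eq)
    ultimately have "compose S f g \<in> C" by (simp add: C)
    thus "f \<otimes>\<^bsub>BijGroup S\<^esub> g \<in> C" using fg CB by (auto simp: BijGroup_def)
  next
    fix f assume f: "f \<in> C"
    hence fB: "f \<in> Bij S" using CB by blast
    define g where "g = (\<lambda>x\<in>S. inv_into S f x)"
    have inv: "inv\<^bsub>BijGroup S\<^esub> f = g"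
      unfolding g_def using fB by (rule inv_BijGroup)
    obtain h where h: "homeomorphic_maps X X f h"
      using f by (auto simp: C homeomorphic_map_maps)
    have gh: "g x = h x" if x: "x \<in> S" for x
    proof -
      have hx: "h x \<in> S" "f (h x) = x"
        using h x by (auto simp: homeomorphic_maps_def S_def continuous_map_def)
      thus ?thesis
        using fB x by (simp add: g_def Bij_def bij_betw_def inv_into_f_eq)
    qed
    have "homeomorphic_map X X g"
      by (rule homeomorphic_map_eq[of X X h])
         (use h gh in \<open>auto simp: homeomorphic_maps_map S_def\<close>)
    moreover have "g (shift x) = shift (g x)" if x: "x \<in> S" for x
    proof -
      have gx: "g x \<in> S" "f (g x) = x"
        using gh[OF x] h x by (auto simp: homeomorphic_maps_def S_def continuous_map_def)
      have "f (shift (g x)) = shift x" using f gx by (simp add: C)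
      thus ?thesis
        using fB sh[OF x] sh[OF gx(1)] by (simp add: g_def Bij_def bij_betw_def inv_into_f_eq)
    qed
    ultimately show "inv\<^bsub>BijGroup S\<^esub> f \<in> C" by (simp add: inv C g_def)
  qed
  thus ?thesis by (simp add: C_def S_def X_def)
qed

lemma group_shift_Aut: "group (shift_Aut A)"
proof -
  have "shift_Aut A = BijGroup (topspace (full_shift A))\<lparr>carrier := carrier (shift_Aut A)\<rparr>"
    by (simp add: shift_Aut_def)
  thus ?thesis
    using group.subgroup_imp_group[OF group_BijGroup subgroup_shift_Aut] by metis
qed

text \<open>The class of groups that embed in the automorphism group of the full shift over \<open>A\<close>.\<close>

definition shift_Aut_class :: "'a set \<Rightarrow> 'g monoid set" where
  "shift_Aut_class A = {G. group G \<and> (\<exists>\<phi>. \<phi> \<in> mon G (shift_Aut A))}"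


section \<open>Restricted wreath products\<close>

text \<open>The group \<open>H\<close> acts on finitely supported functions by left translation,
  \<open>(h \<cdot> v) x = v (h\<inverse> x)\<close>, and \<open>(u, h) (v, k) = (u (h \<cdot> v), h k)\<close>.\<close>

definition wreath_product ::
    "('k, 'm) monoid_scheme \<Rightarrow> ('h, 'n) monoid_scheme \<Rightarrow> (('h \<Rightarrow> 'k) \<times> 'h) monoid"
    (infixr "\<wreath>" 70) where
  "K \<wreath> H =
     \<lparr>carrier = carrier (sum_group (carrier H) (\<lambda>_. K)) \<times> carrier H,
      monoid.mult = (\<lambda>(u, h) (v, k).
        (u \<otimes>\<^bsub>sum_group (carrier H) (\<lambda>_. K)\<^esub> (\<lambda>x \<in> carrier H. v (inv\<^bsub>H\<^esub> h \<otimes>\<^bsub>H\<^esub> x)), h \<otimes>\<^bsub>H\<^esub> k)),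
      one = (\<one>\<^bsub>sum_group (carrier H) (\<lambda>_. K)\<^esub>, \<one>\<^bsub>H\<^esub>)\<rparr>"

lemma group_wreath_product:
  assumes "group K" "group H"
  shows "group (K \<wreath> H)"
proof -
  interpret K: group K by fact
  interpret H: group H by fact
  define N where "N = sum_group (carrier H) (\<lambda>_. K)"
  interpret N: group N unfolding N_def by (simp add: assms)
  define act where "act h v = (\<lambda>x \<in> carrier H. v (inv\<^bsub>H\<^esub> h \<otimes>\<^bsub>H\<^esub> x))" for h and v :: "'c \<Rightarrow> 'a"
  have carN: "v \<in> carrier N \<longleftrightarrow> v \<in> carrier H \<rightarrow>\<^sub>E carrier K \<and> finite {x \<in> carrier H. v x \<noteq> \<one>\<^bsub>K\<^esub>}" for v
    by (simp add: N_def carrier_sum_group)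
  have multN: "u \<otimes>\<^bsub>N\<^esub> v = (\<lambda>x\<in>carrier H. u x \<otimes>\<^bsub>K\<^esub> v x)" for u v
    by (simp add: N_def)
  have oneN: "\<one>\<^bsub>N\<^esub> = (\<lambda>x\<in>carrier H. \<one>\<^bsub>K\<^esub>)" by (simp add: N_def)
  have act_closed: "act h v \<in> carrier N" if h: "h \<in> carrier H" and v: "v \<in> carrier N" for h v
  proof -
    have "{x \<in> carrier H. act h v x \<noteq> \<one>\<^bsub>K\<^esub>} \<subseteq> (\<lambda>y. h \<otimes>\<^bsub>H\<^esub> y) ` {x \<in> carrier H. v x \<noteq> \<one>\<^bsub>K\<^esub>}"
    proof
      fix x assume x: "x \<in> {x \<in> carrier H. act h v x \<noteq> \<one>\<^bsub>K\<^esub>}"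
      hence "inv\<^bsub>H\<^esub> h \<otimes>\<^bsub>H\<^esub> x \<in> {x \<in> carrier H. v x \<noteq> \<one>\<^bsub>K\<^esub>}" using h by (auto simp: act_def)
      moreover have "x = h \<otimes>\<^bsub>H\<^esub> (inv\<^bsub>H\<^esub> h \<otimes>\<^bsub>H\<^esub> x)"
        using h x by (simp flip: H.m_assoc)
      ultimately show "x \<in> (\<lambda>y. h \<otimes>\<^bsub>H\<^esub> y) ` {x \<in> carrier H. v x \<noteq> \<one>\<^bsub>K\<^esub>}" by blast
    qed
    hence "finite {x \<in> carrier H. act h v x \<noteq> \<one>\<^bsub>K\<^esub>}"
      using v by (auto simp: carN intro: finite_subset)
    moreover have "act h v \<in> carrier H \<rightarrow>\<^sub>E carrier K"
      using h v by (auto simp: act_def carN)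
    ultimately show ?thesis by (simp add: carN)
  qed
  have act_mult: "act h (u \<otimes>\<^bsub>N\<^esub> v) = act h u \<otimes>\<^bsub>N\<^esub> act h v" if "h \<in> carrier H" for h u v
    using that by (auto simp: act_def multN)
  have act_act: "act h (act k v) = act (h \<otimes>\<^bsub>H\<^esub> k) v" if "h \<in> carrier H" "k \<in> carrier H" for h k v
    using that by (auto simp: act_def H.inv_mult_group H.m_assoc)
  have act_one: "act \<one>\<^bsub>H\<^esub> v = v" if "v \<in> carrier N" for v
    using that by (auto simp: act_def carN PiE_def extensional_def)
  have act_unit: "act h \<one>\<^bsub>N\<^esub> = \<one>\<^bsub>N\<^esub>" if "h \<in> carrier H" for h
    using that by (auto simp: act_def oneN)
  have W: "K \<wreath> H = \<lparr>carrier = carrier N \<times> carrier H,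
     monoid.mult = (\<lambda>(u, h) (v, k). (u \<otimes>\<^bsub>N\<^esub> act h v, h \<otimes>\<^bsub>H\<^esub> k)), one = (\<one>\<^bsub>N\<^esub>, \<one>\<^bsub>H\<^esub>)\<rparr>"
    by (simp add: wreath_product_def N_def act_def)
  show ?thesis
  proof (rule groupI)
    fix a assume "a \<in> carrier (K \<wreath> H)"
    then obtain u h where a: "a = (u, h)" "u \<in> carrier N" "h \<in> carrier H" by (auto simp: W)
    have "act (inv\<^bsub>H\<^esub> h) (inv\<^bsub>N\<^esub> u) \<otimes>\<^bsub>N\<^esub> act (inv\<^bsub>H\<^esub> h) u = \<one>\<^bsub>N\<^esub>"
      using a by (simp flip: act_mult add: act_unit)
    thus "\<exists>b\<in>carrier (K \<wreath> H). b \<otimes>\<^bsub>K \<wreath> H\<^esub> a = \<one>\<^bsub>K \<wreath> H\<^esub>"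
      using a by (intro bexI[of _ "(act (inv\<^bsub>H\<^esub> h) (inv\<^bsub>N\<^esub> u), inv\<^bsub>H\<^esub> h)"]) (auto simp: W act_closed)
  qed (auto simp: W act_closed act_mult act_act act_one N.m_assoc H.m_assoc)
qed

end

theory Submission
  imports Defs "HOL-Algebra.Free_Abelian_Groups"
begin

text \<open>
  Let \<open>H\<close> act on a set, let the maps \<open>\<tau> a\<close> for \<open>a \<in> K\<close> form an action of \<open>K\<close> by commuting maps that also
  commute with the action of \<open>H\<close>, and let \<open>C\<close> be a set of points that is invariant under all \<open>\<tau> a\<close>.  Let \<open>a\<close>
  act as \<open>\<tau> a\<close> on \<open>C\<close> and trivially outside \<open>C\<close>.  The conjugate of this map by \<open>h \<in> H\<close> is \<open>\<tau> a\<close> on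
  \<open>h C\<close> and trivial elsewhere, so all the conjugates commute and \<open>K \<wreath> H\<close> acts (\<open>wreath_hom_exists\<close>).  The
  action is faithful if for every finite \<open>F \<subseteq> H\<close> and every \<open>a \<noteq> 1\<close> there is a point of \<open>C\<close> that \<open>\<tau> a\<close> moves and
  that every element of \<open>F\<close> except the identity sends outside \<open>C\<close> (\<open>wreath_hom_inj\<close>, \<open>wreath_on_runs\<close>).

  The points are the states of finite machines that live inside the configurations of a full shift.
  Symbols of a large auxiliary alphabet, the cells, are written in the full shift as
  non-overlapping blocks, and maximal stretches of adjacent cells that fit together form runs.  A
  run of \<open>n\<close> cells is a conveyor belt.  Every cell has an upper and a lower slot, and the \<open>2 n\<close> slots form a circle
  on which there are \<open>m + 1\<close> heads, numbered from \<open>0\<close>, and at every slot a lamp that is lit or not.  Permutations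
  of the states that are induced by local rules form a group that embeds in the automorphism group
  of the full shift (\<open>run_group_embeds\<close>).

  Rotating one head by one slot is induced by local rules, because it is the product of two
  reflections of the circle, one inside each cell and one across each border between cells
  (\<open>two_reflections\<close>).  So is toggling the lamp at head \<open>0\<close>.  Hence \<open>\<int>\<^sup>n\<close> acts by
  rotating the heads \<open>1, \<dots>, n\<close>, and \<open>\<int>\<^sub>2 \<wreath> \<int>\<close> acts by rotating head \<open>0\<close> and toggling the lamp there.

  For \<open>K = \<int>\<close> the maps \<open>\<tau> a\<close> rotate the whole circle with its heads and lamps, and \<open>C\<close> consists of the states in
  which all heads are in one slot and no lamp is lit.  For \<open>K = \<int>\<^sub>2\<close> the nontrivial \<open>\<tau> a\<close> moves head \<open>1\<close> to the
  other slot of its cell, and \<open>C\<close> consists of the states in which the heads \<open>0\<close> and \<open>1\<close> are in one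
  cell and no lamp is lit.  That no lamp is lit is a global condition, but only head \<open>0\<close> has to know it.  The cells carry
  flags that say whether all cells on one side are dark; a flag looks away from head \<open>0\<close>, so
  toggling a lamp at head \<open>0\<close> does not invalidate any flag, and moving head \<open>0\<close> to a neighbouring cell changes flags
  only in the two cells concerned.

  The point required for a finite set \<open>F\<close> is a long run without lit lamps and with all heads in one slot.
  If it is long enough, rotations by the amounts that occur in \<open>F\<close> do not wrap around, so different amounts
  put a head or a lamp in different slots (\<open>\<rho>_separates\<close>).
\<close>

section \<open>Homomorphisms out of a restricted wreath product\<close>

definition point_mass :: "('h, 'n) monoid_scheme \<Rightarrow> ('k, 'm) monoid_scheme \<Rightarrow> 'h \<Rightarrow> 'k \<Rightarrow> 'h \<Rightarrow> 'k" where
  "point_mass H K x a = (\<lambda>y \<in> carrier H. if y = x then a else \<one>\<^bsub>K\<^esub>)"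

abbreviation base_group :: "('k, 'm) monoid_scheme \<Rightarrow> ('h, 'n) monoid_scheme \<Rightarrow> ('h \<Rightarrow> 'k) monoid" where
  "base_group K H \<equiv> sum_group (carrier H) (\<lambda>_. K)"

abbreviation translate :: "('h, 'n) monoid_scheme \<Rightarrow> 'h \<Rightarrow> ('h \<Rightarrow> 'k) \<Rightarrow> 'h \<Rightarrow> 'k" where
  "translate H h v \<equiv> (\<lambda>x \<in> carrier H. v (inv\<^bsub>H\<^esub> h \<otimes>\<^bsub>H\<^esub> x))"

lemma carrier_base_group:
  assumes "group K"
  shows "u \<in> carrier (base_group K H) \<longleftrightarrow>
    u \<in> carrier H \<rightarrow>\<^sub>E carrier K \<and> finite {x \<in> carrier H. u x \<noteq> \<one>\<^bsub>K\<^esub>}"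
  using assms by (simp add: carrier_sum_group)

lemma point_mass_closed:
  assumes "group K" "a \<in> carrier K"
  shows "point_mass H K x a \<in> carrier (base_group K H)"
proof -
  interpret K: group K by fact
  have "{y \<in> carrier H. point_mass H K x a y \<noteq> \<one>\<^bsub>K\<^esub>} \<subseteq> {x}"
    by (auto simp: point_mass_def)
  hence "finite {y \<in> carrier H. point_mass H K x a y \<noteq> \<one>\<^bsub>K\<^esub>}"
    using finite_subset by blast
  thus ?thesis
    using assms by (auto simp: carrier_base_group point_mass_def)
qed

text \<open>The new point is always outside the support of \<open>u\<close>, so that the property to be proved can describe the
  support, as it does in \<open>\<rho>_lamps\<close>.\<close>

lemma base_group_induct [consumes 2, case_names one point]:
  assumes K: "group K" and u: "u \<in> carrier (base_group K H)"
    and one: "P \<one>\<^bsub>base_group K H\<^esub>"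
    and point: "\<And>x a u. \<lbrakk>x \<in> carrier H; a \<in> carrier K; a \<noteq> \<one>\<^bsub>K\<^esub>; u \<in> carrier (base_group K H); u x = \<one>\<^bsub>K\<^esub>; P u\<rbrakk>
      \<Longrightarrow> P (point_mass H K x a \<otimes>\<^bsub>base_group K H\<^esub> u)"
  shows "P u"
proof -
  interpret K: group K by fact
  have "finite {x \<in> carrier H. u x \<noteq> \<one>\<^bsub>K\<^esub>}" using u K by (simp add: carrier_base_group)
  moreover have "finite F \<Longrightarrow> \<forall>u \<in> carrier (base_group K H). {x \<in> carrier H. u x \<noteq> \<one>\<^bsub>K\<^esub>} = F \<longrightarrow> P u" for F
  proof (induction F rule: finite_induct)
    case empty
    show ?case
    proof (intro ballI impI)
      fix u assume "u \<in> carrier (base_group K H)" "{x \<in> carrier H. u x \<noteq> \<one>\<^bsub>K\<^esub>} = {}"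
      hence "u = \<one>\<^bsub>base_group K H\<^esub>"
        using K by (auto simp: carrier_base_group fun_eq_iff PiE_def extensional_def)
      thus "P u" using one by simp
    qed
  next
    case (insert x F)
    show ?case
    proof (intro ballI impI)
      fix u assume u: "u \<in> carrier (base_group K H)" and s: "{x \<in> carrier H. u x \<noteq> \<one>\<^bsub>K\<^esub>} = insert x F"
      define v where "v = u (x := \<one>\<^bsub>K\<^esub>)"
      have x: "x \<in> carrier H" "u x \<noteq> \<one>\<^bsub>K\<^esub>" using s by auto
      have sv: "{y \<in> carrier H. v y \<noteq> \<one>\<^bsub>K\<^esub>} = F" using s insert.hyps by (auto simp: v_def)
      have v: "v \<in> carrier (base_group K H)"
        unfolding carrier_base_group[OF K] sv using u x insert.hyps K
        by (auto simp: carrier_base_group PiE_def extensional_def v_def Pi_def)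
      have "u = point_mass H K x (u x) \<otimes>\<^bsub>base_group K H\<^esub> v"
        using u K by (auto simp: point_mass_def v_def fun_eq_iff carrier_base_group PiE_def extensional_def Pi_def)
      moreover have "P (point_mass H K x (u x) \<otimes>\<^bsub>base_group K H\<^esub> v)"
        using x v u K insert.IH sv
        by (intro point) (auto simp: v_def carrier_base_group)
      ultimately show "P u" by simp
    qed
  qed
  ultimately show ?thesis using u by blast
qed

lemma carrier_wreath: "carrier (K \<wreath> H) = carrier (base_group K H) \<times> carrier H"
  by (simp add: wreath_product_def)

lemma mult_wreath: "(u, h) \<otimes>\<^bsub>K \<wreath> H\<^esub> (v, k) = (u \<otimes>\<^bsub>base_group K H\<^esub> translate H h v, h \<otimes>\<^bsub>H\<^esub> k)"
  by (simp add: wreath_product_def)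

lemma one_wreath: "\<one>\<^bsub>K \<wreath> H\<^esub> = (\<one>\<^bsub>base_group K H\<^esub>, \<one>\<^bsub>H\<^esub>)"
  by (simp add: wreath_product_def)

lemma translate_closed:
  assumes "group K" "group H" "h \<in> carrier H" "v \<in> carrier (base_group K H)"
  shows "translate H h v \<in> carrier (base_group K H)"
proof -
  interpret W: group "K \<wreath> H" using assms group_wreath_product by blast
  interpret K: group K by fact
  interpret H: group H by fact
  interpret N: group "base_group K H" using assms by simp
  have "(\<one>\<^bsub>base_group K H\<^esub>, h) \<otimes>\<^bsub>K \<wreath> H\<^esub> (v, \<one>\<^bsub>H\<^esub>) \<in> carrier (K \<wreath> H)"
    using assms by (intro W.m_closed) (auto simp: carrier_wreath intro: N.one_closed[simplified])
  hence "\<one>\<^bsub>base_group K H\<^esub> \<otimes>\<^bsub>base_group K H\<^esub> translate H h v \<in> carrier (base_group K H)"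
    by (simp only: mult_wreath carrier_wreath mem_Sigma_iff)
  moreover have "\<one>\<^bsub>base_group K H\<^esub> \<otimes>\<^bsub>base_group K H\<^esub> translate H h v = translate H h v"
    using assms by (auto simp: carrier_base_group fun_eq_iff PiE_def Pi_def)
  ultimately show ?thesis by simp
qed

lemma translate_one:
  assumes "group H" "h \<in> carrier H"
  shows "translate H h \<one>\<^bsub>base_group K H\<^esub> = \<one>\<^bsub>base_group K H\<^esub>"
proof -
  interpret H: group H by fact
  show ?thesis using assms by (auto simp: fun_eq_iff)
qed

lemma translate_mult:
  assumes "group H" "h \<in> carrier H"
  shows "translate H h (u \<otimes>\<^bsub>base_group K H\<^esub> v) =
    translate H h u \<otimes>\<^bsub>base_group K H\<^esub> translate H h v"
proof -
  interpret H: group H by fact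
  show ?thesis using assms by (auto simp: fun_eq_iff)
qed

lemma translate_point_mass:
  assumes "group H" "h \<in> carrier H" "x \<in> carrier H"
  shows "translate H h (point_mass H K x a) = point_mass H K (h \<otimes>\<^bsub>H\<^esub> x) a"
proof -
  interpret H: group H by fact
  have "inv\<^bsub>H\<^esub> h \<otimes>\<^bsub>H\<^esub> y = x \<longleftrightarrow> y = h \<otimes>\<^bsub>H\<^esub> x" if "y \<in> carrier H" for y
    using assms that by (metis H.inv_solve_left)
  thus ?thesis using assms by (auto simp: point_mass_def fun_eq_iff)
qed

definition (in monoid) centralizer :: "'a set \<Rightarrow> 'a set" where
  "centralizer S = {p \<in> carrier G. \<forall>s \<in> S. p \<otimes> s = s \<otimes> p}"

lemma (in group) subgroup_centralizer:
  assumes "S \<subseteq> carrier G"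
  shows "subgroup (centralizer S) G"
proof (rule subgroupI)
  fix a assume a: "a \<in> centralizer S"
  have "inv a \<otimes> s = s \<otimes> inv a" if s: "s \<in> S" for s
  proof -
    have "a \<otimes> s = s \<otimes> a" "a \<in> carrier G" "s \<in> carrier G"
      using a s assms by (auto simp: centralizer_def)
    thus ?thesis by (metis inv_closed inv_solve_left inv_solve_right m_assoc m_closed)
  qed
  thus "inv a \<in> centralizer S" using a by (simp add: centralizer_def)
next
  fix a b assume ab: "a \<in> centralizer S" "b \<in> centralizer S"
  have "a \<otimes> b \<otimes> s = s \<otimes> (a \<otimes> b)" if s: "s \<in> S" for s
  proof -
    have "a \<otimes> s = s \<otimes> a" "b \<otimes> s = s \<otimes> b" "a \<in> carrier G" "b \<in> carrier G" "s \<in> carrier G"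
      using ab s assms by (auto simp: centralizer_def)
    thus ?thesis by (metis m_assoc)
  qed
  thus "a \<otimes> b \<in> centralizer S" using ab by (simp add: centralizer_def)
next
  have "\<one> \<in> centralizer S" using assms by (auto simp: centralizer_def)
  thus "centralizer S \<noteq> {}" by blast
qed (auto simp: centralizer_def)

text \<open>Provides an abelian group around a set of commuting elements that need not generate the
  whole group.  Finite products indexed by the top group of a wreath product are defined in it.\<close>

lemma (in group) comm_group_double_centralizer:
  assumes S: "S \<subseteq> carrier G" and comm: "\<And>s t. \<lbrakk>s \<in> S; t \<in> S\<rbrakk> \<Longrightarrow> s \<otimes> t = t \<otimes> s"
  shows "comm_group (G\<lparr>carrier := centralizer (centralizer S)\<rparr>)"
proof -
  have cS: "centralizer S \<subseteq> carrier G" by (auto simp: centralizer_def)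
  have "S \<subseteq> centralizer S" using S comm by (auto simp: centralizer_def)
  hence "centralizer (centralizer S) \<subseteq> centralizer S" by (auto simp: centralizer_def)
  hence c: "a \<otimes> b = b \<otimes> a"
    if "a \<in> centralizer (centralizer S)" "b \<in> centralizer (centralizer S)" for a b
    using that by (auto simp: centralizer_def)
  show ?thesis
    using group.group_comm_groupI[OF subgroup_imp_group[OF subgroup_centralizer[OF cS]]] c by simp
qed

text \<open>The conjugates \<open>\<beta> x a\<close> of \<open>\<kappa> a\<close> by \<open>\<rho> x\<close> all commute, since conjugation reduces this to the case \<open>comm\<close>
  in which one of the two factors is at the origin.  They therefore lie in a common abelian subgroup,
  where \<open>u \<mapsto> \<Prod>x. \<beta> x (u x)\<close> is a homomorphism.\<close>

theorem wreath_hom_exists: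
  fixes P :: "('p, 'q) monoid_scheme" and K :: "('k, 'm) monoid_scheme" and H :: "('h, 'n) monoid_scheme"
  assumes P: "group P" and K: "group K" and H: "group H"
    and \<rho>: "\<rho> \<in> hom H P" and \<kappa>: "\<kappa> \<in> hom K P"
    and comm: "\<And>x a b. \<lbrakk>x \<in> carrier H; a \<in> carrier K; b \<in> carrier K\<rbrakk> \<Longrightarrow>
      \<kappa> a \<otimes>\<^bsub>P\<^esub> (\<rho> x \<otimes>\<^bsub>P\<^esub> \<kappa> b \<otimes>\<^bsub>P\<^esub> inv\<^bsub>P\<^esub> \<rho> x) = (\<rho> x \<otimes>\<^bsub>P\<^esub> \<kappa> b \<otimes>\<^bsub>P\<^esub> inv\<^bsub>P\<^esub> \<rho> x) \<otimes>\<^bsub>P\<^esub> \<kappa> a"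
  obtains \<Phi> where "\<Phi> \<in> hom (K \<wreath> H) P"
    "\<And>h. h \<in> carrier H \<Longrightarrow> \<Phi> (\<one>\<^bsub>base_group K H\<^esub>, h) = \<rho> h"
    "\<And>x a. \<lbrakk>x \<in> carrier H; a \<in> carrier K\<rbrakk> \<Longrightarrow>
       \<Phi> (point_mass H K x a, \<one>\<^bsub>H\<^esub>) = \<rho> x \<otimes>\<^bsub>P\<^esub> \<kappa> a \<otimes>\<^bsub>P\<^esub> inv\<^bsub>P\<^esub> \<rho> x"
proof -
  interpret P: group P by fact
  interpret K: group K by fact
  interpret H: group H by fact
  define N where "N = base_group K H"
  interpret N: group N unfolding N_def by (simp add: K)
  interpret \<rho>: group_hom H P \<rho> by unfold_locales (rule \<rho>)
  interpret \<kappa>: group_hom K P \<kappa> by unfold_locales (rule \<kappa>)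
  define conj where "conj g p = g \<otimes>\<^bsub>P\<^esub> p \<otimes>\<^bsub>P\<^esub> inv\<^bsub>P\<^esub> g" for g p
  have conj_closed: "conj g p \<in> carrier P" if "g \<in> carrier P" "p \<in> carrier P" for g p
    using that by (simp add: conj_def)
  have conj_mult: "conj g (p \<otimes>\<^bsub>P\<^esub> q) = conj g p \<otimes>\<^bsub>P\<^esub> conj g q"
    if "g \<in> carrier P" "p \<in> carrier P" "q \<in> carrier P" for g p q
    using that by (simp add: conj_def P.m_assoc P.inv_solve_left)
  have conj_conj: "conj g (conj h p) = conj (g \<otimes>\<^bsub>P\<^esub> h) p"
    if "g \<in> carrier P" "h \<in> carrier P" "p \<in> carrier P" for g h p
    using that by (simp add: conj_def P.m_assoc P.inv_mult_group)
  define \<beta> where "\<beta> x a = conj (\<rho> x) (\<kappa> a)" for x a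
  have \<beta>_closed: "\<beta> x a \<in> carrier P" if "x \<in> carrier H" "a \<in> carrier K" for x a
    using that by (simp add: \<beta>_def conj_closed)
  have \<beta>_conj: "conj (\<rho> h) (\<beta> x a) = \<beta> (h \<otimes>\<^bsub>H\<^esub> x) a"
    if "h \<in> carrier H" "x \<in> carrier H" "a \<in> carrier K" for h x a
    using that by (simp add: \<beta>_def conj_conj)
  define S where "S = {\<beta> x a | x a. x \<in> carrier H \<and> a \<in> carrier K}"
  have S: "S \<subseteq> carrier P" by (auto simp: S_def \<beta>_closed)
  have S_comm: "s \<otimes>\<^bsub>P\<^esub> t = t \<otimes>\<^bsub>P\<^esub> s" if st: "s \<in> S" "t \<in> S" for s t
  proof -
    obtain x a y b where s: "s = \<beta> x a" "x \<in> carrier H" "a \<in> carrier K"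
      and t: "t = \<beta> y b" "y \<in> carrier H" "b \<in> carrier K" using st by (auto simp: S_def)
    \<comment> \<open>Conjugating both factors by \<open>\<rho> x\<inverse>\<close> moves the first one to the origin.\<close>
    define z where "z = inv\<^bsub>H\<^esub> x \<otimes>\<^bsub>H\<^esub> y"
    have z: "z \<in> carrier H" "y = x \<otimes>\<^bsub>H\<^esub> z" using s t by (auto simp: z_def H.inv_solve_left simp flip: H.m_assoc)
    have "t = conj (\<rho> x) (\<beta> z b)" using s t z by (simp add: \<beta>_conj)
    moreover have "s = conj (\<rho> x) (\<kappa> a)" using s by (simp add: \<beta>_def)
    moreover have "\<kappa> a \<otimes>\<^bsub>P\<^esub> \<beta> z b = \<beta> z b \<otimes>\<^bsub>P\<^esub> \<kappa> a"
      using comm z s t by (simp add: \<beta>_def conj_def)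
    ultimately show ?thesis
      using s t z by (simp flip: conj_mult add: \<beta>_closed)
  qed
  define C where "C = P.centralizer (P.centralizer S)"
  define D where "D = P\<lparr>carrier := C\<rparr>"
  interpret D: comm_group D
    unfolding D_def C_def using P.comm_group_double_centralizer[OF S S_comm] by simp
  have CP: "C \<subseteq> carrier P" by (auto simp: C_def P.centralizer_def)
  have SC: "S \<subseteq> C" using S by (auto simp: C_def P.centralizer_def)
  have \<beta>_hom: "\<beta> x \<in> hom K D" if x: "x \<in> carrier H" for x
  proof (rule homI)
    fix a assume "a \<in> carrier K"
    thus "\<beta> x a \<in> carrier D" using x SC by (auto simp: D_def S_def)
  qed (use x in \<open>simp add: D_def \<beta>_def conj_mult\<close>)
  define B where "B u = gfinprod D (\<lambda>x. \<beta> x (u x)) (carrier H)" for u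
  have B_hom: "B \<in> hom N D"
    unfolding B_def[abs_def] N_def using \<beta>_hom K by (intro D.hom_group_sum) auto
  have B_P: "B u \<in> carrier P" if "u \<in> carrier N" for u
    using hom_in_carrier[OF B_hom that] CP by (auto simp: D_def)
  have B_mult: "B (u \<otimes>\<^bsub>N\<^esub> v) = B u \<otimes>\<^bsub>P\<^esub> B v" if "u \<in> carrier N" "v \<in> carrier N" for u v
    using hom_mult[OF B_hom that] by (simp add: D_def)
  have B_one: "B \<one>\<^bsub>N\<^esub> = \<one>\<^bsub>P\<^esub>"
    using hom_one[OF B_hom N.is_group D.is_group] by (simp add: D_def)
  have B_point: "B (point_mass H K x a) = \<beta> x a" if x: "x \<in> carrier H" and a: "a \<in> carrier K" for x a
  proof -
    have one: "\<beta> y \<one>\<^bsub>K\<^esub> = \<one>\<^bsub>D\<^esub>" if "y \<in> carrier H" for y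
      using hom_one[OF \<beta>_hom[OF that] K D.is_group] .
    have "B (point_mass H K x a) = gfinprod D (\<lambda>y. \<beta> y (point_mass H K x a y)) {x}"
      unfolding B_def using x a one hom_in_carrier[OF \<beta>_hom[OF x] a]
      by (intro D.gfinprod_mono_neutral_cong_right) (auto simp: point_mass_def)
    also have "\<dots> = \<beta> x a"
    proof -
      have "\<beta> x a \<in> carrier D" using hom_in_carrier[OF \<beta>_hom[OF x] a] .
      thus ?thesis using x by (simp add: point_mass_def Pi_def)
    qed
    finally show ?thesis .
  qed
  \<comment> \<open>By induction on the support: translating one lamp amounts to conjugating its image by \<open>\<rho> h\<close>.\<close>
  have B_translate: "B (translate H h v) = conj (\<rho> h) (B v)"
    if h: "h \<in> carrier H" and v: "v \<in> carrier N" for h v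
    using K v[unfolded N_def]
  proof (induction rule: base_group_induct)
    case one
    have "B (translate H h \<one>\<^bsub>base_group K H\<^esub>) = \<one>\<^bsub>P\<^esub>"
      using B_one by (simp only: translate_one[OF H h] N_def)
    moreover have "B \<one>\<^bsub>base_group K H\<^esub> = \<one>\<^bsub>P\<^esub>" using B_one by (simp only: N_def)
    moreover have "conj (\<rho> h) \<one>\<^bsub>P\<^esub> = \<one>\<^bsub>P\<^esub>" using h by (simp add: conj_def)
    ultimately show ?case by (simp only:)
  next
    case (point x a u)
    have tu: "translate H h u \<in> carrier N" using translate_closed[OF K H h point(4)] by (simp add: N_def)
    have u: "u \<in> carrier N" using point(4) by (simp add: N_def)
    have pm: "point_mass H K y a \<in> carrier N" for y
      using point_mass_closed[OF K point(2)] by (simp add: N_def)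
    have "B (translate H h (point_mass H K x a \<otimes>\<^bsub>base_group K H\<^esub> u))
      = B (point_mass H K (h \<otimes>\<^bsub>H\<^esub> x) a \<otimes>\<^bsub>N\<^esub> translate H h u)"
      by (simp only: translate_mult[OF H h] translate_point_mass[OF H h point(1)] N_def)
    also have "\<dots> = \<beta> (h \<otimes>\<^bsub>H\<^esub> x) a \<otimes>\<^bsub>P\<^esub> conj (\<rho> h) (B u)"
      using B_mult[OF pm tu] B_point point h by simp
    also have "\<dots> = conj (\<rho> h) (\<beta> x a \<otimes>\<^bsub>P\<^esub> B u)"
      using point h B_P[OF u] by (simp add: conj_mult \<beta>_closed \<beta>_conj)
    also have "\<dots> = conj (\<rho> h) (B (point_mass H K x a \<otimes>\<^bsub>base_group K H\<^esub> u))"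
      using B_mult[OF pm u] B_point point by (simp only: N_def)
    finally show ?case .
  qed
  define \<Phi> where "\<Phi> = (\<lambda>(u, h). B u \<otimes>\<^bsub>P\<^esub> \<rho> h)"
  show thesis
  proof
    show "\<Phi> \<in> hom (K \<wreath> H) P"
    proof (rule homI)
      fix w assume "w \<in> carrier (K \<wreath> H)"
      thus "\<Phi> w \<in> carrier P" by (auto simp: \<Phi>_def carrier_wreath B_P N_def)
    next
      fix w w' assume "w \<in> carrier (K \<wreath> H)" "w' \<in> carrier (K \<wreath> H)"
      then obtain u h v k where w: "w = (u, h)" "u \<in> carrier N" "h \<in> carrier H"
        and w': "w' = (v, k)" "v \<in> carrier N" "k \<in> carrier H"
        by (auto simp: carrier_wreath N_def)
      have tv: "translate H h v \<in> carrier N"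
        using translate_closed[OF K H w(3)] w'(2) by (simp add: N_def)
      have "\<Phi> (w \<otimes>\<^bsub>K \<wreath> H\<^esub> w') = B u \<otimes>\<^bsub>P\<^esub> conj (\<rho> h) (B v) \<otimes>\<^bsub>P\<^esub> (\<rho> h \<otimes>\<^bsub>P\<^esub> \<rho> k)"
        unfolding w w' mult_wreath \<Phi>_def case_prod_conv N_def[symmetric]
        using w w' tv by (simp add: B_mult B_translate)
      also have "\<dots> = \<Phi> w \<otimes>\<^bsub>P\<^esub> \<Phi> w'"
        using w w' B_P P.m_assoc[of "inv\<^bsub>P\<^esub> \<rho> h" "\<rho> h" "\<rho> k"] by (simp add: \<Phi>_def conj_def P.m_assoc)
      finally show "\<Phi> (w \<otimes>\<^bsub>K \<wreath> H\<^esub> w') = \<Phi> w \<otimes>\<^bsub>P\<^esub> \<Phi> w'" .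
    qed
    show "\<Phi> (\<one>\<^bsub>base_group K H\<^esub>, h) = \<rho> h" if "h \<in> carrier H" for h
      using that B_one unfolding N_def by (simp add: \<Phi>_def del: one_sum_group)
    show "\<Phi> (point_mass H K x a, \<one>\<^bsub>H\<^esub>) = \<rho> x \<otimes>\<^bsub>P\<^esub> \<kappa> a \<otimes>\<^bsub>P\<^esub> inv\<^bsub>P\<^esub> \<rho> x"
      if "x \<in> carrier H" "a \<in> carrier K" for x a
      using that by (simp add: \<Phi>_def B_point \<beta>_closed flip: conj_def \<beta>_def)
  qed
qed

lemma wreath_split:
  assumes "group K" "group H" "u \<in> carrier (base_group K H)" "h \<in> carrier H"
  shows "(u, h) = (u, \<one>\<^bsub>H\<^esub>) \<otimes>\<^bsub>K \<wreath> H\<^esub> (\<one>\<^bsub>base_group K H\<^esub>, h)"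
proof -
  interpret H: group H by fact
  interpret N: group "base_group K H" using assms by simp
  show ?thesis
    using assms unfolding mult_wreath translate_one[OF assms(2) H.one_closed]
    by (metis H.l_one N.r_one)
qed

lemma wreath_base_mult:
  assumes "group K" "group H" "u \<in> carrier (base_group K H)" "v \<in> carrier (base_group K H)"
  shows "(u, \<one>\<^bsub>H\<^esub>) \<otimes>\<^bsub>K \<wreath> H\<^esub> (v, \<one>\<^bsub>H\<^esub>) = (u \<otimes>\<^bsub>base_group K H\<^esub> v, \<one>\<^bsub>H\<^esub>)"
proof -
  interpret H: group H by fact
  have "translate H \<one>\<^bsub>H\<^esub> v = v"
    using assms by (auto simp: fun_eq_iff carrier_base_group PiE_def extensional_def)
  thus ?thesis unfolding mult_wreath by simp
qed

lemma wreath_base_induct [consumes 5, case_names one point]: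
  assumes K: "group K" and u: "u \<in> carrier (base_group K H)"
    and H: "group H" and P: "group P" and \<Phi>: "\<Phi> \<in> hom (K \<wreath> H) P"
    and one: "R \<one>\<^bsub>P\<^esub>"
    and point: "\<And>x a p. \<lbrakk>x \<in> carrier H; a \<in> carrier K; u x = a; a \<noteq> \<one>\<^bsub>K\<^esub>; p \<in> carrier P; R p\<rbrakk> \<Longrightarrow>
      R (\<Phi> (point_mass H K x a, \<one>\<^bsub>H\<^esub>) \<otimes>\<^bsub>P\<^esub> p)"
  shows "R (\<Phi> (u, \<one>\<^bsub>H\<^esub>))"
  using K u point
proof (induction rule: base_group_induct)
  case one
  interpret K: group K by fact
  interpret H: group H by fact
  interpret P: group P by fact
  interpret W: group "K \<wreath> H" using K H by (rule group_wreath_product)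
  have "\<Phi> \<one>\<^bsub>K \<wreath> H\<^esub> = \<one>\<^bsub>P\<^esub>" using hom_one[OF \<Phi> W.is_group P] .
  thus ?case using assms(6) by (simp only: one_wreath)
next
  case (point x a u)
  interpret K: group K by fact
  interpret H: group H by fact
  have c: "(u, \<one>\<^bsub>H\<^esub>) \<in> carrier (K \<wreath> H)" "(point_mass H K x a, \<one>\<^bsub>H\<^esub>) \<in> carrier (K \<wreath> H)"
    using point point_mass_closed[OF K point(2)] by (auto simp: carrier_wreath)
  have val: "(point_mass H K x a \<otimes>\<^bsub>base_group K H\<^esub> u) y = (if y = x then a else u y)"
    if "y \<in> carrier H" for y
    using that point K by (auto simp: point_mass_def carrier_base_group PiE_def Pi_def)
  have "\<Phi> (point_mass H K x a \<otimes>\<^bsub>base_group K H\<^esub> u, \<one>\<^bsub>H\<^esub>)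
    = \<Phi> (point_mass H K x a, \<one>\<^bsub>H\<^esub>) \<otimes>\<^bsub>P\<^esub> \<Phi> (u, \<one>\<^bsub>H\<^esub>)"
    using hom_mult[OF \<Phi> c(2,1)] point K H by (simp only: wreath_base_mult point_mass_closed)
  moreover have "R (\<Phi> (u, \<one>\<^bsub>H\<^esub>))"
  proof (rule point(6))
    fix y b p
    assume *: "y \<in> carrier H" "b \<in> carrier K" "u y = b" "b \<noteq> \<one>\<^bsub>K\<^esub>" "p \<in> carrier P" "R p"
    show "R (\<Phi> (point_mass H K y b, \<one>\<^bsub>H\<^esub>) \<otimes>\<^bsub>P\<^esub> p)"
      by (rule point(7)) (use * val point(5) in \<open>auto simp del: mult_sum_group\<close>)
  qed
  ultimately show ?case
    using point(7)[of x a "\<Phi> (u, \<one>\<^bsub>H\<^esub>)"] val point hom_in_carrier[OF \<Phi> c(1)] by (simp del: mult_sum_group)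
qed

text \<open>The subgroup \<open>Q\<close> contains the images of all lamps of a given configuration except the one at the
  origin, but not the image of that one, so the product cannot be trivial.  Hence the base group is
  embedded.  An element \<open>(u, h)\<close> of the kernel cannot have \<open>h \<noteq> 1\<close>, because \<open>h\<close> moves
  the lamp at the origin elsewhere.\<close>

theorem wreath_hom_inj:
  assumes P: "group P" and K: "group K" and H: "group H"
    and \<rho>: "\<rho> \<in> hom H P" and \<kappa>: "\<kappa> \<in> hom K P" and \<Phi>: "\<Phi> \<in> hom (K \<wreath> H) P"
    and \<Phi>\<rho>: "\<And>h. h \<in> carrier H \<Longrightarrow> \<Phi> (\<one>\<^bsub>base_group K H\<^esub>, h) = \<rho> h"
    and \<Phi>\<kappa>: "\<And>x a. \<lbrakk>x \<in> carrier H; a \<in> carrier K\<rbrakk> \<Longrightarrow>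
       \<Phi> (point_mass H K x a, \<one>\<^bsub>H\<^esub>) = \<rho> x \<otimes>\<^bsub>P\<^esub> \<kappa> a \<otimes>\<^bsub>P\<^esub> inv\<^bsub>P\<^esub> \<rho> x"
    and nontriv: "carrier K \<noteq> {\<one>\<^bsub>K\<^esub>}"
    and sep: "\<And>F a. \<lbrakk>finite F; F \<subseteq> carrier H; a \<in> carrier K; a \<noteq> \<one>\<^bsub>K\<^esub>\<rbrakk> \<Longrightarrow>
      \<exists>Q. subgroup Q P \<and> \<kappa> a \<notin> Q \<and>
        (\<forall>x \<in> F - {\<one>\<^bsub>H\<^esub>}. \<forall>b \<in> carrier K. \<rho> x \<otimes>\<^bsub>P\<^esub> \<kappa> b \<otimes>\<^bsub>P\<^esub> inv\<^bsub>P\<^esub> \<rho> x \<in> Q)"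
  shows "\<Phi> \<in> mon (K \<wreath> H) P"
proof -
  interpret P: group P by fact
  interpret K: group K by fact
  interpret H: group H by fact
  interpret N: group "base_group K H" using K by simp
  interpret W: group "K \<wreath> H" using K H by (rule group_wreath_product)
  interpret \<rho>: group_hom H P \<rho> by unfold_locales (rule \<rho>)
  interpret \<kappa>: group_hom K P \<kappa> by unfold_locales (rule \<kappa>)
  interpret \<Phi>: group_hom "K \<wreath> H" P \<Phi> by unfold_locales (rule \<Phi>)
  have base: "u = \<one>\<^bsub>base_group K H\<^esub>"
    if u: "u \<in> carrier (base_group K H)" and triv: "\<Phi> (u, \<one>\<^bsub>H\<^esub>) = \<one>\<^bsub>P\<^esub>" for u
  proof (rule ccontr)
    assume "u \<noteq> \<one>\<^bsub>base_group K H\<^esub>"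
    then obtain z where z: "z \<in> carrier H" "u z \<noteq> \<one>\<^bsub>K\<^esub>"
      using u K by (auto simp: carrier_base_group fun_eq_iff PiE_def extensional_def split: if_splits)
    have uz: "u z \<in> carrier K" using u z K by (auto simp: carrier_base_group)
    define v where "v = translate H (inv\<^bsub>H\<^esub> z) u"
    have v: "v \<in> carrier (base_group K H)"
      unfolding v_def by (rule translate_closed[OF K H _ u]) (use z in simp)
    have v1: "v \<one>\<^bsub>H\<^esub> = u z" using z by (simp add: v_def)
    \<comment> \<open>After a translation the nontrivial lamp \<open>z\<close> is at the origin.\<close>
    have "(\<one>\<^bsub>base_group K H\<^esub>, inv\<^bsub>H\<^esub> z) \<otimes>\<^bsub>K \<wreath> H\<^esub> (u, \<one>\<^bsub>H\<^esub>) = (v, inv\<^bsub>H\<^esub> z)"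
      using v z N.l_one[OF v] by (simp add: mult_wreath v_def del: mult_sum_group one_sum_group)
    moreover have "(v, inv\<^bsub>H\<^esub> z) = (v, \<one>\<^bsub>H\<^esub>) \<otimes>\<^bsub>K \<wreath> H\<^esub> (\<one>\<^bsub>base_group K H\<^esub>, inv\<^bsub>H\<^esub> z)"
      by (rule wreath_split[OF K H v]) (use z in simp)
    ultimately have "(v, \<one>\<^bsub>H\<^esub>) \<otimes>\<^bsub>K \<wreath> H\<^esub> (\<one>\<^bsub>base_group K H\<^esub>, inv\<^bsub>H\<^esub> z)
      = (\<one>\<^bsub>base_group K H\<^esub>, inv\<^bsub>H\<^esub> z) \<otimes>\<^bsub>K \<wreath> H\<^esub> (u, \<one>\<^bsub>H\<^esub>)" by simp
    hence "\<Phi> ((v, \<one>\<^bsub>H\<^esub>) \<otimes>\<^bsub>K \<wreath> H\<^esub> (\<one>\<^bsub>base_group K H\<^esub>, inv\<^bsub>H\<^esub> z))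
      = \<Phi> ((\<one>\<^bsub>base_group K H\<^esub>, inv\<^bsub>H\<^esub> z) \<otimes>\<^bsub>K \<wreath> H\<^esub> (u, \<one>\<^bsub>H\<^esub>))" by (rule arg_cong)
    moreover have mem: "(v, \<one>\<^bsub>H\<^esub>) \<in> carrier (K \<wreath> H)" "(u, \<one>\<^bsub>H\<^esub>) \<in> carrier (K \<wreath> H)"
      "(\<one>\<^bsub>base_group K H\<^esub>, inv\<^bsub>H\<^esub> z) \<in> carrier (K \<wreath> H)"
      using u v z N.one_closed by (simp_all add: carrier_wreath del: one_sum_group)
    moreover have "\<Phi> (\<one>\<^bsub>base_group K H\<^esub>, inv\<^bsub>H\<^esub> z) = \<rho> (inv\<^bsub>H\<^esub> z)"
      by (rule \<Phi>\<rho>) (use z in simp)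
    ultimately have "\<Phi> (v, \<one>\<^bsub>H\<^esub>) \<otimes>\<^bsub>P\<^esub> \<rho> (inv\<^bsub>H\<^esub> z) = \<rho> (inv\<^bsub>H\<^esub> z) \<otimes>\<^bsub>P\<^esub> \<one>\<^bsub>P\<^esub>"
      by (simp only: \<Phi>.hom_mult triv)
    hence trivv: "\<Phi> (v, \<one>\<^bsub>H\<^esub>) = \<one>\<^bsub>P\<^esub>"
      using \<Phi>.hom_closed[OF mem(1)] z by simp
    define w where "w = v (\<one>\<^bsub>H\<^esub> := \<one>\<^bsub>K\<^esub>)"
    define F where "F = {x \<in> carrier H. v x \<noteq> \<one>\<^bsub>K\<^esub>}"
    have F: "finite F" "F \<subseteq> carrier H" using v K by (auto simp: F_def carrier_base_group)
    obtain Q where Q: "subgroup Q P" "\<kappa> (u z) \<notin> Q"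
      "\<And>x b. \<lbrakk>x \<in> F; x \<noteq> \<one>\<^bsub>H\<^esub>; b \<in> carrier K\<rbrakk> \<Longrightarrow> \<rho> x \<otimes>\<^bsub>P\<^esub> \<kappa> b \<otimes>\<^bsub>P\<^esub> inv\<^bsub>P\<^esub> \<rho> x \<in> Q"
      using sep[OF F uz z(2)] by blast
    interpret Q: subgroup Q P by fact
    have sw: "{x \<in> carrier H. w x \<noteq> \<one>\<^bsub>K\<^esub>} \<subseteq> F" by (auto simp: w_def F_def)
    have w: "w \<in> carrier (base_group K H)"
      unfolding carrier_base_group[OF K] using v finite_subset[OF sw F(1)] K
      by (auto simp: carrier_base_group PiE_def extensional_def w_def Pi_def)
    have "\<Phi> (w, \<one>\<^bsub>H\<^esub>) \<in> Q"
      using K w H P \<Phi>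
    proof (induction rule: wreath_base_induct)
      case (point x a p)
      have "x \<in> F" "x \<noteq> \<one>\<^bsub>H\<^esub>" using point by (auto simp: w_def F_def split: if_splits)
      thus ?case using point Q(3) by (simp add: \<Phi>\<kappa>)
    qed simp
    moreover have "v = point_mass H K \<one>\<^bsub>H\<^esub> (u z) \<otimes>\<^bsub>base_group K H\<^esub> w"
      using v v1 K uz by (auto simp: point_mass_def w_def fun_eq_iff carrier_base_group PiE_def extensional_def Pi_def)
    hence "\<Phi> (v, \<one>\<^bsub>H\<^esub>) = \<kappa> (u z) \<otimes>\<^bsub>P\<^esub> \<Phi> (w, \<one>\<^bsub>H\<^esub>)"
      using w uz wreath_base_mult[OF K H point_mass_closed[OF K uz] w, of "\<one>\<^bsub>H\<^esub>"]
        \<Phi>.hom_mult[of "(point_mass H K \<one>\<^bsub>H\<^esub> (u z), \<one>\<^bsub>H\<^esub>)" "(w, \<one>\<^bsub>H\<^esub>)"] \<Phi>\<kappa>[of "\<one>\<^bsub>H\<^esub>" "u z"]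
        point_mass_closed[OF K uz, where H = H and x = "\<one>\<^bsub>H\<^esub>"]
      by (simp add: carrier_wreath del: mult_sum_group)
    ultimately have "\<kappa> (u z) = inv\<^bsub>P\<^esub> \<Phi> (w, \<one>\<^bsub>H\<^esub>)" "\<Phi> (w, \<one>\<^bsub>H\<^esub>) \<in> Q"
      using trivv uz P.inv_equality[of "\<kappa> (u z)" "\<Phi> (w, \<one>\<^bsub>H\<^esub>)"] by auto
    thus False using Q(2) by simp
  qed
  have base_inj: "u = v"
    if u: "u \<in> carrier (base_group K H)" and v: "v \<in> carrier (base_group K H)" and h: "h \<in> carrier H"
      and eq: "\<Phi> (u, h) = \<Phi> (v, h)" for u v h
  proof -
    have mem: "(u', \<one>\<^bsub>H\<^esub>) \<in> carrier (K \<wreath> H)" if "u' \<in> carrier (base_group K H)" for u'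
      using that by (simp add: carrier_wreath)
    have "\<Phi> (u', h) = \<Phi> (u', \<one>\<^bsub>H\<^esub>) \<otimes>\<^bsub>P\<^esub> \<rho> h" if "u' \<in> carrier (base_group K H)" for u'
    proof -
      have "(\<one>\<^bsub>base_group K H\<^esub>, h) \<in> carrier (K \<wreath> H)"
        using h N.one_closed by (simp add: carrier_wreath del: one_sum_group)
      from \<Phi>.hom_mult[OF mem[OF that] this] show ?thesis
        by (simp only: \<Phi>\<rho>[OF h] flip: wreath_split[OF K H that h])
    qed
    hence eq1: "\<Phi> (u, \<one>\<^bsub>H\<^esub>) = \<Phi> (v, \<one>\<^bsub>H\<^esub>)"
      using eq u v h \<Phi>.hom_closed[OF mem] by simp
    define d where "d = inv\<^bsub>base_group K H\<^esub> v"
    have d: "d \<in> carrier (base_group K H)" unfolding d_def using v by (rule N.inv_closed)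
    have "\<Phi> (d \<otimes>\<^bsub>base_group K H\<^esub> u, \<one>\<^bsub>H\<^esub>) = \<Phi> (d \<otimes>\<^bsub>base_group K H\<^esub> v, \<one>\<^bsub>H\<^esub>)"
      using eq1 \<Phi>.hom_mult[OF mem[OF d] mem[OF u]] \<Phi>.hom_mult[OF mem[OF d] mem[OF v]]
      by (simp only: wreath_base_mult[OF K H d u] wreath_base_mult[OF K H d v])
    also have "\<dots> = \<one>\<^bsub>P\<^esub>"
      using \<Phi>.hom_one N.l_inv[OF v] by (simp only: d_def one_wreath)
    finally have "d \<otimes>\<^bsub>base_group K H\<^esub> u = \<one>\<^bsub>base_group K H\<^esub>"
      using base d u N.m_closed by blast
    hence "inv\<^bsub>base_group K H\<^esub> u = inv\<^bsub>base_group K H\<^esub> v"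
      unfolding d_def[symmetric] by (rule N.inv_equality) (rule u, rule d)
    hence "inv\<^bsub>base_group K H\<^esub> (inv\<^bsub>base_group K H\<^esub> u) = inv\<^bsub>base_group K H\<^esub> (inv\<^bsub>base_group K H\<^esub> v)"
      by (rule arg_cong)
    thus ?thesis by (simp only: N.inv_inv[OF u] N.inv_inv[OF v])
  qed
  have "inj_on \<Phi> (carrier (K \<wreath> H))"
  proof (rule \<Phi>.inj_on_one_iff[THEN iffD2], intro allI impI)
    fix w assume w: "w \<in> carrier (K \<wreath> H)" and triv: "\<Phi> w = \<one>\<^bsub>P\<^esub>"
    obtain u h where uh: "w = (u, h)" "u \<in> carrier (base_group K H)" "h \<in> carrier H"
      using w by (auto simp: carrier_wreath)
    obtain a where a: "a \<in> carrier K" "a \<noteq> \<one>\<^bsub>K\<^esub>" using nontriv K.one_closed by blast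
    define p where "p = point_mass H K \<one>\<^bsub>H\<^esub> a"
    have p: "p \<in> carrier (base_group K H)" unfolding p_def by (rule point_mass_closed[OF K a(1)])
    have tp: "translate H h p \<in> carrier (base_group K H)" by (rule translate_closed[OF K H uh(3) p])
    \<comment> \<open>An element of the kernel commutes, modulo the kernel, with the lamp \<open>p\<close> at the origin.
      Since the base group embeds, conjugation by \<open>h\<close> must keep this lamp at the origin.\<close>
    have "\<Phi> (u \<otimes>\<^bsub>base_group K H\<^esub> translate H h p, h) = \<Phi> (p, \<one>\<^bsub>H\<^esub>)"
      using \<Phi>.hom_mult[of w "(p, \<one>\<^bsub>H\<^esub>)"] w triv p uh(3) \<Phi>.hom_closed[of "(p, \<one>\<^bsub>H\<^esub>)"]
      by (simp add: uh(1) mult_wreath carrier_wreath del: mult_sum_group)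
    moreover have "(p, \<one>\<^bsub>H\<^esub>) \<otimes>\<^bsub>K \<wreath> H\<^esub> w = (p \<otimes>\<^bsub>base_group K H\<^esub> u, h)"
    proof -
      have "translate H \<one>\<^bsub>H\<^esub> u = u"
        using uh(2) K by (auto simp: fun_eq_iff carrier_base_group PiE_def extensional_def)
      thus ?thesis using uh by (simp only: uh(1) mult_wreath H.l_one)
    qed
    hence "\<Phi> (p \<otimes>\<^bsub>base_group K H\<^esub> u, h) = \<Phi> (p, \<one>\<^bsub>H\<^esub>)"
      using \<Phi>.hom_mult[of "(p, \<one>\<^bsub>H\<^esub>)" w] w triv p \<Phi>.hom_closed[of "(p, \<one>\<^bsub>H\<^esub>)"]
      by (simp add: carrier_wreath)
    ultimately have "\<Phi> (u \<otimes>\<^bsub>base_group K H\<^esub> translate H h p, h) = \<Phi> (p \<otimes>\<^bsub>base_group K H\<^esub> u, h)"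
      by simp
    hence eq: "u \<otimes>\<^bsub>base_group K H\<^esub> translate H h p = p \<otimes>\<^bsub>base_group K H\<^esub> u"
      using base_inj[OF N.m_closed[OF uh(2) tp] N.m_closed[OF p uh(2)]] uh(3) by blast
    have "h = \<one>\<^bsub>H\<^esub>"
    proof (rule ccontr)
      assume "h \<noteq> \<one>\<^bsub>H\<^esub>"
      moreover have "u h \<in> carrier K" using uh K by (auto simp: carrier_base_group)
      ultimately have "u h \<otimes>\<^bsub>K\<^esub> a = u h"
        using fun_cong[OF eq, of h] uh(3) by (simp add: p_def point_mass_def)
      thus False using a \<open>u h \<in> carrier K\<close> by simp
    qed
    thus "w = \<one>\<^bsub>K \<wreath> H\<^esub>" using base uh triv by (simp add: one_wreath del: one_sum_group)
  qed
  thus ?thesis using \<Phi> by (simp add: mon_def)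
qed

section \<open>Cellular automata on configurations with holes\<close>

type_synonym 's config = "int \<Rightarrow> 's option"

definition configs_on :: "'s set \<Rightarrow> 's config set" where
  "configs_on S = {y. \<forall>i. set_option (y i) \<subseteq> S}"

definition is_local :: "('s config \<Rightarrow> 's config) \<Rightarrow> bool" where
  "is_local F \<longleftrightarrow> (\<exists>r::nat. \<forall>y z i. (\<forall>j. \<bar>j - i\<bar> \<le> int r \<longrightarrow> y j = z j) \<longrightarrow> F y i = F z i)"

definition shift_equivariant :: "('s config \<Rightarrow> 's config) \<Rightarrow> bool" where
  "shift_equivariant F \<longleftrightarrow> (\<forall>y k. F (\<lambda>j. y (j + k)) = (\<lambda>j. F y (j + k)))"

definition preserves_holes :: "('s config \<Rightarrow> 's config) \<Rightarrow> bool" where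
  "preserves_holes F \<longleftrightarrow> (\<forall>y i. F y i = None \<longleftrightarrow> y i = None)"

text \<open>Holes are the places that carry no symbol.  An automaton never moves them, so that after
  coding symbols by blocks only the contents of the blocks change.\<close>

definition hole_CA :: "'s set \<Rightarrow> ('s config \<Rightarrow> 's config) \<Rightarrow> bool" where
  "hole_CA S F \<longleftrightarrow> is_local F \<and> shift_equivariant F \<and> preserves_holes F \<and> F \<in> configs_on S \<rightarrow> configs_on S"

lemma hole_CA_translate:
  assumes "hole_CA S F"
  shows "F (\<lambda>j. y (j + k)) i = F y (i + k)"
proof -
  have "shift_equivariant F" using assms by (simp add: hole_CA_def)
  hence "F (\<lambda>j. y (j + k)) = (\<lambda>j. F y (j + k))" unfolding shift_equivariant_def by (elim allE)
  thus ?thesis by (rule fun_cong)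
qed

lemma hole_CA_None:
  assumes "hole_CA S F"
  shows "F y i = None \<longleftrightarrow> y i = None"
proof -
  have "preserves_holes F" using assms by (simp add: hole_CA_def)
  thus ?thesis unfolding preserves_holes_def by (elim allE)
qed

lemma hole_CA_closed: "hole_CA S F \<Longrightarrow> y \<in> configs_on S \<Longrightarrow> F y \<in> configs_on S"
  by (auto simp: hole_CA_def)

lemma hole_CAI:
  assumes "is_local F" "\<And>y k i. F (\<lambda>j. y (j + k)) i = F y (i + k)"
    "\<And>y i. F y i = None \<longleftrightarrow> y i = None" "\<And>y. y \<in> configs_on S \<Longrightarrow> F y \<in> configs_on S"
  shows "hole_CA S F"
proof -
  have "shift_equivariant F"
    unfolding shift_equivariant_def by (intro allI ext) (rule assms(2))
  moreover have "preserves_holes F"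
    unfolding preserves_holes_def by (intro allI) (rule assms(3))
  moreover have "F \<in> configs_on S \<rightarrow> configs_on S" using assms(4) by (rule Pi_I)
  ultimately show ?thesis using assms(1) by (simp add: hole_CA_def)
qed

lemma is_local_comp:
  assumes "is_local F" "is_local G"
  shows "is_local (F \<circ> G)"
proof -
  obtain r where r: "\<And>y z i. (\<And>j. \<bar>j - i\<bar> \<le> int r \<Longrightarrow> y j = z j) \<Longrightarrow> F y i = F z i"
    using assms(1) unfolding is_local_def by blast
  obtain s where s: "\<And>y z i. (\<And>j. \<bar>j - i\<bar> \<le> int s \<Longrightarrow> y j = z j) \<Longrightarrow> G y i = G z i"
    using assms(2) unfolding is_local_def by blast
  show ?thesis
    unfolding is_local_def comp_apply
  proof (intro exI[of _ "r + s"] allI impI)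
    fix y z :: "'a config" and i
    assume yz: "\<forall>j. \<bar>j - i\<bar> \<le> int (r + s) \<longrightarrow> y j = z j"
    show "F (G y) i = F (G z) i"
    proof (rule r, rule s)
      fix j k :: int assume "\<bar>j - i\<bar> \<le> int r" "\<bar>k - j\<bar> \<le> int s"
      hence "\<bar>k - i\<bar> \<le> int (r + s)" by linarith
      thus "y k = z k" using yz by blast
    qed
  qed
qed

lemma hole_CA_id: "hole_CA S (\<lambda>y. y)"
proof (rule hole_CAI)
  show "is_local (\<lambda>y::'a config. y)" unfolding is_local_def by (rule exI[of _ 0]) simp
qed simp_all

lemma hole_CA_comp:
  assumes F: "hole_CA S F" and G: "hole_CA S G"
  shows "hole_CA S (F \<circ> G)"
proof (rule hole_CAI)
  show "is_local (F \<circ> G)" using F G is_local_comp unfolding hole_CA_def by blast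
  fix y k i
  have "G (\<lambda>j. y (j + k)) = (\<lambda>j. G y (j + k))" using hole_CA_translate[OF G] by blast
  thus "(F \<circ> G) (\<lambda>j. y (j + k)) i = (F \<circ> G) y (i + k)"
    using hole_CA_translate[OF F, of "G y"] by (simp only: comp_apply)
qed (use hole_CA_None[OF F] hole_CA_None[OF G] hole_CA_closed[OF F] hole_CA_closed[OF G] in auto)

section \<open>Embedding automata with holes into the automorphism group of a full shift\<close>

lemma continuous_map_full_shift_local:
  assumes closed: "\<And>x. x \<in> topspace (full_shift A) \<Longrightarrow> f x \<in> topspace (full_shift A)"
    and loc: "\<And>i. \<exists>E. finite E \<and> (\<forall>x z. (\<forall>j\<in>E. x j = z j) \<longrightarrow> f x i = f z i)"
  shows "continuous_map (full_shift A) (full_shift A) f"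
proof -
  have "continuous_map (full_shift A) (discrete_topology A) (\<lambda>x. f x i)" for i
  proof -
    obtain E where E0: "finite E \<and> (\<forall>x z. (\<forall>j\<in>E. x j = z j) \<longrightarrow> f x i = f z i)"
      using loc[of i] by (rule exE)
    have E: "finite E" using E0 by (rule conjunct1)
    have E_det: "f x i = f z i" if "\<And>j. j \<in> E \<Longrightarrow> x j = z j" for x z
      by (rule conjunct2[OF E0, THEN spec, THEN spec, THEN mp]) (rule ballI, rule that)
    have "openin (full_shift A) {x \<in> topspace (full_shift A). f x i \<in> U}" for U
    proof (subst openin_subopen, intro ballI)
      fix x assume x: "x \<in> {x \<in> topspace (full_shift A). f x i \<in> U}"
      define T where "T = (\<Pi>\<^sub>E j\<in>UNIV. if j \<in> E then {x j} else A)"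
      have "openin (full_shift A) T"
        unfolding T_def full_shift_def
      proof (rule product_topology_basis)
        show "openin (discrete_topology A) (if j \<in> E then {x j} else A)" for j
          using x by (auto simp: topspace_full_shift)
        show "finite {j. (if j \<in> E then {x j} else A) \<noteq> topspace (discrete_topology A)}"
          using E by (rule rev_finite_subset) auto
      qed
      moreover have "x \<in> T" using x by (auto simp: T_def topspace_full_shift)
      moreover have "T \<subseteq> {x \<in> topspace (full_shift A). f x i \<in> U}"
      proof
        fix z assume "z \<in> T"
        hence zT: "z j \<in> (if j \<in> E then {x j} else A)" for j
          unfolding T_def by (rule PiE_mem) simp
        have eq: "z j = x j" if "j \<in> E" for j using zT[of j] that by simp
        have "z j \<in> A" for j
          using zT[of j] eq[of j] x by (cases "j \<in> E") (auto simp: topspace_full_shift)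
        moreover have "f z i = f x i" by (rule E_det) (rule eq)
        ultimately show "z \<in> {x \<in> topspace (full_shift A). f x i \<in> U}"
          using x by (simp add: topspace_full_shift)
      qed
      ultimately show "\<exists>T. openin (full_shift A) T \<and> x \<in> T \<and> T \<subseteq> {x \<in> topspace (full_shift A). f x i \<in> U}"
        by blast
    qed
    moreover have "f x i \<in> A" if "x \<in> topspace (full_shift A)" for x
      using closed[OF that] by (simp add: topspace_full_shift)
    ultimately show ?thesis by (simp add: continuous_map_def Pi_def)
  qed
  hence "continuous_map (full_shift A) (product_topology (\<lambda>i. discrete_topology A) UNIV) f"
    by (simp add: continuous_map_componentwise_UNIV)
  thus ?thesis unfolding full_shift_def[of A, symmetric] .
qed

text \<open>Symbols are coded over the alphabet \<open>A\<close> with two distinct letters \<open>a0\<close> and \<open>a1\<close>.  The block of the symbol with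
  index \<open>k\<close> has \<open>a1\<close> at the offsets \<open>0\<close>, \<open>1\<close>, \<open>k + 3\<close> and \<open>a0\<close> elsewhere.  It starts with \<open>1 1 0\<close> and
  contains no other pair of adjacent \<open>a1\<close>.  The length leaves a final \<open>a0\<close> after the last possible offset.\<close>

locale block_code =
  fixes A :: "'a set" and a0 a1 :: 'a and S :: "'s set" and idx :: "'s \<Rightarrow> nat" and q :: nat
  assumes a01: "a0 \<in> A" "a1 \<in> A" "a0 \<noteq> a1"
    and idx: "inj_on idx S" "\<And>s. s \<in> S \<Longrightarrow> idx s < q"
begin

definition len :: int where "len = int q + 4"

definition ones :: "'s \<Rightarrow> int set" where "ones s = {0, 1, 3 + int (idx s)}"

definition block :: "(int \<Rightarrow> 'a) \<Rightarrow> int \<Rightarrow> 's \<Rightarrow> bool" where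
  "block x i s \<longleftrightarrow> (\<forall>k. 0 \<le> k \<and> k < len \<longrightarrow> x (i + k) = (if k \<in> ones s then a1 else a0))"

lemma len_pos: "len > 0" by (simp add: len_def)

lemma ones_bounds: "s \<in> S \<Longrightarrow> k \<in> ones s \<Longrightarrow> 0 \<le> k \<and> k < len - 1"
  using idx(2)[of s] by (auto simp: ones_def len_def)

lemma block_unique:
  assumes "block x i s" "block x i t" "s \<in> S" "t \<in> S"
  shows "s = t"
proof -
  have k: "0 \<le> 3 + int (idx s)" "3 + int (idx s) < len"
    using idx(2)[OF assms(3)] by (auto simp: len_def)
  have "x (i + (3 + int (idx s))) = a1" using assms(1) k unfolding block_def by (simp add: ones_def)
  moreover have "x (i + (3 + int (idx s))) = (if 3 + int (idx s) \<in> ones t then a1 else a0)"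
    using assms(2) k unfolding block_def by blast
  ultimately have "idx s = idx t" using a01(3) by (auto simp: ones_def split: if_splits)
  thus ?thesis using idx(1) assms(3,4) by (auto dest: inj_onD)
qed

text \<open>An overlapping block would begin with a pair of adjacent \<open>a1\<close> inside the first block, but the only such pair
  is at the very beginning.\<close>

lemma block_no_overlap:
  assumes b: "block x i s" "block x j t" and st: "s \<in> S" "t \<in> S" and ij: "i < j" "j < i + len"
  shows False
proof -
  define k where "k = j - i"
  have k: "0 < k" "k < len" using ij by (auto simp: k_def)
  have j0: "x j = a1" using b(2)[unfolded block_def, rule_format, of 0] len_pos by (simp add: ones_def)
  have j1: "x (j + 1) = a1" using b(2)[unfolded block_def, rule_format, of 1] by (simp add: ones_def len_def)
  have "k \<in> ones s"
    using b(1)[unfolded block_def, rule_format, of k] k j0 a01(3) by (auto simp: k_def split: if_splits)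
  moreover have "k + 1 \<in> ones s"
    using b(1)[unfolded block_def, rule_format, of "k + 1"] k j1 a01(3) ones_bounds[OF st(1) \<open>k \<in> ones s\<close>]
    by (auto simp: k_def algebra_simps split: if_splits)
  ultimately show False using k by (auto simp: ones_def)
qed

definition dec :: "(int \<Rightarrow> 'a) \<Rightarrow> 's config" where
  "dec x i = (if \<exists>s\<in>S. block x i s then Some (THE s. s \<in> S \<and> block x i s) else None)"

lemma dec_Some_iff: "dec x i = Some s \<longleftrightarrow> s \<in> S \<and> block x i s"
proof -
  have "(THE t. t \<in> S \<and> block x i t) = s" if "s \<in> S" "block x i s" for s
    using that block_unique by blast
  thus ?thesis unfolding dec_def by auto
qed

lemma dec_None_iff: "dec x i = None \<longleftrightarrow> (\<forall>s\<in>S. \<not> block x i s)"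
  by (simp add: dec_def)

lemma dec_configs: "dec x \<in> configs_on S"
  by (auto simp: configs_on_def dec_Some_iff elim!: option.set_cases)

definition spaced :: "'s config \<Rightarrow> bool" where
  "spaced y \<longleftrightarrow> (\<forall>i j. y i \<noteq> None \<longrightarrow> y j \<noteq> None \<longrightarrow> i < j \<longrightarrow> i + len \<le> j)"

lemma spacedD:
  assumes y: "spaced y" and i: "y i = Some s" and j: "y j = Some t" and ij: "\<bar>i - j\<bar> < len"
  shows "i = j"
proof (rule linorder_cases[of i j])
  assume "i < j"
  hence "i + len \<le> j" using y i j unfolding spaced_def by simp
  thus ?thesis using ij by linarith
next
  assume "j < i"
  hence "j + len \<le> i" using y i j unfolding spaced_def by simp
  thus ?thesis using ij by linarith
qed

lemma spaced_dec: "spaced (dec x)"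
  unfolding spaced_def
proof (intro allI impI)
  fix i j :: int
  assume "dec x i \<noteq> None" "dec x j \<noteq> None" and ij: "i < j"
  then obtain s t where "dec x i = Some s" "dec x j = Some t" by auto
  hence "block x i s" "block x j t" "s \<in> S" "t \<in> S" by (simp_all add: dec_Some_iff)
  thus "i + len \<le> j" using block_no_overlap[of x i s j t] ij by (cases "j < i + len") auto
qed

definition covered :: "'s config \<Rightarrow> int \<Rightarrow> bool" where
  "covered y j \<longleftrightarrow> (\<exists>i. y i \<noteq> None \<and> i \<le> j \<and> j < i + len)"

definition rewrite :: "(int \<Rightarrow> 'a) \<Rightarrow> 's config \<Rightarrow> int \<Rightarrow> 'a" where
  "rewrite x y j = (if covered y j then if \<exists>i s. y i = Some s \<and> j - i \<in> ones s then a1 else a0 else x j)"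

lemma block_rewrite:
  assumes y: "spaced y" "y \<in> configs_on S" and i: "y i = Some s"
  shows "block (rewrite x y) i s"
  unfolding block_def
proof (intro allI impI)
  fix k assume k: "0 \<le> k \<and> k < len"
  have cov: "covered y (i + k)" unfolding covered_def using k i by (intro exI[of _ i]) auto
  have "(\<exists>j t. y j = Some t \<and> i + k - j \<in> ones t) \<longleftrightarrow> k \<in> ones s"
  proof
    assume "\<exists>j t. y j = Some t \<and> i + k - j \<in> ones t"
    then obtain j t where jt: "y j = Some t" "i + k - j \<in> ones t" by blast
    hence "t \<in> S" using y(2) by (force simp: configs_on_def)
    hence "\<bar>i - j\<bar> < len" using ones_bounds[OF _ jt(2)] k by auto
    hence "i = j" using spacedD[OF y(1) i jt(1)] by simp
    thus "k \<in> ones s" using jt i by simp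
  next
    assume "k \<in> ones s"
    thus "\<exists>j t. y j = Some t \<and> i + k - j \<in> ones t" using i by (intro exI[of _ i] exI[of _ s]) simp
  qed
  thus "rewrite x y (i + k) = (if k \<in> ones s then a1 else a0)"
    using cov by (simp add: rewrite_def)
qed

text \<open>Rewriting creates no new blocks.  A block of the result at a place that \<open>y\<close> leaves empty either
  overlaps a block written for \<open>y\<close>, which is impossible, or lies where \<open>x\<close> is unchanged.\<close>

lemma dec_rewrite:
  assumes y: "spaced y" "y \<in> configs_on S" and None: "\<And>i. y i = None \<Longrightarrow> dec x i = None"
  shows "dec (rewrite x y) = y"
proof
  fix i
  show "dec (rewrite x y) i = y i"
  proof (cases "y i")
    case (Some s)
    hence "s \<in> S" using y(2) by (force simp: configs_on_def)
    thus ?thesis using block_rewrite[OF y Some] Some dec_Some_iff by simp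
  next
    case N: None
    have "\<not> block (rewrite x y) i s" if s: "s \<in> S" for s
    proof
      assume b: "block (rewrite x y) i s"
      show False
      proof (cases "\<exists>j t. y j = Some t \<and> \<bar>j - i\<bar> < len")
        case True
        then obtain j t where jt: "y j = Some t" "\<bar>j - i\<bar> < len" by blast
        have "t \<in> S" using jt y(2) by (force simp: configs_on_def)
        moreover have "block (rewrite x y) j t" using block_rewrite[OF y jt(1)] .
        moreover have "i \<noteq> j" using jt N by auto
        ultimately show False
        proof (cases "i < j")
          case True
          show False
            by (rule block_no_overlap[OF b \<open>block (rewrite x y) j t\<close> s \<open>t \<in> S\<close> True]) (use jt(2) in linarith)
        next
          case False
          hence "j < i" using \<open>i \<noteq> j\<close> by simp
          show False
            by (rule block_no_overlap[OF \<open>block (rewrite x y) j t\<close> b \<open>t \<in> S\<close> s \<open>j < i\<close>]) (use jt(2) in linarith)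
        qed
      next
        case False
        have "\<not> covered y (i + k)" if "0 \<le> k" "k < len" for k
        proof
          assume "covered y (i + k)"
          then obtain j where j: "y j \<noteq> None" "j \<le> i + k" "i + k < j + len" by (auto simp: covered_def)
          hence "\<bar>j - i\<bar> < len" using that by auto
          moreover obtain t where "y j = Some t" using j(1) by blast
          ultimately show False using False by blast
        qed
        hence "block x i s" using b by (auto simp: block_def rewrite_def)
        thus False using None[OF N] s by (simp add: dec_None_iff)
      qed
    qed
    thus ?thesis using N by (simp add: dec_None_iff)
  qed
qed

lemma covered_cong: "(\<And>i. y i = None \<longleftrightarrow> z i = None) \<Longrightarrow> covered y = covered z"
  unfolding covered_def by auto

lemma rewrite_rewrite:
  assumes "\<And>i. y i = None \<longleftrightarrow> z i = None"
  shows "rewrite (rewrite x y) z = rewrite x z"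
  unfolding rewrite_def[abs_def] covered_cong[OF assms] by auto

lemma rewrite_dec: "rewrite x (dec x) = x"
proof
  fix j
  show "rewrite x (dec x) j = x j"
  proof (cases "covered (dec x) j")
    case True
    then obtain i s where i: "dec x i = Some s" "i \<le> j" "j < i + len" by (auto simp: covered_def)
    have val: "x j = (if j - i \<in> ones s then a1 else a0)"
    proof -
      have "block x i s" using i(1) by (simp add: dec_Some_iff)
      hence "x (i + (j - i)) = (if j - i \<in> ones s then a1 else a0)"
        unfolding block_def by (rule allE[of _ "j - i"]) (use i(2,3) in auto)
      thus ?thesis by simp
    qed
    have "x j = a1" if "dec x i' = Some t" "j - i' \<in> ones t" for i' t
    proof -
      have "t \<in> S" "block x i' t" using that dec_Some_iff by auto
      moreover have "0 \<le> j - i' \<and> j - i' < len" using ones_bounds[OF \<open>t \<in> S\<close> that(2)] by linarith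
      ultimately have "x (i' + (j - i')) = (if j - i' \<in> ones t then a1 else a0)"
        unfolding block_def by blast
      thus ?thesis using that(2) by simp
    qed
    hence a1: "x j = a1" if "\<exists>i' t. dec x i' = Some t \<and> j - i' \<in> ones t" using that by blast
    show ?thesis
    proof (cases "\<exists>i' t. dec x i' = Some t \<and> j - i' \<in> ones t")
      case ex: True
      thus ?thesis using a1[OF ex] True by (simp add: rewrite_def)
    next
      case False
      hence "j - i \<notin> ones s" using i(1) by blast
      thus ?thesis unfolding rewrite_def using val False True by auto
    qed
  qed (simp add: rewrite_def)
qed

text \<open>Neighbouring symbols are coded by blocks that touch, so their positions differ by the block
  length.  The automaton runs independently on each residue class of positions.\<close>

definition on_cosets :: "('s config \<Rightarrow> 's config) \<Rightarrow> 's config \<Rightarrow> 's config" where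
  "on_cosets F y i = F (\<lambda>k. y (i + len * k)) 0"

lemma on_cosets_coset:
  assumes "hole_CA S F"
  shows "on_cosets F y (i + len * k) = F (\<lambda>k. y (i + len * k)) k"
proof -
  have "on_cosets F y (i + len * k) = F (\<lambda>j. (\<lambda>k. y (i + len * k)) (j + k)) 0"
    unfolding on_cosets_def by (simp add: algebra_simps)
  also have "\<dots> = F (\<lambda>k. y (i + len * k)) k"
    by (simp only: hole_CA_translate[OF assms, of "\<lambda>k. y (i + len * k)"] add_0)
  finally show ?thesis .
qed

lemma on_cosets_comp:
  assumes "hole_CA S F" "hole_CA S G"
  shows "on_cosets (F \<circ> G) y = on_cosets F (on_cosets G y)"
proof
  fix i
  have "(\<lambda>k. on_cosets G y (i + len * k)) = G (\<lambda>k. y (i + len * k))"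
    using on_cosets_coset[OF assms(2)] by blast
  thus "on_cosets (F \<circ> G) y i = on_cosets F (on_cosets G y) i"
    by (simp add: on_cosets_def[of F] on_cosets_def[of "F \<circ> G"])
qed

lemma on_cosets_None: "hole_CA S F \<Longrightarrow> on_cosets F y i = None \<longleftrightarrow> y i = None"
  using hole_CA_None[of S F "\<lambda>k. y (i + len * k)" 0] by (simp add: on_cosets_def)

lemma on_cosets_configs:
  assumes "hole_CA S F" "y \<in> configs_on S"
  shows "on_cosets F y \<in> configs_on S"
proof -
  have "F (\<lambda>k. y (i + len * k)) \<in> configs_on S" for i
    by (rule hole_CA_closed[OF assms(1)]) (use assms(2) in \<open>simp add: configs_on_def\<close>)
  thus ?thesis by (auto simp: configs_on_def on_cosets_def)
qed

text \<open>Decode, apply the automaton, write the new blocks over the old ones.  Since holes are preserved,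
  exactly the old blocks are overwritten, and \<open>lift\<close> is compatible with composition.\<close>

definition lift :: "('s config \<Rightarrow> 's config) \<Rightarrow> (int \<Rightarrow> 'a) \<Rightarrow> int \<Rightarrow> 'a" where
  "lift F x = rewrite x (on_cosets F (dec x))"

lemma dec_lift: 
  assumes "hole_CA S F"
  shows "dec (lift F x) = on_cosets F (dec x)"
proof -
  have sp: "spaced (on_cosets F (dec x))"
    using spaced_dec[of x] unfolding spaced_def on_cosets_None[OF assms] .
  show ?thesis
    unfolding lift_def
  proof (rule dec_rewrite[OF sp on_cosets_configs[OF assms dec_configs]])
    fix i assume "on_cosets F (dec x) i = None"
    thus "dec x i = None" unfolding on_cosets_None[OF assms] .
  qed
qed

lemma lift_comp:
  assumes "hole_CA S F" "hole_CA S G"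
  shows "lift F (lift G x) = lift (F \<circ> G) x"
proof -
  have "lift F (lift G x) = rewrite (lift G x) (on_cosets F (on_cosets G (dec x)))"
    unfolding lift_def[of F] dec_lift[OF assms(2)] ..
  also have "\<dots> = rewrite x (on_cosets F (on_cosets G (dec x)))"
    unfolding lift_def[of G] by (rule rewrite_rewrite) (rule on_cosets_None[OF assms(1), symmetric])
  also have "\<dots> = lift (F \<circ> G) x"
    unfolding lift_def on_cosets_comp[OF assms] ..
  finally show ?thesis .
qed

lemma lift_cong:
  assumes "\<And>y. y \<in> configs_on S \<Longrightarrow> F y = G y"
  shows "lift F x = lift G x"
proof -
  have "(\<lambda>k. dec x (i + len * k)) \<in> configs_on S" for i
    using dec_configs[of x] by (auto simp: configs_on_def)
  hence "on_cosets F (dec x) = on_cosets G (dec x)"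
    unfolding on_cosets_def[abs_def] using assms by auto
  thus ?thesis by (simp add: lift_def)
qed

lemma lift_id: "lift (\<lambda>y. y) x = x"
  by (simp add: lift_def on_cosets_def[abs_def] rewrite_dec)

lemma lift_closed: "x \<in> topspace (full_shift A) \<Longrightarrow> lift F x \<in> topspace (full_shift A)"
  using a01 by (simp add: topspace_full_shift lift_def rewrite_def)

lemma dec_translate: "dec (\<lambda>j. x (j + c)) i = dec x (i + c)"
proof -
  have "block (\<lambda>j. x (j + c)) i s = block x (i + c) s" for s
    unfolding block_def by (simp add: algebra_simps)
  thus ?thesis by (simp add: dec_def)
qed

lemma rewrite_translate: "rewrite (\<lambda>j. x (j + c)) (\<lambda>j. y (j + c)) i = rewrite x y (i + c)"
proof -
  have shift: "(\<exists>i. P (i + c)) \<longleftrightarrow> (\<exists>i. P i)" for P :: "int \<Rightarrow> bool"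
    by (metis diff_add_cancel)
  have 1: "covered (\<lambda>j. y (j + c)) i \<longleftrightarrow> covered y (i + c)"
    using shift[of "\<lambda>j. y j \<noteq> None \<and> j \<le> i + c \<and> i + c < j + len"]
    unfolding covered_def by (simp add: algebra_simps)
  have 2: "(\<exists>j s. y (j + c) = Some s \<and> i - j \<in> ones s) \<longleftrightarrow> (\<exists>j s. y j = Some s \<and> i + c - j \<in> ones s)"
    using shift[of "\<lambda>j. \<exists>s. y j = Some s \<and> i + c - j \<in> ones s"] by simp
  show ?thesis unfolding rewrite_def using 1 2 by simp
qed

lemma lift_shift:
  assumes "hole_CA S F"
  shows "lift F (shift x) = shift (lift F x)"
proof -
  have d: "dec (shift x) = (\<lambda>j. dec x (j + 1))"
    unfolding shift_def using dec_translate[of x 1] by blast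
  have "on_cosets F (\<lambda>j. dec x (j + 1)) = (\<lambda>j. on_cosets F (dec x) (j + 1))"
    by (simp add: on_cosets_def[abs_def] algebra_simps)
  thus ?thesis unfolding lift_def d unfolding shift_def using rewrite_translate by auto
qed

lemma lift_local:
  assumes "hole_CA S F"
  shows "\<exists>E. finite E \<and> (\<forall>x z. (\<forall>j\<in>E. x j = z j) \<longrightarrow> lift F x i = lift F z i)"
proof -
  obtain r where r: "\<And>y z i. (\<And>j. \<bar>j - i\<bar> \<le> int r \<Longrightarrow> y j = z j) \<Longrightarrow> F y i = F z i"
    using assms unfolding hole_CA_def is_local_def by blast
  define R where "R = len * int r + 2 * len"
  define E where "E = {i - R..i + R}"
  have det: "lift F x i = lift F z i" if xz: "\<And>j. j \<in> E \<Longrightarrow> x j = z j" for x z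
  proof -
    have dec: "dec x j = dec z j" if j: "\<bar>j - i\<bar> \<le> len * int r + len" for j
    proof -
      have "x (j + k) = z (j + k)" if "0 \<le> k" "k < len" for k
        by (rule xz) (use that j in \<open>auto simp: E_def R_def\<close>)
      hence "block x j s = block z j s" for s unfolding block_def by auto
      thus ?thesis by (simp add: dec_def)
    qed
    have cos: "on_cosets F (dec x) j = on_cosets F (dec z) j" if j: "\<bar>j - i\<bar> \<le> len" for j
      unfolding on_cosets_def
    proof (rule r, rule dec)
      fix k :: int assume "\<bar>k - 0\<bar> \<le> int r"
      hence "\<bar>len * k\<bar> \<le> len * int r" using len_pos by (simp add: abs_mult)
      thus "\<bar>j + len * k - i\<bar> \<le> len * int r + len" using j by linarith
    qed
    have near: "\<bar>j - i\<bar> \<le> len" if "j \<le> i" "i < j + len" for j using that by auto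
    have cov: "covered (on_cosets F (dec x)) i = covered (on_cosets F (dec z)) i"
      unfolding covered_def using cos near by metis
    have conf: "on_cosets F (dec u) \<in> configs_on S" for u
      using on_cosets_configs[OF assms dec_configs] .
    have near': "\<bar>j - i\<bar> \<le> len" if "on_cosets F (dec u) j = Some s" "i - j \<in> ones s" for j u s
    proof -
      have "s \<in> S" using conf[of u] that(1) by (force simp: configs_on_def)
      thus ?thesis using ones_bounds[OF _ that(2)] by auto
    qed
    have "(\<exists>j s. on_cosets F (dec x) j = Some s \<and> i - j \<in> ones s) \<longleftrightarrow>
          (\<exists>j s. on_cosets F (dec z) j = Some s \<and> i - j \<in> ones s)"
      using cos near' by metis
    moreover have "0 \<le> R" using len_pos by (simp add: R_def)
    hence "x i = z i" by (intro xz) (simp add: E_def)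
    ultimately show ?thesis unfolding lift_def rewrite_def using cov by simp
  qed
  show ?thesis
  proof (intro exI[of _ E] conjI allI impI)
    fix x z :: "int \<Rightarrow> 'a" assume "\<forall>j\<in>E. x j = z j"
    thus "lift F x i = lift F z i" by (intro det) (rule bspec)
  qed (simp add: E_def)
qed

definition lift_Aut :: "('s config \<Rightarrow> 's config) \<Rightarrow> (int \<Rightarrow> 'a) \<Rightarrow> int \<Rightarrow> 'a" where
  "lift_Aut F = restrict (lift F) (topspace (full_shift A))"

lemma lift_Aut_closed:
  assumes F: "hole_CA S F" and G: "hole_CA S G"
    and inv: "\<And>y. y \<in> configs_on S \<Longrightarrow> F (G y) = y" "\<And>y. y \<in> configs_on S \<Longrightarrow> G (F y) = y"
  shows "lift_Aut F \<in> carrier (shift_Aut A)"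
proof -
  have cont: "continuous_map (full_shift A) (full_shift A) (lift F)" if "hole_CA S F" for F
    using lift_closed lift_local[OF that] by (rule continuous_map_full_shift_local)
  have "lift F (lift G x) = x" "lift G (lift F x) = x" for x
    using lift_comp[OF F G] lift_comp[OF G F] lift_cong[of "F \<circ> G" "\<lambda>y. y"] lift_cong[of "G \<circ> F" "\<lambda>y. y"]
      inv lift_id by auto
  hence "homeomorphic_maps (full_shift A) (full_shift A) (lift F) (lift G)"
    using cont F G by (auto simp: homeomorphic_maps_def)
  hence "homeomorphic_map (full_shift A) (full_shift A) (lift F)"
    by (rule homeomorphic_maps_imp_map)
  hence "homeomorphic_map (full_shift A) (full_shift A) (lift_Aut F)"
    by (rule homeomorphic_map_eq) (simp add: lift_Aut_def)
  thus ?thesis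
    using lift_shift[OF F] shift_in_full_shift[of _ A] lift_closed
    by (auto simp: shift_Aut_def lift_Aut_def)
qed

lemma lift_Aut_mult:
  assumes "hole_CA S F" "hole_CA S G" "lift_Aut F \<in> carrier (shift_Aut A)" "lift_Aut G \<in> carrier (shift_Aut A)"
  shows "lift_Aut F \<otimes>\<^bsub>shift_Aut A\<^esub> lift_Aut G = lift_Aut (F \<circ> G)"
proof -
  have BG: "carrier (BijGroup X) = Bij X" for X :: "(int \<Rightarrow> 'a) set" by (simp add: BijGroup_def)
  have "carrier (shift_Aut A) \<subseteq> Bij (topspace (full_shift A))"
    using subgroup.subset[OF subgroup_shift_Aut[of A]] unfolding BG .
  hence "lift_Aut F \<otimes>\<^bsub>shift_Aut A\<^esub> lift_Aut G
    = compose (topspace (full_shift A)) (lift_Aut F) (lift_Aut G)"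
  proof -
    have "lift_Aut F \<in> Bij (topspace (full_shift A))" "lift_Aut G \<in> Bij (topspace (full_shift A))"
      using assms(3,4) \<open>carrier (shift_Aut A) \<subseteq> _\<close> by blast+
    moreover have "mult (shift_Aut A) = mult (BijGroup (topspace (full_shift A)))"
      by (simp add: shift_Aut_def)
    ultimately show ?thesis by (simp add: BijGroup_def)
  qed
  also have "\<dots> = lift_Aut (F \<circ> G)"
  proof
    fix x
    show "compose (topspace (full_shift A)) (lift_Aut F) (lift_Aut G) x = lift_Aut (F \<circ> G) x"
    proof (cases "x \<in> topspace (full_shift A)")
      case True
      hence "lift G x \<in> topspace (full_shift A)" by (rule lift_closed)
      thus ?thesis using True by (simp add: compose_eq lift_Aut_def lift_comp[OF assms(1,2)])
    qed (simp add: compose_def lift_Aut_def)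
  qed
  finally show ?thesis .
qed

text \<open>Places every symbol of \<open>y\<close> so that, after coding, neighbours are neighbours in the coset of \<open>0\<close>.\<close>

definition spread :: "'s config \<Rightarrow> 's config" where
  "spread y i = (if len dvd i then y (i div len) else None)"

lemma lift_Aut_eqD:
  assumes F: "hole_CA S F" and G: "hole_CA S G" and y: "y \<in> configs_on S"
    and eq: "lift_Aut F = lift_Aut G"
  shows "F y = G y"
proof -
  define x where "x = rewrite (\<lambda>_. a0) (spread y)"
  have x: "x \<in> topspace (full_shift A)" using a01 by (simp add: x_def rewrite_def topspace_full_shift)
  have "\<not> block (\<lambda>_. a0) i s" for i s
  proof
    assume "block (\<lambda>_. a0) i s"
    hence "a0 = (if 0 \<in> ones s then a1 else a0)"
      unfolding block_def by (elim allE[of _ 0] mp) (use len_pos in simp)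
    thus False using a01(3) by (simp add: ones_def)
  qed
  hence "dec (\<lambda>_. a0) i = None" for i by (simp add: dec_None_iff)
  moreover have "spaced (spread y)"
    unfolding spaced_def
  proof (intro allI impI)
    fix i j assume "spread y i \<noteq> None" "spread y j \<noteq> None" and ij: "i < j"
    hence "len dvd i" "len dvd j" by (simp_all add: spread_def split: if_splits)
    hence "len dvd j - i" by (intro dvd_diff)
    hence "len \<le> j - i" using ij by (intro zdvd_imp_le) simp_all
    thus "i + len \<le> j" by simp
  qed
  moreover have "spread y \<in> configs_on S" using y by (auto simp: configs_on_def spread_def)
  ultimately have dx: "dec x = spread y" unfolding x_def by (intro dec_rewrite)
  have coset: "(\<lambda>k. spread y (0 + len * k)) = y"
    using len_pos by (simp add: spread_def)
  have "lift F x = lift G x" using fun_cong[OF eq, of x] x by (simp add: lift_Aut_def)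
  hence "on_cosets F (spread y) = on_cosets G (spread y)"
    using dec_lift[OF F, of x] dec_lift[OF G, of x] dx by simp
  hence "on_cosets F (spread y) (0 + len * k) = on_cosets G (spread y) (0 + len * k)" for k by simp
  thus ?thesis unfolding on_cosets_coset[OF F] on_cosets_coset[OF G] coset by blast
qed

end

section \<open>Permutations of runs\<close>

text \<open>A word is a run if consecutive letters are related by \<open>J\<close>.  The map \<open>enc\<close> identifies the runs with the
  elements of \<open>\<Omega>\<close>, which can be any convenient description of them.\<close>

locale run_system =
  fixes S :: "'s set" and J :: "'s \<Rightarrow> 's \<Rightarrow> bool" and \<Omega> :: "'w set" and enc :: "'w \<Rightarrow> 's list"
  assumes enc_inj: "inj_on enc \<Omega>"
    and enc_range: "enc ` \<Omega> = {w. w \<noteq> [] \<and> set w \<subseteq> S \<and> (\<forall>k. Suc k < length w \<longrightarrow> J (w ! k) (w ! Suc k))}"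
begin

definition joined :: "'s config \<Rightarrow> int \<Rightarrow> bool" where
  "joined y i \<longleftrightarrow> (\<exists>a b. y i = Some a \<and> y (i + 1) = Some b \<and> J a b)"

text \<open>Maximality: the run does not continue to either side.\<close>

definition run_at :: "'s config \<Rightarrow> int \<Rightarrow> 's list \<Rightarrow> bool" where
  "run_at y p w \<longleftrightarrow> (\<forall>k<length w. y (p + int k) = Some (w ! k)) \<and>
     \<not> joined y (p - 1) \<and> \<not> joined y (p + int (length w) - 1)"

lemma enc_valid:
  assumes "\<omega> \<in> \<Omega>"
  shows "enc \<omega> \<noteq> []" "set (enc \<omega>) \<subseteq> S" "\<And>k. Suc k < length (enc \<omega>) \<Longrightarrow> J (enc \<omega> ! k) (enc \<omega> ! Suc k)"
proof -
  have "enc \<omega> \<in> enc ` \<Omega>" using assms by (rule imageI)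
  hence "enc \<omega> \<noteq> [] \<and> set (enc \<omega>) \<subseteq> S \<and> (\<forall>k. Suc k < length (enc \<omega>) \<longrightarrow> J (enc \<omega> ! k) (enc \<omega> ! Suc k))"
    unfolding enc_range by (rule CollectD)
  thus "enc \<omega> \<noteq> []" "set (enc \<omega>) \<subseteq> S" "\<And>k. Suc k < length (enc \<omega>) \<Longrightarrow> J (enc \<omega> ! k) (enc \<omega> ! Suc k)"
    by simp_all
qed

text \<open>In a configuration with finitely many symbols every symbol lies in a finite maximal run: go left and
  right from it as long as neighbours are joined.\<close>

lemma run_exists:
  assumes y: "y \<in> configs_on S" and i: "y i \<noteq> None" and fin: "\<And>j. \<bar>j - i\<bar> > int r \<Longrightarrow> y j = None"
  obtains p k \<omega> where "\<omega> \<in> \<Omega>" "run_at y p (enc \<omega>)" "k < length (enc \<omega>)" "i = p + int k"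
proof -
  have notj: "\<not> joined y (i - 1 - int r)" "\<not> joined y (i + int r)"
    using fin[of "i - 1 - int r"] fin[of "i + int r + 1"] by (auto simp: joined_def)
  define a where "a = (LEAST a. \<not> joined y (i - 1 - int a))"
  define b where "b = (LEAST b. \<not> joined y (i + int b))"
  have a: "\<not> joined y (i - 1 - int a)" unfolding a_def by (rule LeastI[of _ r]) (rule notj)
  have b: "\<not> joined y (i + int b)" unfolding b_def by (rule LeastI[of _ r]) (rule notj)
  have ja: "joined y (i - 1 - int k)" if "k < a" for k using not_less_Least[OF that[unfolded a_def]] by simp
  have jb: "joined y (i + int k)" if "k < b" for k using not_less_Least[OF that[unfolded b_def]] by simp
  define p where "p = i - int a"
  define n where "n = a + b + 1"
  have j: "joined y (p + int k)" if "Suc k < n" for k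
  proof (cases "k < a")
    case True
    thus ?thesis using ja[of "a - 1 - k"] by (simp add: p_def of_nat_diff algebra_simps)
  next
    case False
    thus ?thesis using jb[of "k - a"] that by (simp add: p_def n_def of_nat_diff algebra_simps)
  qed
  define w where "w = map (\<lambda>k. the (y (p + int k))) [0..<n]"
  have lw: "length w = n" "n > 0" by (simp_all add: w_def n_def)
  have some: "y (p + int k) = Some (w ! k)" if "k < n" for k
  proof -
    have "y (p + int k) \<noteq> None"
    proof (cases "Suc k < n")
      case True
      thus ?thesis using j[OF True] by (auto simp: joined_def)
    next
      case False
      show ?thesis
      proof (cases k)
        case 0
        hence "a = 0" using False by (simp add: n_def)
        thus ?thesis using i 0 by (simp add: p_def)
      next
        case (Suc l)
        thus ?thesis using j[of l] that by (auto simp: joined_def algebra_simps)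
      qed
    qed
    thus ?thesis using that by (auto simp: w_def)
  qed
  have "J (w ! k) (w ! Suc k)" if "Suc k < length w" for k
    using j[of k] that some[of k] some[of "Suc k"] by (auto simp: joined_def lw algebra_simps)
  moreover have "set w \<subseteq> S"
  proof
    fix s assume "s \<in> set w"
    then obtain k where "k < n" "s = w ! k" by (auto simp: in_set_conv_nth lw)
    hence "y (p + int k) = Some s" using some by simp
    thus "s \<in> S" using y by (force simp: configs_on_def)
  qed
  moreover have "w \<noteq> []" using lw by auto
  ultimately have "w \<in> enc ` \<Omega>" unfolding enc_range by blast
  then obtain \<omega> where \<omega>: "\<omega> \<in> \<Omega>" "w = enc \<omega>" by blast
  have "run_at y p w"
    unfolding run_at_def using some a b by (simp add: lw p_def n_def algebra_simps)
  hence "run_at y p (enc \<omega>)" by (simp only: \<omega>(2))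
  thus ?thesis
  proof (rule that[OF \<omega>(1)])
    show "a < length (enc \<omega>)" using lw by (simp add: n_def flip: \<omega>(2))
    show "i = p + int a" by (simp add: p_def)
  qed
qed

text \<open>\<open>F\<close> acts on every maximal finite run by \<open>\<pi>\<close>, whatever surrounds the run, and does not change where the run
  begins and ends.\<close>

definition realizes :: "('s config \<Rightarrow> 's config) \<Rightarrow> ('w \<Rightarrow> 'w) \<Rightarrow> bool" where
  "realizes F \<pi> \<longleftrightarrow> hole_CA S F \<and> (\<forall>\<omega>\<in>\<Omega>. \<pi> \<omega> \<in> \<Omega> \<and> length (enc (\<pi> \<omega>)) = length (enc \<omega>)) \<and>
     (\<forall>y\<in>configs_on S. \<forall>p. \<forall>\<omega>\<in>\<Omega>. run_at y p (enc \<omega>) \<longrightarrow> run_at (F y) p (enc (\<pi> \<omega>)))"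

lemma realizesD:
  assumes "realizes F \<pi>"
  shows "hole_CA S F" "\<And>\<omega>. \<omega> \<in> \<Omega> \<Longrightarrow> \<pi> \<omega> \<in> \<Omega>" "\<And>\<omega>. \<omega> \<in> \<Omega> \<Longrightarrow> length (enc (\<pi> \<omega>)) = length (enc \<omega>)"
    "\<And>y p \<omega>. \<lbrakk>y \<in> configs_on S; \<omega> \<in> \<Omega>; run_at y p (enc \<omega>)\<rbrakk> \<Longrightarrow> run_at (F y) p (enc (\<pi> \<omega>))"
proof -
  note c = assms[unfolded realizes_def]
  show "hole_CA S F" by (rule conjunct1[OF c])
  show "\<pi> \<omega> \<in> \<Omega>" "length (enc (\<pi> \<omega>)) = length (enc \<omega>)" if "\<omega> \<in> \<Omega>" for \<omega>
    using conjunct1[OF conjunct2[OF c]] that by simp_all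
  show "run_at (F y) p (enc (\<pi> \<omega>))" if "y \<in> configs_on S" "\<omega> \<in> \<Omega>" "run_at y p (enc \<omega>)" for y p \<omega>
    by (rule conjunct2[OF conjunct2[OF c], THEN bspec, THEN spec, THEN bspec, THEN mp, OF that])
qed

lemma realizes_cong:
  assumes "realizes F \<pi>" "\<And>\<omega>. \<omega> \<in> \<Omega> \<Longrightarrow> \<pi> \<omega> = \<sigma> \<omega>"
  shows "realizes F \<sigma>"
  unfolding realizes_def
proof (intro conjI ballI allI impI)
  show "hole_CA S F" by (rule realizesD(1)[OF assms(1)])
next
  fix \<omega> assume "\<omega> \<in> \<Omega>"
  thus "\<sigma> \<omega> \<in> \<Omega>" "length (enc (\<sigma> \<omega>)) = length (enc \<omega>)"
    using realizesD(2,3)[OF assms(1)] assms(2)[symmetric] by simp_all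
next
  fix y p \<omega> assume "y \<in> configs_on S" "\<omega> \<in> \<Omega>" "run_at y p (enc \<omega>)"
  thus "run_at (F y) p (enc (\<sigma> \<omega>))"
    using realizesD(4)[OF assms(1)] by (simp only: assms(2)[symmetric])
qed

lemma realizes_id: "realizes (\<lambda>y. y) (\<lambda>\<omega>. \<omega>)"
  unfolding realizes_def by (intro conjI ballI allI impI) (simp_all add: hole_CA_id)

lemma realizes_comp:
  assumes F: "realizes F \<pi>" and G: "realizes G \<sigma>"
  shows "realizes (F \<circ> G) (\<pi> \<circ> \<sigma>)"
  unfolding realizes_def
proof (intro conjI ballI allI impI)
  show "hole_CA S (F \<circ> G)" by (rule hole_CA_comp[OF realizesD(1)[OF F] realizesD(1)[OF G]])
next
  fix \<omega> assume "\<omega> \<in> \<Omega>"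
  thus "(\<pi> \<circ> \<sigma>) \<omega> \<in> \<Omega>" "length (enc ((\<pi> \<circ> \<sigma>) \<omega>)) = length (enc \<omega>)"
    using realizesD(2,3)[OF F] realizesD(2,3)[OF G] by simp_all
next
  fix y p \<omega> assume y: "y \<in> configs_on S" "\<omega> \<in> \<Omega>" "run_at y p (enc \<omega>)"
  have "run_at (G y) p (enc (\<sigma> \<omega>))" by (rule realizesD(4)[OF G y])
  hence "run_at (F (G y)) p (enc (\<pi> (\<sigma> \<omega>)))"
    by (rule realizesD(4)[OF F hole_CA_closed[OF realizesD(1)[OF G] y(1)] realizesD(2)[OF G y(2)]])
  thus "run_at ((F \<circ> G) y) p (enc ((\<pi> \<circ> \<sigma>) \<omega>))" by simp
qed

text \<open>Infinite runs are not described by \<open>\<Omega>\<close>, but by locality an automaton is determined by what it does to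
  configurations with finitely many symbols.\<close>

lemma realizes_unique:
  assumes F: "realizes F \<pi>" and G: "realizes G \<pi>" and y: "y \<in> configs_on S"
  shows "F y = G y"
proof
  fix i
  obtain r where r: "\<forall>y z i. (\<forall>j. \<bar>j - i\<bar> \<le> int r \<longrightarrow> y j = z j) \<longrightarrow> F y i = F z i"
    using realizesD(1)[OF F] unfolding hole_CA_def is_local_def by (elim conjE) (rule exE)
  obtain s where s: "\<forall>y z i. (\<forall>j. \<bar>j - i\<bar> \<le> int s \<longrightarrow> y j = z j) \<longrightarrow> G y i = G z i"
    using realizesD(1)[OF G] unfolding hole_CA_def is_local_def by (elim conjE) (rule exE)
  \<comment> \<open>Both maps are local, so cutting the configuration off far away from \<open>i\<close> does not matter.\<close>
  define z where "z = (\<lambda>j. if \<bar>j - i\<bar> \<le> int (r + s) then y j else None)"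
  have z: "z \<in> configs_on S" using y by (simp add: configs_on_def z_def)
  have Fz: "F y i = F z i" by (rule r[THEN spec, THEN spec, THEN spec, THEN mp]) (simp add: z_def)
  have Gz: "G y i = G z i" by (rule s[THEN spec, THEN spec, THEN spec, THEN mp]) (simp add: z_def)
  show "F y i = G y i"
  proof (cases "y i = None")
    case True
    thus ?thesis using hole_CA_None[OF realizesD(1)[OF F], of y i] hole_CA_None[OF realizesD(1)[OF G], of y i] by simp
  next
    case False
    hence "z i \<noteq> None" by (simp add: z_def)
    then obtain p k \<omega> where \<omega>: "\<omega> \<in> \<Omega>" "run_at z p (enc \<omega>)" "k < length (enc \<omega>)" "i = p + int k"
      by (rule run_exists[OF z, of i "r + s"]) (simp_all add: z_def)
    have "run_at (F z) p (enc (\<pi> \<omega>))" "run_at (G z) p (enc (\<pi> \<omega>))"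
      by (rule realizesD(4)[OF F z \<omega>(1,2)], rule realizesD(4)[OF G z \<omega>(1,2)])
    hence "F z i = G z i"
      using \<omega>(3,4) realizesD(3)[OF F \<omega>(1)] by (simp add: run_at_def)
    thus ?thesis using Fz Gz by simp
  qed
qed

definition realizable :: "('w \<Rightarrow> 'w) \<Rightarrow> bool" where "realizable \<pi> \<longleftrightarrow> (\<exists>F. realizes F \<pi>)"

lemma realizable_comp: "realizable \<pi> \<Longrightarrow> realizable \<sigma> \<Longrightarrow> realizable (\<pi> \<circ> \<sigma>)"
  unfolding realizable_def by (elim exE) (rule exI, rule realizes_comp)

lemma realizable_cong: "realizable \<pi> \<Longrightarrow> (\<And>\<omega>. \<omega> \<in> \<Omega> \<Longrightarrow> \<pi> \<omega> = \<sigma> \<omega>) \<Longrightarrow> realizable \<sigma>"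
  unfolding realizable_def by (elim exE) (rule exI, rule realizes_cong)

definition run_perms :: "('w \<Rightarrow> 'w) set" where
  "run_perms = {\<pi> \<in> Bij \<Omega>. realizable \<pi> \<and> realizable (inv\<^bsub>BijGroup \<Omega>\<^esub> \<pi>)}"

definition run_group :: "('w \<Rightarrow> 'w) monoid" where
  "run_group = BijGroup \<Omega>\<lparr>carrier := run_perms\<rparr>"

lemma mult_Bij:
  assumes "\<pi> \<in> Bij \<Omega>" "\<sigma> \<in> Bij \<Omega>"
  shows "\<pi> \<otimes>\<^bsub>BijGroup \<Omega>\<^esub> \<sigma> = compose \<Omega> \<pi> \<sigma>"
  using assms by (simp add: BijGroup_def)

lemma subgroup_run_perms: "subgroup run_perms (BijGroup \<Omega>)"
proof -
  interpret B: group "BijGroup \<Omega>" by (rule group_BijGroup)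
  have car: "carrier (BijGroup \<Omega>) = Bij \<Omega>" by (simp add: BijGroup_def)
  have prod: "realizable (\<pi> \<otimes>\<^bsub>BijGroup \<Omega>\<^esub> \<sigma>)"
    if "realizable \<pi>" "realizable \<sigma>" "\<pi> \<in> Bij \<Omega>" "\<sigma> \<in> Bij \<Omega>" for \<pi> \<sigma>
    using realizable_comp[OF that(1,2)] by (rule realizable_cong) (simp add: mult_Bij that compose_eq)
  show ?thesis
  proof (rule B.subgroupI)
    show "run_perms \<subseteq> carrier (BijGroup \<Omega>)" by (auto simp: run_perms_def car)
    have "realizable \<one>\<^bsub>BijGroup \<Omega>\<^esub>"
      unfolding realizable_def
      by (rule exI, rule realizes_cong[OF realizes_id]) (simp add: BijGroup_def)
    hence "\<one>\<^bsub>BijGroup \<Omega>\<^esub> \<in> run_perms" using B.one_closed by (simp add: run_perms_def car)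
    thus "run_perms \<noteq> {}" by blast
  next
    fix \<pi> assume "\<pi> \<in> run_perms"
    thus "inv\<^bsub>BijGroup \<Omega>\<^esub> \<pi> \<in> run_perms" using B.inv_closed B.inv_inv by (simp add: run_perms_def car)
  next
    fix \<pi> \<sigma> assume "\<pi> \<in> run_perms" "\<sigma> \<in> run_perms"
    thus "\<pi> \<otimes>\<^bsub>BijGroup \<Omega>\<^esub> \<sigma> \<in> run_perms"
      using B.m_closed B.inv_closed prod by (simp add: run_perms_def car B.inv_mult_group)
  qed
qed

lemma group_run_group: "group run_group"
  unfolding run_group_def by (rule group.subgroup_imp_group[OF group_BijGroup subgroup_run_perms])

lemma carrier_run_group: "carrier run_group = run_perms"
  by (simp add: run_group_def)

lemma mult_run_group: "\<pi> \<in> run_perms \<Longrightarrow> \<sigma> \<in> run_perms \<Longrightarrow> \<pi> \<otimes>\<^bsub>run_group\<^esub> \<sigma> = compose \<Omega> \<pi> \<sigma>"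
  by (simp add: run_group_def run_perms_def mult_Bij)

text \<open>Choose an automaton for every permutation.  By uniqueness the choice is multiplicative on configurations, hence
  \<open>\<pi> \<mapsto> lift_Aut (pick \<pi>)\<close> is a homomorphism.  It is injective because every run occurs as
  the only run of some configuration.\<close>

theorem run_group_embeds:
  fixes A :: "'a set"
  assumes finS: "finite S" and A: "finite A" "card A \<ge> 2"
  shows "\<exists>\<psi>. \<psi> \<in> mon run_group (shift_Aut A)"
proof -
  obtain a0 a1 where a01: "a0 \<in> A" "a1 \<in> A" "a0 \<noteq> a1"
    using A by (metis card_2_iff' obtain_subset_with_card_n subset_iff)
  obtain idx where idx: "bij_betw idx S {0..<card S}" using ex_bij_betw_finite_nat[OF finS] by blast
  interpret block_code A a0 a1 S idx "card S"
  proof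
    show "a0 \<in> A" "a1 \<in> A" "a0 \<noteq> a1" by (rule a01)+
    show "inj_on idx S" using idx by (rule bij_betw_imp_inj_on)
    show "idx s < card S" if "s \<in> S" for s using bij_betwE[OF idx] that by simp
  qed
  interpret G: group run_group by (rule group_run_group)
  define pick where "pick \<pi> = (SOME F. realizes F \<pi>)" for \<pi>
  have pick: "realizes (pick \<pi>) \<pi>" if "\<pi> \<in> run_perms" for \<pi>
    unfolding pick_def by (rule someI_ex[of "\<lambda>F. realizes F \<pi>"]) (use that in \<open>simp add: run_perms_def realizable_def\<close>)
  have pick_CA: "hole_CA S (pick \<pi>)" if "\<pi> \<in> run_perms" for \<pi> using realizesD(1)[OF pick[OF that]] .
  have pick_mult: "pick (\<pi> \<otimes>\<^bsub>run_group\<^esub> \<sigma>) y = (pick \<pi> \<circ> pick \<sigma>) y"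
    if "\<pi> \<in> run_perms" "\<sigma> \<in> run_perms" "y \<in> configs_on S" for \<pi> \<sigma> y
  proof -
    have "realizes (pick \<pi> \<circ> pick \<sigma>) (\<pi> \<otimes>\<^bsub>run_group\<^esub> \<sigma>)"
      by (rule realizes_cong[OF realizes_comp[OF pick[OF that(1)] pick[OF that(2)]]])
        (simp add: mult_run_group that compose_eq)
    moreover have "\<pi> \<otimes>\<^bsub>run_group\<^esub> \<sigma> \<in> run_perms"
      using G.m_closed that by (simp add: carrier_run_group)
    ultimately show ?thesis using realizes_unique[OF pick[of "\<pi> \<otimes>\<^bsub>run_group\<^esub> \<sigma>"] _ that(3)] by simp
  qed
  have pick_one: "pick \<one>\<^bsub>run_group\<^esub> y = y" if "y \<in> configs_on S" for y
  proof -
    have "realizes (\<lambda>y. y) \<one>\<^bsub>run_group\<^esub>"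
      by (rule realizes_cong[OF realizes_id]) (simp add: run_group_def BijGroup_def)
    moreover have "\<one>\<^bsub>run_group\<^esub> \<in> run_perms" using G.one_closed by (simp add: carrier_run_group)
    ultimately show ?thesis using realizes_unique[OF pick[of "\<one>\<^bsub>run_group\<^esub>"] _ that] by simp
  qed
  define \<psi> where "\<psi> \<pi> = lift_Aut (pick \<pi>)" for \<pi>
  have closed: "\<psi> \<pi> \<in> carrier (shift_Aut A)" if \<pi>: "\<pi> \<in> run_perms" for \<pi>
    unfolding \<psi>_def
  proof (rule lift_Aut_closed)
    have i: "inv\<^bsub>run_group\<^esub> \<pi> \<in> run_perms" using G.inv_closed \<pi> by (simp add: carrier_run_group)
    show "hole_CA S (pick \<pi>)" "hole_CA S (pick (inv\<^bsub>run_group\<^esub> \<pi>))" using pick_CA \<pi> i by auto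
    fix y assume y: "y \<in> configs_on S"
    show "pick \<pi> (pick (inv\<^bsub>run_group\<^esub> \<pi>) y) = y" "pick (inv\<^bsub>run_group\<^esub> \<pi>) (pick \<pi> y) = y"
      using pick_mult[OF \<pi> i y] pick_mult[OF i \<pi> y] pick_one[OF y] \<pi> by (simp_all add: carrier_run_group)
  qed
  have "\<psi> \<in> hom run_group (shift_Aut A)"
  proof (rule homI)
    fix \<pi> assume "\<pi> \<in> carrier run_group"
    thus "\<psi> \<pi> \<in> carrier (shift_Aut A)" using closed by (simp add: carrier_run_group)
  next
    fix \<pi> \<sigma> assume "\<pi> \<in> carrier run_group" "\<sigma> \<in> carrier run_group"
    hence *: "\<pi> \<in> run_perms" "\<sigma> \<in> run_perms" by (simp_all add: carrier_run_group)
    have "\<psi> \<pi> \<otimes>\<^bsub>shift_Aut A\<^esub> \<psi> \<sigma> = lift_Aut (pick \<pi> \<circ> pick \<sigma>)"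
      unfolding \<psi>_def by (rule lift_Aut_mult) (use * pick_CA closed in \<open>simp_all add: \<psi>_def\<close>)
    also have "\<dots> = \<psi> (\<pi> \<otimes>\<^bsub>run_group\<^esub> \<sigma>)"
    proof -
      have "lift (pick (\<pi> \<otimes>\<^bsub>run_group\<^esub> \<sigma>)) x = lift (pick \<pi> \<circ> pick \<sigma>) x" for x
        by (rule lift_cong) (rule pick_mult[OF *])
      hence "lift (pick (\<pi> \<otimes>\<^bsub>run_group\<^esub> \<sigma>)) = lift (pick \<pi> \<circ> pick \<sigma>)" by (rule ext)
      thus ?thesis by (simp only: \<psi>_def lift_Aut_def)
    qed
    finally show "\<psi> (\<pi> \<otimes>\<^bsub>run_group\<^esub> \<sigma>) = \<psi> \<pi> \<otimes>\<^bsub>shift_Aut A\<^esub> \<psi> \<sigma>" by simp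
  qed
  moreover have "inj_on \<psi> (carrier run_group)"
  proof (rule inj_onI)
    fix \<pi> \<sigma> assume "\<pi> \<in> carrier run_group" "\<sigma> \<in> carrier run_group" and eq: "\<psi> \<pi> = \<psi> \<sigma>"
    hence *: "\<pi> \<in> run_perms" "\<sigma> \<in> run_perms" by (simp_all add: carrier_run_group)
    show "\<pi> = \<sigma>"
    proof (rule extensionalityI[of _ \<Omega>])
      show "\<pi> \<in> extensional \<Omega>" "\<sigma> \<in> extensional \<Omega>" using * by (auto simp: run_perms_def Bij_def)
      fix \<omega> assume \<omega>: "\<omega> \<in> \<Omega>"
      define w where "w = enc \<omega>"
      \<comment> \<open>The configuration that consists of the single run \<open>\<omega>\<close>.\<close>
      define y where "y i = (if 0 \<le> i \<and> i < int (length w) then Some (w ! nat i) else None)" for i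
      have "set w \<subseteq> S" using enc_valid(2)[OF \<omega>] by (simp add: w_def)
      hence "w ! nat i \<in> S" if "0 \<le> i" "i < int (length w)" for i
        using that nth_mem[of "nat i" w] by auto
      hence y: "y \<in> configs_on S" by (simp add: configs_on_def y_def)
      have run: "run_at y 0 (enc \<omega>)" by (simp add: run_at_def y_def joined_def flip: w_def)
      have "pick \<pi> y = pick \<sigma> y"
        using lift_Aut_eqD[OF pick_CA[OF *(1)] pick_CA[OF *(2)] y] eq by (simp add: \<psi>_def)
      hence "run_at (pick \<pi> y) 0 (enc (\<pi> \<omega>))" "run_at (pick \<pi> y) 0 (enc (\<sigma> \<omega>))"
        using realizesD(4)[OF pick[OF *(1)] y \<omega> run] realizesD(4)[OF pick[OF *(2)] y \<omega> run] by simp_all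
      hence "enc (\<pi> \<omega>) = enc (\<sigma> \<omega>)"
        using realizesD(3)[OF pick[OF *(1)] \<omega>] realizesD(3)[OF pick[OF *(2)] \<omega>]
        by (intro nth_equalityI) (auto simp: run_at_def)
      thus "\<pi> \<omega> = \<sigma> \<omega>"
        using enc_inj realizesD(2)[OF pick[OF *(1)] \<omega>] realizesD(2)[OF pick[OF *(2)] \<omega>] by (auto dest: inj_onD)
    qed
  qed
  ultimately show ?thesis by (auto simp: mon_def)
qed

end

section \<open>Local rules that permute runs\<close>

context run_system
begin

text \<open>A rule sees a neighbour only if it belongs to the same run.\<close>

definition rule_map :: "('s option \<Rightarrow> 's \<Rightarrow> 's option \<Rightarrow> 's) \<Rightarrow> 's config \<Rightarrow> 's config" where
  "rule_map R y i = map_option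
     (\<lambda>a. R (if joined y (i - 1) then y (i - 1) else None) a (if joined y i then y (i + 1) else None)) (y i)"

lemma hole_CA_rule_map:
  assumes closed: "\<And>l a r. \<lbrakk>a \<in> S; set_option l \<subseteq> S; set_option r \<subseteq> S\<rbrakk> \<Longrightarrow> R l a r \<in> S"
  shows "hole_CA S (rule_map R)"
proof (rule hole_CAI)
  show "is_local (rule_map R)"
    unfolding is_local_def
  proof (intro exI[of _ 1] allI impI)
    fix y z :: "'s config" and i assume "\<forall>j. \<bar>j - i\<bar> \<le> int 1 \<longrightarrow> y j = z j"
    hence eq: "y i = z i" "y (i - 1) = z (i - 1)" "y (i + 1) = z (i + 1)" by simp_all
    hence "joined y i = joined z i" "joined y (i - 1) = joined z (i - 1)" by (simp_all add: joined_def)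
    thus "rule_map R y i = rule_map R z i" by (simp only: rule_map_def eq)
  qed
next
  fix y :: "'s config" and k i
  have "joined (\<lambda>j. y (j + k)) j = joined y (j + k)" for j by (simp add: joined_def algebra_simps)
  thus "rule_map R (\<lambda>j. y (j + k)) i = rule_map R y (i + k)" proof -
    assume j: "\<And>j. joined (\<lambda>j. y (j + k)) j = joined y (j + k)"
    have idx: "i - 1 + k = i + k - 1" "i + 1 + k = i + k + 1" by simp_all
    show ?thesis unfolding rule_map_def j idx ..
  qed
next
  fix y :: "'s config" and i
  show "(rule_map R y i = None) = (y i = None)" by (simp add: rule_map_def)
next
  fix y assume y: "y \<in> configs_on S"
  hence yi: "set_option (y i) \<subseteq> S" for i by (simp add: configs_on_def)
  have "set_option (rule_map R y i) \<subseteq> S" for i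
  proof (cases "y i")
    case (Some a)
    hence "a \<in> S" using yi[of i] by simp
    thus ?thesis using Some closed yi by (simp add: rule_map_def)
  qed (simp add: rule_map_def)
  thus "rule_map R y \<in> configs_on S" by (simp add: configs_on_def)
qed

text \<open>The assumption \<open>boundary\<close> says that two adjacent runs are not merged by the
  rule.  That a run is not torn apart is contained in \<open>rule\<close>, since \<open>enc (\<pi> \<omega>)\<close> is again a run.\<close>

lemma realizes_rule_map:
  assumes closed: "\<And>l a r. \<lbrakk>a \<in> S; set_option l \<subseteq> S; set_option r \<subseteq> S\<rbrakk> \<Longrightarrow> R l a r \<in> S"
    and boundary: "\<And>l a b r. \<lbrakk>\<not> J a b; \<And>c. l = Some c \<Longrightarrow> J c a; \<And>d. r = Some d \<Longrightarrow> J b d\<rbrakk>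
      \<Longrightarrow> \<not> J (R l a None) (R None b r)"
    and \<pi>: "\<And>\<omega>. \<omega> \<in> \<Omega> \<Longrightarrow> \<pi> \<omega> \<in> \<Omega>" "\<And>\<omega>. \<omega> \<in> \<Omega> \<Longrightarrow> length (enc (\<pi> \<omega>)) = length (enc \<omega>)"
    and rule: "\<And>\<omega> k. \<lbrakk>\<omega> \<in> \<Omega>; k < length (enc \<omega>)\<rbrakk> \<Longrightarrow> enc (\<pi> \<omega>) ! k =
      R (if k = 0 then None else Some (enc \<omega> ! (k - 1))) (enc \<omega> ! k)
        (if Suc k < length (enc \<omega>) then Some (enc \<omega> ! Suc k) else None)"
  shows "realizes (rule_map R) \<pi>"
  unfolding realizes_def
proof (intro conjI ballI allI impI)
  show "hole_CA S (rule_map R)" using closed by (rule hole_CA_rule_map)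
next
  fix y p \<omega> assume \<omega>: "\<omega> \<in> \<Omega>" and run: "run_at y p (enc \<omega>)"
  have stay: "\<not> joined (rule_map R y) i" if "\<not> joined y i" for i
  proof
    assume "joined (rule_map R y) i"
    then obtain a' b' where ab': "rule_map R y i = Some a'" "rule_map R y (i + 1) = Some b'" "J a' b'"
      unfolding joined_def by (elim exE conjE)
    then obtain a b where ab: "y i = Some a" "y (i + 1) = Some b"
      by (auto simp: rule_map_def)
    have "\<not> J a b" using that ab by (simp add: joined_def)
    hence "\<not> J (R (if joined y (i - 1) then y (i - 1) else None) a None)
                (R None b (if joined y (i + 1) then y (i + 1 + 1) else None))"
      by (rule boundary) (use ab in \<open>auto simp: joined_def split: if_splits\<close>)
    thus False using ab ab' that by (simp add: rule_map_def)
  qed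
  have y: "y (p + int k) = Some (enc \<omega> ! k)" if "k < length (enc \<omega>)" for k
    using run that by (simp add: run_at_def)
  have edge: "joined y (p + int k)" if "Suc k < length (enc \<omega>)" for k
    using y[of k] y[of "Suc k"] that enc_valid(3)[OF \<omega> that] by (simp add: joined_def algebra_simps)
  have "rule_map R y (p + int k) = Some (enc (\<pi> \<omega>) ! k)" if k: "k < length (enc \<omega>)" for k
  proof -
    have l: "(if joined y (p + int k - 1) then y (p + int k - 1) else None)
      = (if k = 0 then None else Some (enc \<omega> ! (k - 1)))"
    proof (cases k)
      case 0
      thus ?thesis using run by (simp add: run_at_def)
    next
      case (Suc l)
      thus ?thesis using edge[of l] y[of l] k by (simp add: algebra_simps)
    qed
    have r: "(if joined y (p + int k) then y (p + int k + 1) else None)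
      = (if Suc k < length (enc \<omega>) then Some (enc \<omega> ! Suc k) else None)"
    proof (cases "Suc k < length (enc \<omega>)")
      case True
      thus ?thesis using edge[of k] y[of "Suc k"] by (simp add: algebra_simps)
    next
      case False
      hence "p + int k = p + int (length (enc \<omega>)) - 1" using k by simp
      moreover have "\<not> joined y (p + int (length (enc \<omega>)) - 1)" using run by (simp add: run_at_def)
      ultimately have "\<not> joined y (p + int k)" by (simp only: simp_thms)
      thus ?thesis using False by simp
    qed
    show ?thesis unfolding rule_map_def l r using y[OF k] rule[OF \<omega> k] by simp
  qed
  thus "run_at (rule_map R y) p (enc (\<pi> \<omega>))"
    using run stay \<pi>(2)[OF \<omega>] by (simp add: run_at_def)
qed (use \<pi> in simp_all)

lemma realizes_cell_rule:
  assumes "\<And>a. a \<in> S \<Longrightarrow> c a \<in> S" "\<And>a b. J (c a) (c b) = J a b"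
    and "\<And>\<omega>. \<omega> \<in> \<Omega> \<Longrightarrow> \<pi> \<omega> \<in> \<Omega>" "\<And>\<omega>. \<omega> \<in> \<Omega> \<Longrightarrow> enc (\<pi> \<omega>) = map c (enc \<omega>)"
  shows "realizes (rule_map (\<lambda>_ a _. c a)) \<pi>"
  by (rule realizes_rule_map) (simp_all add: assms)

text \<open>Acts on pairs of adjacent cells that satisfy \<open>act\<close>, by \<open>f\<close> on the left and \<open>g\<close> on the right member.\<close>

definition edge_rule :: "('s \<Rightarrow> 's \<Rightarrow> bool) \<Rightarrow> ('s \<Rightarrow> 's \<Rightarrow> 's) \<Rightarrow> ('s \<Rightarrow> 's \<Rightarrow> 's) \<Rightarrow>
    's option \<Rightarrow> 's \<Rightarrow> 's option \<Rightarrow> 's" where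
  "edge_rule act f g l a r =
     (if \<exists>b. r = Some b \<and> act a b then f a (the r)
      else if \<exists>c. l = Some c \<and> act c a then g (the l) a else a)"

text \<open>The left member of a pair keeps its relation to everything on its left and the right member to
  everything on its right, so the rule cannot join two runs.\<close>

lemma realizes_edge_rule:
  assumes closed: "\<And>a b. \<lbrakk>a \<in> S; b \<in> S; act a b\<rbrakk> \<Longrightarrow> f a b \<in> S \<and> g a b \<in> S"
    and f: "\<And>a b z. \<lbrakk>act a b; J a b\<rbrakk> \<Longrightarrow> J z (f a b) = J z a"
    and g: "\<And>a b z. \<lbrakk>act a b; J a b\<rbrakk> \<Longrightarrow> J (g a b) z = J b z"
    and \<pi>: "\<And>\<omega>. \<omega> \<in> \<Omega> \<Longrightarrow> \<pi> \<omega> \<in> \<Omega>" "\<And>\<omega>. \<omega> \<in> \<Omega> \<Longrightarrow> length (enc (\<pi> \<omega>)) = length (enc \<omega>)"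
    and rule: "\<And>\<omega> k. \<lbrakk>\<omega> \<in> \<Omega>; k < length (enc \<omega>)\<rbrakk> \<Longrightarrow> enc (\<pi> \<omega>) ! k =
      edge_rule act f g (if k = 0 then None else Some (enc \<omega> ! (k - 1))) (enc \<omega> ! k)
        (if Suc k < length (enc \<omega>) then Some (enc \<omega> ! Suc k) else None)"
  shows "realizes (rule_map (edge_rule act f g)) \<pi>"
proof (rule realizes_rule_map[OF _ _ \<pi> rule])
  show "edge_rule act f g l a r \<in> S" if "a \<in> S" "set_option l \<subseteq> S" "set_option r \<subseteq> S" for l a r
    using that closed by (auto simp: edge_rule_def)
next
  fix l r :: "'s option" and a b
  assume ab: "\<not> J a b" and l: "\<And>c. l = Some c \<Longrightarrow> J c a" and r: "\<And>d. r = Some d \<Longrightarrow> J b d"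
  have "J (edge_rule act f g l a None) z = J a z" for z
    using g l by (auto simp: edge_rule_def)
  moreover have "J z (edge_rule act f g None b r) = J z b" for z
    using f r by (auto simp: edge_rule_def)
  ultimately show "\<not> J (edge_rule act f g l a None) (edge_rule act f g None b r)" using ab by simp
qed auto

end

section \<open>Runs as configurations of heads and lamps on a circle\<close>

text \<open>The label of a cell with respect to a head: the cell comes before the cell of the head, comes after it, or
  contains the head, in the upper slot (\<open>At False\<close>) or in the lower slot (\<open>At True\<close>).  Labels that are consistent
  across the run guarantee that a run has at most one copy of each head.\<close>

datatype label = Before | After | At bool

datatype cell = Cell (labels: "nat \<Rightarrow> label") (lamp_up: bool) (lamp_dn: bool) (clear_before: bool) (clear_after: bool)

definition blank :: "cell \<Rightarrow> bool" where "blank c \<longleftrightarrow> \<not> lamp_up c \<and> \<not> lamp_dn c"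

text \<open>Only the heads \<open>0, \<dots>, m\<close> exist.  The flag \<open>clear_before\<close> is meaningful up to the cell of head \<open>0\<close> and \<open>clear_after\<close>
  from this cell on; elsewhere they are \<open>False\<close> by convention.\<close>

definition cells :: "nat \<Rightarrow> cell set" where
  "cells m = {c. (\<forall>i>m. labels c i = Before) \<and> (labels c 0 = After \<longrightarrow> \<not> clear_before c) \<and>
     (labels c 0 = Before \<longrightarrow> \<not> clear_after c)}"

text \<open>Reading from left to right, the labels of one head can only be \<open>Before\<close> several times, then at most one \<open>At\<close>, then
  \<open>After\<close>.  Where it is meaningful and up to a free value at the end of the run, \<open>clear_before\<close> records that all earlier cells of the run are
  dark, and \<open>clear_after\<close> that all later ones are.  Neither flag of the cell of head \<open>0\<close> depends
  on the lamps of that cell.\<close>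

definition linked :: "nat \<Rightarrow> cell \<Rightarrow> cell \<Rightarrow> bool" where
  "linked m a b \<longleftrightarrow> (\<forall>i\<le>m. labels a i = Before \<longleftrightarrow> labels b i \<noteq> After) \<and>
     (labels b 0 \<noteq> After \<longrightarrow> clear_before b = (clear_before a \<and> blank a)) \<and>
     (labels a 0 \<noteq> Before \<longrightarrow> clear_after a = (clear_after b \<and> blank b))"

text \<open>The slots of a run of \<open>n\<close> cells are numbered along the circle, from left to right through the upper slots
  \<open>0, \<dots>, n - 1\<close> and back from right to left through the lower slots \<open>n, \<dots>, 2 n - 1\<close>.  The two further positions \<open>2 n\<close> and
  \<open>2 n + 1\<close> stand for a head that is missing because all labels are \<open>Before\<close> or all are \<open>After\<close>.  The flags at
  the two ends of a run are not determined by its lamps; these free values are \<open>free_before\<close> and \<open>free_after\<close>.\<close>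

datatype state = State (run_len: nat) (pos: "nat \<Rightarrow> nat") (lit: "nat set") (free_before: bool) (free_after: bool)

text \<open>If all labels of head \<open>0\<close> are \<open>After\<close>, no cell has a meaningful \<open>clear_before\<close>, so the free value is normalized to
  \<open>False\<close>; similarly on the other side.  This makes the encoding injective.\<close>

definition states :: "nat \<Rightarrow> state set" where
  "states m = {\<omega>. run_len \<omega> > 0 \<and> (\<forall>i\<le>m. pos \<omega> i \<le> 2 * run_len \<omega> + 1) \<and> (\<forall>i>m. pos \<omega> i = 2 * run_len \<omega>) \<and>
     lit \<omega> \<subseteq> {..<2 * run_len \<omega>} \<and> (pos \<omega> 0 = 2 * run_len \<omega> + 1 \<longrightarrow> \<not> free_before \<omega>) \<and>
     (pos \<omega> 0 = 2 * run_len \<omega> \<longrightarrow> \<not> free_after \<omega>)}"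

definition cell_of :: "nat \<Rightarrow> nat \<Rightarrow> nat" where
  "cell_of n p = (if p < n then p else 2 * n - 1 - p)"

definition label_at :: "nat \<Rightarrow> nat \<Rightarrow> nat \<Rightarrow> label" where
  "label_at n p k = (if p = 2 * n then Before else if p = 2 * n + 1 then After
     else if k < cell_of n p then Before else if k = cell_of n p then At (n \<le> p) else After)"

definition blank_at :: "state \<Rightarrow> nat \<Rightarrow> bool" where
  "blank_at \<omega> k \<longleftrightarrow> k \<notin> lit \<omega> \<and> 2 * run_len \<omega> - 1 - k \<notin> lit \<omega>"

definition encode_cell :: "state \<Rightarrow> nat \<Rightarrow> cell" where
  "encode_cell \<omega> k = Cell (\<lambda>i. label_at (run_len \<omega>) (pos \<omega> i) k) (k \<in> lit \<omega>) (2 * run_len \<omega> - 1 - k \<in> lit \<omega>)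
     (label_at (run_len \<omega>) (pos \<omega> 0) k \<noteq> After \<and> free_before \<omega> \<and> (\<forall>j<k. blank_at \<omega> j))
     (label_at (run_len \<omega>) (pos \<omega> 0) k \<noteq> Before \<and> free_after \<omega> \<and> (\<forall>j. k < j \<and> j < run_len \<omega> \<longrightarrow> blank_at \<omega> j))"

definition encode :: "state \<Rightarrow> cell list" where
  "encode \<omega> = map (encode_cell \<omega>) [0..<run_len \<omega>]"

lemma length_encode [simp]: "length (encode \<omega>) = run_len \<omega>"
  by (simp add: encode_def)

lemma nth_encode [simp]: "k < run_len \<omega> \<Longrightarrow> encode \<omega> ! k = encode_cell \<omega> k"
  by (simp add: encode_def)

lemma blank_encode_cell: "blank (encode_cell \<omega> k) = blank_at \<omega> k"
  by (simp add: blank_def encode_cell_def blank_at_def)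

lemma cell_of_less: "p < 2 * n \<Longrightarrow> cell_of n p < n"
  by (auto simp: cell_of_def)

text \<open>Follow the labels up to the first one that is not \<open>Before\<close>.\<close>

lemma label_at_sequence:
  fixes f :: "nat \<Rightarrow> label"
  assumes n: "n > 0" and f: "\<And>k. Suc k < n \<Longrightarrow> f k = Before \<longleftrightarrow> f (Suc k) \<noteq> After"
  shows "\<exists>p \<le> 2 * n + 1. \<forall>k<n. f k = label_at n p k"
proof (cases "\<exists>k<n. f k \<noteq> Before")
  case False
  thus ?thesis by (intro exI[of _ "2 * n"]) (simp add: label_at_def)
next
  case True
  define c where "c = (LEAST k. k < n \<and> f k \<noteq> Before)"
  have c: "c < n" "f c \<noteq> Before" using LeastI_ex[OF True] by (simp_all add: c_def)
  have before: "f k = Before" if "k < c" for k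
    using not_less_Least[OF that[unfolded c_def]] that c by simp
  have after: "f k = After" if "c < k" "k < n" for k
    using that
  proof (induction k)
    case (Suc k)
    have "f k \<noteq> Before" using Suc c by (cases "k = c") auto
    thus ?case using f[of k] Suc by simp
  qed simp
  show ?thesis
  proof (cases "f c")
    case After
    have "c = 0"
    proof (rule ccontr)
      assume "c \<noteq> 0"
      thus False using before[of "c - 1"] f[of "c - 1"] c After by simp
    qed
    hence "f k = After" if "k < n" for k using after[of k] After that by (cases "k = 0") auto
    thus ?thesis using n by (intro exI[of _ "2 * n + 1"]) (simp add: label_at_def)
  next
    case (At s)
    define p where "p = (if s then 2 * n - 1 - c else c)"
    have p: "p < 2 * n" "cell_of n p = c" "(n \<le> p) = s" using c by (auto simp: p_def cell_of_def)
    have "f k = label_at n p k" if "k < n" for k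
      using before[of k] after[of k] At p that by (cases k c rule: linorder_cases) (auto simp: label_at_def)
    thus ?thesis using p(1) by (intro exI[of _ p]) simp
  qed (use c in simp)
qed

lemma label_at_inj:
  assumes n: "n > 0" and p: "p \<le> 2 * n + 1" "p' \<le> 2 * n + 1" and eq: "\<And>k. k < n \<Longrightarrow> label_at n p k = label_at n p' k"
  shows "p = p'"
proof -
  have *: "p = p'" if p: "p < 2 * n" and p': "p' \<le> 2 * n + 1" and eq: "\<And>k. k < n \<Longrightarrow> label_at n p k = label_at n p' k" for p p'
  proof -
    have "label_at n p' (cell_of n p) = At (n \<le> p)"
      using eq[OF cell_of_less[OF p]] p by (simp add: label_at_def)
    hence "p' < 2 * n" "cell_of n p' = cell_of n p" "(n \<le> p') = (n \<le> p)"
      using p' by (auto simp: label_at_def split: if_splits)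
    thus ?thesis using p by (auto simp: cell_of_def split: if_splits)
  qed
  show ?thesis
  proof (cases "p < 2 * n \<or> p' < 2 * n")
    case True
    thus ?thesis using *[of p p'] *[of p' p] p eq by auto
  next
    case False
    hence "p \<in> {2 * n, 2 * n + 1}" "p' \<in> {2 * n, 2 * n + 1}" using p by auto
    thus ?thesis using eq[OF n] by (auto simp: label_at_def)
  qed
qed

lemma finite_cells: "finite (cells m)"
proof -
  have "(UNIV :: label set) = {Before, After, At True, At False}"
  proof (rule UNIV_eq_I)
    fix x show "x \<in> {Before, After, At True, At False}" by (cases x) auto
  qed
  hence lab: "finite (UNIV :: label set)" by (metis finite.emptyI finite_insert)
  define D where "D = {f. \<forall>i. (i \<in> {..m} \<longrightarrow> f i \<in> (UNIV :: label set)) \<and> (i \<notin> {..m} \<longrightarrow> f i = Before)}"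
  have "finite D" unfolding D_def by (rule finite_set_of_finite_funs) (simp_all add: lab)
  hence "finite ((\<lambda>(f, u, v, l, r). Cell f u v l r) ` (D \<times> UNIV \<times> UNIV \<times> UNIV \<times> UNIV))"
    by (intro finite_imageI finite_cartesian_product) simp_all
  moreover have "cells m \<subseteq> (\<lambda>(f, u, v, l, r). Cell f u v l r) ` (D \<times> UNIV \<times> UNIV \<times> UNIV \<times> UNIV)"
  proof
    fix c assume "c \<in> cells m"
    hence "labels c \<in> D" by (simp add: cells_def D_def)
    thus "c \<in> (\<lambda>(f, u, v, l, r). Cell f u v l r) ` (D \<times> UNIV \<times> UNIV \<times> UNIV \<times> UNIV)"
      by (intro image_eqI[of _ _ "(labels c, lamp_up c, lamp_dn c, clear_before c, clear_after c)"]) simp_all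
  qed
  ultimately show ?thesis by (rule rev_finite_subset)
qed

lemma encode_valid:
  assumes "\<omega> \<in> states m"
  shows "encode \<omega> \<noteq> []" "set (encode \<omega>) \<subseteq> cells m"
    "Suc k < run_len \<omega> \<Longrightarrow> linked m (encode_cell \<omega> k) (encode_cell \<omega> (Suc k))"
proof -
  show "encode \<omega> \<noteq> []" using assms by (simp add: encode_def states_def)
  show "set (encode \<omega>) \<subseteq> cells m"
    using assms by (auto simp: encode_def cells_def states_def encode_cell_def label_at_def)
  assume k: "Suc k < run_len \<omega>"
  have lab: "label_at (run_len \<omega>) (pos \<omega> i) k = Before \<longleftrightarrow> label_at (run_len \<omega>) (pos \<omega> i) (Suc k) \<noteq> After" for i
    by (auto simp: label_at_def)
  have l: "(\<forall>j<Suc k. blank_at \<omega> j) \<longleftrightarrow> (\<forall>j<k. blank_at \<omega> j) \<and> blank_at \<omega> k"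
    by (auto simp: less_Suc_eq)
  have r: "(\<forall>j. k < j \<and> j < run_len \<omega> \<longrightarrow> blank_at \<omega> j) \<longleftrightarrow>
    (\<forall>j. Suc k < j \<and> j < run_len \<omega> \<longrightarrow> blank_at \<omega> j) \<and> blank_at \<omega> (Suc k)"
    using k by (metis Suc_lessI less_Suc_eq not_less_eq)
  show "linked m (encode_cell \<omega> k) (encode_cell \<omega> (Suc k))"
    unfolding linked_def blank_encode_cell
  proof (intro conjI allI impI)
    fix i show "labels (encode_cell \<omega> k) i = Before \<longleftrightarrow> labels (encode_cell \<omega> (Suc k)) i \<noteq> After"
      using lab[of i] by (simp add: encode_cell_def)
  next
    assume a: "labels (encode_cell \<omega> (Suc k)) 0 \<noteq> After"
    hence "labels (encode_cell \<omega> k) 0 \<noteq> After" using lab[of 0] by (auto simp: encode_cell_def)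
    thus "clear_before (encode_cell \<omega> (Suc k)) = (clear_before (encode_cell \<omega> k) \<and> blank_at \<omega> k)"
      using a unfolding encode_cell_def cell.sel l by blast
  next
    assume a: "labels (encode_cell \<omega> k) 0 \<noteq> Before"
    hence "labels (encode_cell \<omega> (Suc k)) 0 \<noteq> Before" using lab[of 0] by (auto simp: encode_cell_def)
    thus "clear_after (encode_cell \<omega> k) = (clear_after (encode_cell \<omega> (Suc k)) \<and> blank_at \<omega> (Suc k))"
      using a unfolding encode_cell_def cell.sel r by blast
  qed
qed

text \<open>Every run of cells comes from a state: the labels determine the positions of the heads, the lamps can
  be read off, and the flags are determined by their values at the ends, by induction from the left for
  \<open>clear_before\<close> and from the right for \<open>clear_after\<close>.\<close>

lemma encode_surj:
  assumes w: "w \<noteq> []" "set w \<subseteq> cells m" and link: "\<And>k. Suc k < length w \<Longrightarrow> linked m (w ! k) (w ! Suc k)"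
  shows "\<exists>\<omega> \<in> states m. w = encode \<omega>"
proof -
  define n where "n = length w"
  have n: "n > 0" using w by (simp add: n_def)
  have cell: "w ! k \<in> cells m" if "k < n" for k using that w(2) nth_mem by (auto simp: n_def)
  have "\<exists>p \<le> 2 * n + 1. (\<forall>k<n. labels (w ! k) i = label_at n p k) \<and> (i > m \<longrightarrow> p = 2 * n)" for i
  proof (cases "i \<le> m")
    case True
    have "\<exists>p \<le> 2 * n + 1. \<forall>k<n. labels (w ! k) i = label_at n p k"
      by (rule label_at_sequence[OF n]) (use link True in \<open>simp add: n_def linked_def\<close>)
    thus ?thesis using True by auto
  next
    case False
    thus ?thesis using cell by (intro exI[of _ "2 * n"]) (auto simp: cells_def label_at_def)
  qed
  then obtain p where p: "\<And>i. p i \<le> 2 * n + 1" "\<And>i k. k < n \<Longrightarrow> labels (w ! k) i = label_at n (p i) k"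
    "\<And>i. i > m \<Longrightarrow> p i = 2 * n" by metis
  define X where "X = {k. k < n \<and> lamp_up (w ! k)} \<union> (\<lambda>k. 2 * n - 1 - k) ` {k. k < n \<and> lamp_dn (w ! k)}"
  define \<omega> where "\<omega> = State n p X (clear_before (w ! 0)) (clear_after (w ! (n - 1)))"
  have up: "k \<in> X \<longleftrightarrow> lamp_up (w ! k)" if "k < n" for k using that by (auto simp: X_def)
  have dn: "2 * n - 1 - k \<in> X \<longleftrightarrow> lamp_dn (w ! k)" if k: "k < n" for k
  proof
    assume "2 * n - 1 - k \<in> X"
    then obtain j where "j < n" "lamp_dn (w ! j)" "2 * n - 1 - k = 2 * n - 1 - j"
      using k by (auto simp: X_def)
    moreover from this have "j = k" using k by simp
    ultimately show "lamp_dn (w ! k)" by simp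
  qed (use k in \<open>auto simp: X_def\<close>)
  have bl: "blank (w ! k) = blank_at \<omega> k" if "k < n" for k
    using up[OF that] dn[OF that] by (simp add: blank_def blank_at_def \<omega>_def)
  have cb: "clear_before (w ! k) \<longleftrightarrow> labels (w ! k) 0 \<noteq> After \<and> clear_before (w ! 0) \<and> (\<forall>j<k. blank_at \<omega> j)"
    if "k < n" for k using that
  proof (induction k)
    case 0
    thus ?case using cell[of 0] by (auto simp: cells_def)
  next
    case (Suc k)
    have "linked m (w ! k) (w ! Suc k)" using link Suc.prems by (simp add: n_def)
    hence 1: "labels (w ! k) 0 = Before \<longleftrightarrow> labels (w ! Suc k) 0 \<noteq> After"
      and 2: "labels (w ! Suc k) 0 \<noteq> After \<Longrightarrow> clear_before (w ! Suc k) = (clear_before (w ! k) \<and> blank (w ! k))"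
      by (simp_all add: linked_def)
    show ?case
    proof (cases "labels (w ! Suc k) 0 = After")
      case True
      thus ?thesis using cell[OF Suc.prems] by (simp add: cells_def)
    next
      case False
      thus ?thesis using 1 2[OF False] Suc bl[of k] by (auto simp: less_Suc_eq)
    qed
  qed
  have ca: "clear_after (w ! (n - 1 - d)) \<longleftrightarrow> labels (w ! (n - 1 - d)) 0 \<noteq> Before \<and> clear_after (w ! (n - 1)) \<and>
    (\<forall>j. n - 1 - d < j \<and> j < n \<longrightarrow> blank_at \<omega> j)" if "d < n" for d using that
  proof (induction d)
    case 0
    thus ?case using cell[of "n - 1"] n by (auto simp: cells_def)
  next
    case (Suc d)
    define k where "k = n - 1 - Suc d"
    have k: "Suc k = n - 1 - d" "Suc k < n" using Suc.prems by (auto simp: k_def)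
    have "linked m (w ! k) (w ! Suc k)" by (rule link[OF k(2)[unfolded n_def]])
    hence 1: "labels (w ! k) 0 = Before \<longleftrightarrow> labels (w ! Suc k) 0 \<noteq> After"
      and 2: "labels (w ! k) 0 \<noteq> Before \<Longrightarrow> clear_after (w ! k) = (clear_after (w ! Suc k) \<and> blank (w ! Suc k))"
      by (simp_all add: linked_def)
    have 3: "(\<forall>j. k < j \<and> j < n \<longrightarrow> blank_at \<omega> j) \<longleftrightarrow> (\<forall>j. Suc k < j \<and> j < n \<longrightarrow> blank_at \<omega> j) \<and> blank_at \<omega> (Suc k)"
      using k(2) by (metis Suc_lessI less_Suc_eq not_less_eq)
    have "clear_after (w ! k) \<longleftrightarrow> labels (w ! k) 0 \<noteq> Before \<and> clear_after (w ! (n - 1)) \<and>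
      (\<forall>j. k < j \<and> j < n \<longrightarrow> blank_at \<omega> j)"
    proof (cases "labels (w ! k) 0 = Before")
      case True
      thus ?thesis using cell[of k] k by (simp add: cells_def)
    next
      case False
      have IH: "clear_after (w ! Suc k) \<longleftrightarrow> labels (w ! Suc k) 0 \<noteq> Before \<and> clear_after (w ! (n - 1)) \<and>
        (\<forall>j. Suc k < j \<and> j < n \<longrightarrow> blank_at \<omega> j)"
        using Suc.IH Suc.prems unfolding k(1) by simp
      show ?thesis unfolding 2[OF False] 3 bl[OF k(2)] IH using 1 False by auto
    qed
    thus ?case by (simp add: k_def)
  qed
  have rl: "run_len \<omega> = n" by (simp add: \<omega>_def)
  have nth: "w ! k = encode_cell \<omega> k" if k: "k < n" for k
  proof (rule cell.expand, intro conjI)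
    show "labels (w ! k) = labels (encode_cell \<omega> k)" using p(2)[OF k] by (auto simp: encode_cell_def \<omega>_def)
    show "lamp_up (w ! k) = lamp_up (encode_cell \<omega> k)" using up[OF k] by (simp add: encode_cell_def \<omega>_def)
    show "lamp_dn (w ! k) = lamp_dn (encode_cell \<omega> k)" using dn[OF k] by (simp add: encode_cell_def \<omega>_def)
    show "clear_before (w ! k) = clear_before (encode_cell \<omega> k)"
      using cb[OF k] p(2)[OF k, of 0] by (simp add: encode_cell_def) (simp add: \<omega>_def)
    show "clear_after (w ! k) = clear_after (encode_cell \<omega> k)"
      using ca[of "n - 1 - k"] k p(2)[OF k, of 0] by (simp add: encode_cell_def) (simp add: \<omega>_def)
  qed
  have "w = encode \<omega>"
  proof (rule nth_equalityI)
    show "length w = length (encode \<omega>)" by (simp add: rl n_def)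
    fix k assume "k < length w"
    hence "k < n" by (simp add: n_def)
    thus "w ! k = encode \<omega> ! k" using nth[of k] rl by simp
  qed
  moreover have "\<omega> \<in> states m"
  proof -
    have "X \<subseteq> {..<2 * n}" by (auto simp: X_def)
    moreover have "p 0 = 2 * n + 1 \<Longrightarrow> \<not> clear_before (w ! 0)"
      using cell[OF n] p(2)[OF n, of 0] by (simp add: cells_def label_at_def)
    moreover have "p 0 = 2 * n \<Longrightarrow> \<not> clear_after (w ! (n - 1))"
      using cell[of "n - 1"] p(2)[of "n - 1" 0] n by (simp add: cells_def label_at_def)
    ultimately show ?thesis using n p(1) p(3) by (simp add: states_def \<omega>_def)
  qed
  ultimately show ?thesis by blast
qed

lemma inj_on_encode: "inj_on encode (states m)"
proof (rule inj_onI)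
  fix \<omega> \<omega>' assume \<omega>: "\<omega> \<in> states m" "\<omega>' \<in> states m" and eq: "encode \<omega> = encode \<omega>'"
  define n where "n = run_len \<omega>"
  have n': "run_len \<omega>' = n" using arg_cong[OF eq, of length] by (simp add: n_def)
  have n: "n > 0" using \<omega> by (simp add: n_def states_def)
  have cell: "encode_cell \<omega> k = encode_cell \<omega>' k" if "k < n" for k
    using arg_cong[OF eq, of "\<lambda>w. w ! k"] that n' by (simp add: n_def)
  have pos: "pos \<omega> i = pos \<omega>' i" for i
  proof (rule label_at_inj[OF n])
    show "pos \<omega> i \<le> 2 * n + 1" "pos \<omega>' i \<le> 2 * n + 1"
      using \<omega> n' by (cases "i \<le> m"; force simp: states_def n_def)+
    fix k assume "k < n"
    from arg_cong[OF cell[OF this], of "\<lambda>c. labels c i"] show "label_at n (pos \<omega> i) k = label_at n (pos \<omega>' i) k"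
      by (simp add: encode_cell_def n' flip: n_def)
  qed
  have lit_iff: "(p \<in> lit \<omega>) = (p \<in> lit \<omega>')" if p: "p < 2 * n" for p
  proof (cases "p < n")
    case True
    from arg_cong[OF cell[OF this], of lamp_up] show ?thesis by (simp add: encode_cell_def)
  next
    case False
    hence k: "2 * n - 1 - p < n" "2 * n - 1 - (2 * n - 1 - p) = p" using p by auto
    from arg_cong[OF cell[OF k(1)], of lamp_dn] k(2) show ?thesis by (simp add: encode_cell_def n' flip: n_def)
  qed
  have "lit \<omega> = lit \<omega>'"
  proof -
    have "lit \<omega> \<subseteq> {..<2 * n}" "lit \<omega>' \<subseteq> {..<2 * n}" using \<omega> n' by (auto simp: states_def n_def)
    thus ?thesis using lit_iff by blast
  qed
  moreover have "free_before \<omega> = free_before \<omega>'"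
  proof (cases "pos \<omega> 0 = 2 * n + 1")
    case True
    thus ?thesis using \<omega> pos[of 0] n' by (simp add: states_def n_def)
  next
    case False
    hence "label_at n (pos \<omega> 0) 0 \<noteq> After" by (simp add: label_at_def)
    thus ?thesis using arg_cong[OF cell[OF n], of clear_before] pos[of 0] n' by (simp add: encode_cell_def flip: n_def)
  qed
  moreover have "free_after \<omega> = free_after \<omega>'"
  proof (cases "pos \<omega> 0 = 2 * n")
    case True
    thus ?thesis using \<omega> pos[of 0] n' by (simp add: states_def n_def)
  next
    case False
    have c: "cell_of n (pos \<omega> 0) < n" if "pos \<omega> 0 \<noteq> 2 * n + 1"
    proof (rule cell_of_less)
      have "pos \<omega> 0 \<le> 2 * n + 1" using \<omega> by (simp add: states_def n_def)
      thus "pos \<omega> 0 < 2 * n" using that False by simp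
    qed
    have "label_at n (pos \<omega> 0) (n - 1) \<noteq> Before"
    proof (cases "pos \<omega> 0 = 2 * n + 1")
      assume "pos \<omega> 0 \<noteq> 2 * n + 1"
      hence "\<not> n - 1 < cell_of n (pos \<omega> 0)" using c by linarith
      thus ?thesis using False by (simp add: label_at_def)
    qed (simp add: label_at_def)
    moreover have "clear_after (encode_cell \<omega>'' (n - 1)) = free_after \<omega>''"
      if "run_len \<omega>'' = n" "label_at n (pos \<omega>'' 0) (n - 1) \<noteq> Before" for \<omega>''
    proof -
      have "\<forall>j. n - 1 < j \<and> j < n \<longrightarrow> blank_at \<omega>'' j" by auto
      thus ?thesis unfolding encode_cell_def cell.sel using that by blast
    qed
    ultimately show ?thesis using cell[of "n - 1"] n pos[of 0] n' n_def by (metis diff_less zero_less_one)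
  qed
  moreover have "pos \<omega> = pos \<omega>'" using pos by blast
  ultimately show "\<omega> = \<omega>'" using n' by (intro state.expand) (simp add: n_def)
qed

interpretation machine: run_system "cells m" "linked m" "states m" encode for m
proof
  show "inj_on encode (states m)" by (rule inj_on_encode)
  show "encode ` states m = {w. w \<noteq> [] \<and> set w \<subseteq> cells m \<and> (\<forall>k. Suc k < length w \<longrightarrow> linked m (w ! k) (w ! Suc k))}"
  proof (intro equalityI subsetI)
    fix w assume "w \<in> encode ` states m"
    then obtain \<omega> where "\<omega> \<in> states m" "w = encode \<omega>" by blast
    thus "w \<in> {w. w \<noteq> [] \<and> set w \<subseteq> cells m \<and> (\<forall>k. Suc k < length w \<longrightarrow> linked m (w ! k) (w ! Suc k))}"
      using encode_valid[of \<omega> m] by simp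
  next
    fix w assume "w \<in> {w. w \<noteq> [] \<and> set w \<subseteq> cells m \<and> (\<forall>k. Suc k < length w \<longrightarrow> linked m (w ! k) (w ! Suc k))}"
    thus "w \<in> encode ` states m" using encode_surj[of w m] by blast
  qed
qed

text \<open>For an involution the inverse needs no separate automaton.  All elementary moves are
  involutions.\<close>

lemma (in run_system) involution_run_perms:
  assumes r: "realizable \<pi>" and inv: "\<And>\<omega>. \<omega> \<in> \<Omega> \<Longrightarrow> \<pi> (\<pi> \<omega>) = \<omega>"
  shows "restrict \<pi> \<Omega> \<in> run_perms"
proof -
  interpret B: group "BijGroup \<Omega>" by (rule group_BijGroup)
  have maps: "\<pi> \<omega> \<in> \<Omega>" if "\<omega> \<in> \<Omega>" for \<omega>
    using r realizesD(2)[OF _ that] unfolding realizable_def by (elim exE)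
  have "bij_betw \<pi> \<Omega> \<Omega>" by (rule bij_betwI[of _ _ _ \<pi>]) (use maps inv in auto)
  hence "bij_betw (restrict \<pi> \<Omega>) \<Omega> \<Omega>" by (simp cong: bij_betw_cong)
  hence b: "restrict \<pi> \<Omega> \<in> Bij \<Omega>" by (simp add: Bij_def)
  have "restrict \<pi> \<Omega> \<otimes>\<^bsub>BijGroup \<Omega>\<^esub> restrict \<pi> \<Omega> = compose \<Omega> (restrict \<pi> \<Omega>) (restrict \<pi> \<Omega>)"
    by (rule mult_Bij[OF b b])
  also have "\<dots> = \<one>\<^bsub>BijGroup \<Omega>\<^esub>"
    using maps inv by (auto simp: BijGroup_def compose_def fun_eq_iff)
  finally have "inv\<^bsub>BijGroup \<Omega>\<^esub> restrict \<pi> \<Omega> = restrict \<pi> \<Omega>"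
    by (rule B.inv_equality) (use b in \<open>simp_all add: BijGroup_def\<close>)
  moreover have "realizable (restrict \<pi> \<Omega>)" by (rule realizable_cong[OF r]) simp
  ultimately show ?thesis using b by (simp add: run_perms_def)
qed

section \<open>Local operations on heads and lamps\<close>

abbreviation realizes_on :: "nat \<Rightarrow> _ \<Rightarrow> (state \<Rightarrow> state) \<Rightarrow> bool" where
  "realizes_on m \<equiv> run_system.realizes (cells m) (linked m) (states m) encode"

abbreviation machine_perms :: "nat \<Rightarrow> (state \<Rightarrow> state) set" where
  "machine_perms m \<equiv> run_system.run_perms (cells m) (linked m) (states m) encode"

abbreviation machine_group :: "nat \<Rightarrow> (state \<Rightarrow> state) monoid" where
  "machine_group m \<equiv> run_system.run_group (cells m) (linked m) (states m) encode"

definition slot :: "nat \<Rightarrow> nat \<Rightarrow> bool \<Rightarrow> nat" where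
  "slot n k s = (if s then 2 * n - 1 - k else k)"

lemma label_at_At_iff:
  assumes "k < n" "p \<le> 2 * n + 1"
  shows "label_at n p k = At s \<longleftrightarrow> p = slot n k s"
  using assms by (auto simp: label_at_def slot_def cell_of_def)

definition with_pos :: "state \<Rightarrow> (nat \<Rightarrow> nat) \<Rightarrow> state" where
  "with_pos \<omega> p = State (run_len \<omega>) p (lit \<omega>) (free_before \<omega>) (free_after \<omega>)"

lemma with_pos_sel [simp]:
  "run_len (with_pos \<omega> p) = run_len \<omega>" "pos (with_pos \<omega> p) = p" "lit (with_pos \<omega> p) = lit \<omega>"
  "free_before (with_pos \<omega> p) = free_before \<omega>" "free_after (with_pos \<omega> p) = free_after \<omega>"
  by (simp_all add: with_pos_def)

lemma with_pos_with_pos [simp]: "with_pos (with_pos \<omega> p) p' = with_pos \<omega> p'"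
  by (simp add: with_pos_def)

lemma with_pos_same [simp]: "with_pos \<omega> (pos \<omega>) = \<omega>"
  by (cases \<omega>) (simp add: with_pos_def)

lemma blank_at_with_pos [simp]: "blank_at (with_pos \<omega> p) = blank_at \<omega>"
  by (simp add: blank_at_def fun_eq_iff)

definition gathered :: "nat set \<Rightarrow> state \<Rightarrow> bool" where
  "gathered M \<omega> \<longleftrightarrow> (\<exists>p < 2 * run_len \<omega>. \<forall>i\<in>M. pos \<omega> i = p)"

text \<open>Moves the heads of \<open>M\<close> together, and only if they are in one slot; a local rule can check this.\<close>

definition move_if :: "(nat \<Rightarrow> nat \<Rightarrow> nat) \<Rightarrow> nat set \<Rightarrow> (state \<Rightarrow> bool) \<Rightarrow> state \<Rightarrow> state" where
  "move_if r M C \<omega> = (if C \<omega> \<and> gathered M \<omega>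
     then with_pos \<omega> (\<lambda>i. if i \<in> M then r (run_len \<omega>) (pos \<omega> i) else pos \<omega> i) else \<omega>)"

text \<open>Exchanges the two slots of each cell.\<close>

definition refl_cell :: "nat \<Rightarrow> nat \<Rightarrow> nat" where "refl_cell n p = 2 * n - 1 - p"

text \<open>Exchanges the lower slot \<open>2 n - 1 - k\<close> of cell \<open>k\<close> with the upper slot \<open>k + 1\<close> of the next cell.  The upper slot of the first
  cell and the lower slot of the last cell have no partner and stay fixed.\<close>

definition refl_edge :: "nat \<Rightarrow> nat \<Rightarrow> nat" where "refl_edge n p = (if p = 0 then 0 else 2 * n - p)"

lemma pos_le: "\<omega> \<in> states m \<Longrightarrow> pos \<omega> i \<le> 2 * run_len \<omega> + 1"
  by (cases "i \<le> m") (auto simp: states_def)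

lemma move_if_states:
  assumes \<omega>: "\<omega> \<in> states m" and M: "M \<subseteq> {..m}" and r: "\<And>n p. p < 2 * n \<Longrightarrow> r n p < 2 * n"
  shows "move_if r M C \<omega> \<in> states m"
proof (cases "C \<omega> \<and> gathered M \<omega>")
  case True
  define n where "n = run_len \<omega>"
  have p: "pos \<omega> i < 2 * n" "r n (pos \<omega> i) < 2 * n" if "i \<in> M" for i
    using True that r[of "pos \<omega> i" n] by (auto simp: gathered_def n_def)
  define q where "q i = (if i \<in> M then r n (pos \<omega> i) else pos \<omega> i)" for i
  have "q i \<le> 2 * n + 1" for i using p[of i] pos_le[OF \<omega>, of i] by (cases "i \<in> M") (auto simp: q_def n_def)
  moreover have "q i = 2 * n" if "i > m" for i using \<omega> that M by (auto simp: q_def n_def states_def)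
  moreover have "q 0 = 2 * n + 1 \<Longrightarrow> pos \<omega> 0 = 2 * n + 1" "q 0 = 2 * n \<Longrightarrow> pos \<omega> 0 = 2 * n"
    using p[of 0] by (auto simp: q_def split: if_splits)
  moreover have "move_if r M C \<omega> = with_pos \<omega> q"
    unfolding move_if_def q_def n_def using True by simp
  ultimately show ?thesis using \<omega> by (simp add: states_def n_def)
next
  case False
  hence "move_if r M C \<omega> = \<omega>" unfolding move_if_def by (simp only: if_False)
  thus ?thesis using \<omega> by simp
qed

lemma run_len_move_if [simp]: "run_len (move_if r M C \<omega>) = run_len \<omega>"
  by (simp add: move_if_def)

text \<open>The condition survives the move by assumption, and the heads stay together.\<close>

lemma move_if_involution:
  assumes r: "\<And>n p. p < 2 * n \<Longrightarrow> r n p < 2 * n" "\<And>n p. p < 2 * n \<Longrightarrow> r n (r n p) = p"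
    and C: "\<And>\<omega>. C \<omega> \<Longrightarrow> gathered M \<omega> \<Longrightarrow> C (move_if r M C \<omega>)"
  shows "move_if r M C (move_if r M C \<omega>) = \<omega>"
proof (cases "C \<omega> \<and> gathered M \<omega>")
  case True
  then obtain p where p: "p < 2 * run_len \<omega>" "\<And>i. i \<in> M \<Longrightarrow> pos \<omega> i = p" by (auto simp: gathered_def)
  define \<omega>' where "\<omega>' = with_pos \<omega> (\<lambda>i. if i \<in> M then r (run_len \<omega>) (pos \<omega> i) else pos \<omega> i)"
  have m: "move_if r M C \<omega> = \<omega>'" using True by (simp add: move_if_def \<omega>'_def)
  have "gathered M \<omega>'"
    unfolding gathered_def \<omega>'_def using p r(1)[OF p(1)] by (intro exI[of _ "r (run_len \<omega>) p"]) simp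
  moreover have "C \<omega>'" using C[of \<omega>] True m by simp
  ultimately have "move_if r M C \<omega>' = with_pos \<omega>' (\<lambda>i. if i \<in> M then r (run_len \<omega>) (pos \<omega>' i) else pos \<omega>' i)"
    by (simp add: move_if_def \<omega>'_def cong: if_cong)
  also have "\<dots> = with_pos \<omega> (pos \<omega>)"
  proof -
    have "(\<lambda>i. if i \<in> M then r (run_len \<omega>) (pos \<omega>' i) else pos \<omega>' i) = pos \<omega>"
      using p r(2)[OF p(1)] by (auto simp: \<omega>'_def fun_eq_iff)
    thus ?thesis by (simp add: \<omega>'_def)
  qed
  finally show ?thesis using m by simp
next
  case False
  hence "move_if r M C \<omega> = \<omega>" unfolding move_if_def by (simp only: if_False)
  thus ?thesis by simp
qed

definition turn :: "label \<Rightarrow> label" where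
  "turn l = (case l of At s \<Rightarrow> At (\<not> s) | _ \<Rightarrow> l)"

definition turn_rule :: "nat set \<Rightarrow> (cell \<Rightarrow> bool) \<Rightarrow> cell \<Rightarrow> cell" where
  "turn_rule M D a = (if D a \<and> (\<exists>s. \<forall>i\<in>M. labels a i = At s)
     then Cell (\<lambda>i. if i \<in> M then turn (labels a i) else labels a i) (lamp_up a) (lamp_dn a) (clear_before a) (clear_after a)
     else a)"

lemma turn_simps [simp]: "turn l = Before \<longleftrightarrow> l = Before" "turn l = After \<longleftrightarrow> l = After" "turn (At s) = At (\<not> s)"
  by (cases l; simp add: turn_def)+ 

lemma turn_rule_sel:
  "(labels (turn_rule M D a) i = Before) = (labels a i = Before)"
  "(labels (turn_rule M D a) i = After) = (labels a i = After)"
  "lamp_up (turn_rule M D a) = lamp_up a" "lamp_dn (turn_rule M D a) = lamp_dn a"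
  "clear_before (turn_rule M D a) = clear_before a" "clear_after (turn_rule M D a) = clear_after a"
  by (simp_all add: turn_rule_def)

text \<open>The condition \<open>C\<close> on the state may be global, but it must be visible in the cell that contains the
  heads; \<open>D\<close> is this local test.\<close>

lemma realizes_turn:
  assumes M: "M \<noteq> {}" "M \<subseteq> {..m}"
    and D: "\<And>\<omega> k s. \<lbrakk>\<omega> \<in> states m; k < run_len \<omega>; \<forall>i\<in>M. pos \<omega> i = slot (run_len \<omega>) k s\<rbrakk>
      \<Longrightarrow> D (encode_cell \<omega> k) = C \<omega>"
  shows "\<exists>F. realizes_on m F (move_if refl_cell M C)"
proof (rule exI, rule machine.realizes_cell_rule)
  show "turn_rule M D a \<in> cells m" if "a \<in> cells m" for a
    using that by (simp add: cells_def turn_rule_sel)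
  show "linked m (turn_rule M D a) (turn_rule M D b) = linked m a b" for a b
    by (simp add: linked_def blank_def turn_rule_sel)
  fix \<omega> assume \<omega>: "\<omega> \<in> states m"
  show "move_if refl_cell M C \<omega> \<in> states m"
    using \<omega> M(2) by (rule move_if_states) (simp add: refl_cell_def)
  define n where "n = run_len \<omega>"
  define \<omega>' where "\<omega>' = move_if refl_cell M C \<omega>"
  have "encode_cell \<omega>' k = turn_rule M D (encode_cell \<omega> k)" if k: "k < n" for k
  proof -
    have lab: "labels (encode_cell \<omega> k) i = At s \<longleftrightarrow> pos \<omega> i = slot n k s" for i s
      using label_at_At_iff[OF k] pos_le[OF \<omega>] by (simp add: encode_cell_def n_def)
    show ?thesis
    proof (cases "D (encode_cell \<omega> k) \<and> (\<exists>s. \<forall>i\<in>M. labels (encode_cell \<omega> k) i = At s)")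
      case True
      then obtain s where s: "\<And>i. i \<in> M \<Longrightarrow> pos \<omega> i = slot n k s" using lab by blast
      hence "C \<omega>" using D[OF \<omega>, of k s] True k by (simp add: n_def)
      moreover have "gathered M \<omega>"
        unfolding gathered_def using s k by (intro exI[of _ "slot n k s"]) (auto simp: slot_def n_def)
      ultimately have \<omega>': "\<omega>' = with_pos \<omega> (\<lambda>i. if i \<in> M then refl_cell n (pos \<omega> i) else pos \<omega> i)"
        unfolding \<omega>'_def move_if_def n_def by simp
      have r: "refl_cell n (slot n k s) = slot n k (\<not> s)" using k by (auto simp: refl_cell_def slot_def)
      have l: "label_at n (slot n k t) k = At t" for t
      proof -
        have "slot n k t \<le> 2 * n + 1" using k unfolding slot_def by auto
        thus ?thesis using label_at_At_iff[OF k] by simp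
      qed
      have labs: "labels (encode_cell \<omega>' k) i = (if i \<in> M then turn (labels (encode_cell \<omega> k) i) else labels (encode_cell \<omega> k) i)" for i
        using s[of i] r l by (simp add: encode_cell_def \<omega>' flip: n_def)
      hence "labels (encode_cell \<omega>' k) = (\<lambda>i. if i \<in> M then turn (labels (encode_cell \<omega> k) i) else labels (encode_cell \<omega> k) i)"
        by (rule ext)
      moreover have "(labels (encode_cell \<omega>' k) 0 = Before) = (labels (encode_cell \<omega> k) 0 = Before)"
        "(labels (encode_cell \<omega>' k) 0 = After) = (labels (encode_cell \<omega> k) 0 = After)"
        unfolding labs[of 0] by simp_all
      moreover have "lamp_up (encode_cell \<omega>' k) = lamp_up (encode_cell \<omega> k)"
        "lamp_dn (encode_cell \<omega>' k) = lamp_dn (encode_cell \<omega> k)"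
        by (simp_all add: encode_cell_def \<omega>')
      moreover have "clear_before (encode_cell \<omega>'' j) \<longleftrightarrow> labels (encode_cell \<omega>'' j) 0 \<noteq> After \<and> free_before \<omega>'' \<and> (\<forall>i<j. blank_at \<omega>'' i)"
        "clear_after (encode_cell \<omega>'' j) \<longleftrightarrow> labels (encode_cell \<omega>'' j) 0 \<noteq> Before \<and> free_after \<omega>'' \<and> (\<forall>i. j < i \<and> i < run_len \<omega>'' \<longrightarrow> blank_at \<omega>'' i)"
        for \<omega>'' j by (simp_all add: encode_cell_def)
      ultimately show ?thesis
        using True by (intro cell.expand) (simp add: turn_rule_def \<omega>')
    next
      case False
      hence t: "turn_rule M D (encode_cell \<omega> k) = encode_cell \<omega> k"
        unfolding turn_rule_def by (simp only: if_False)
      show ?thesis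
      proof (cases "C \<omega> \<and> gathered M \<omega>")
        case True
        then obtain p where p: "p < 2 * n" "\<And>i. i \<in> M \<Longrightarrow> pos \<omega> i = p" by (auto simp: gathered_def n_def)
        have "p \<noteq> slot n k s" for s
        proof
          assume "p = slot n k s"
          hence "D (encode_cell \<omega> k)" "\<forall>i\<in>M. labels (encode_cell \<omega> k) i = At s"
            using D[OF \<omega>, of k s] True p k lab by (auto simp: n_def)
          thus False using False by blast
        qed
        from this[of True] this[of False] have "label_at n (refl_cell n p) k = label_at n p k"
          using p(1) k by (auto simp: label_at_def slot_def refl_cell_def cell_of_def)
        hence "label_at n (if i \<in> M then refl_cell n (pos \<omega> i) else pos \<omega> i) k = label_at n (pos \<omega> i) k" for i
          using p(2) by simp
        moreover have "\<omega>' = with_pos \<omega> (\<lambda>i. if i \<in> M then refl_cell n (pos \<omega> i) else pos \<omega> i)"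
          unfolding \<omega>'_def move_if_def n_def using True by simp
        ultimately show ?thesis unfolding t by (simp add: encode_cell_def flip: n_def)
      next
        case False
        hence "\<omega>' = \<omega>" unfolding \<omega>'_def move_if_def by (simp only: if_False)
        thus ?thesis by (simp add: t)
      qed
    qed
  qed
  thus "encode (move_if refl_cell M C \<omega>) = map (turn_rule M D) (encode \<omega>)"
    by (simp add: encode_def flip: \<omega>'_def n_def) (simp add: \<omega>'_def n_def)
qed

text \<open>The heads of \<open>M\<close> are together in one of the two slots that face the border between \<open>a\<close> and \<open>b\<close>.\<close>

definition crossing :: "nat set \<Rightarrow> (cell \<Rightarrow> cell \<Rightarrow> bool) \<Rightarrow> cell \<Rightarrow> cell \<Rightarrow> bool" where
  "crossing M D a b \<longleftrightarrow> D a b \<and> ((\<forall>i\<in>M. labels a i = At True \<and> labels b i = After) \<or>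
     (\<forall>i\<in>M. labels a i = Before \<and> labels b i = At False))"

text \<open>In the first case the heads leave the cell, which is then before them, in the second case they enter it.
  If head \<open>0\<close> is among them, the flag \<open>clear_after\<close> of this cell loses or acquires its meaning, and the value to
  be acquired is known to the neighbour.\<close>

definition cross_left :: "nat set \<Rightarrow> cell \<Rightarrow> cell \<Rightarrow> cell" where
  "cross_left M a b = (if \<forall>i\<in>M. labels a i = At True
     then Cell (\<lambda>i. if i \<in> M then Before else labels a i) (lamp_up a) (lamp_dn a) (clear_before a)
       (0 \<notin> M \<and> clear_after a)
     else Cell (\<lambda>i. if i \<in> M then At True else labels a i) (lamp_up a) (lamp_dn a) (clear_before a)
       (if 0 \<in> M then clear_after b \<and> blank b else clear_after a))"

definition cross_right :: "nat set \<Rightarrow> cell \<Rightarrow> cell \<Rightarrow> cell" where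
  "cross_right M a b = (if \<forall>i\<in>M. labels a i = At True
     then Cell (\<lambda>i. if i \<in> M then At False else labels b i) (lamp_up b) (lamp_dn b)
       (if 0 \<in> M then clear_before a \<and> blank a else clear_before b) (clear_after b)
     else Cell (\<lambda>i. if i \<in> M then After else labels b i) (lamp_up b) (lamp_dn b)
       (0 \<notin> M \<and> clear_before b) (clear_after b))"

text \<open>Only the two cells at the border that the head crosses change their labels.\<close>

lemma label_at_refl_edge:
  assumes "k < n" "p < 2 * n"
  shows "label_at n (refl_edge n p) k =
    (if Suc k < n \<and> p = 2 * n - 1 - k then Before else if Suc k < n \<and> p = Suc k then At True
     else if 0 < k \<and> p = 2 * n - k then At False else if 0 < k \<and> p = k then After else label_at n p k)"
proof -
  have at: "label_at n q k = (if k < cell_of n q then Before else if k = cell_of n q then At (n \<le> q) else After)"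
    if "q < 2 * n" for q using that by (simp add: label_at_def)
  consider "p = 0" | "p = n" | "0 < p" "p < n" | "n < p" by linarith
  thus ?thesis
  proof cases
    case 1
    thus ?thesis using assms by (auto simp: refl_edge_def)
  next
    case 2
    thus ?thesis using assms by (auto simp: refl_edge_def)
  next
    case 3
    hence q: "refl_edge n p = 2 * n - p" "2 * n - p < 2 * n" "cell_of n (2 * n - p) = p - 1" "n \<le> 2 * n - p"
      "cell_of n p = p" "\<not> n \<le> p"
      by (auto simp: refl_edge_def cell_of_def)
    have ne: "p \<noteq> 2 * n - 1 - k" "p \<noteq> 2 * n - k" using 3 assms by linarith+
    have lhs: "label_at n (refl_edge n p) k = (if k < p - 1 then Before else if k = p - 1 then At True else After)"
      unfolding q(1) at[OF q(2)] q(3) using q(4) by simp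
    have rhs: "label_at n p k = (if k < p then Before else if k = p then At False else After)"
      unfolding at[OF assms(2)] q(5) using q(6) by simp
    consider "Suc k < p" | "Suc k = p" | "k = p" | "p < k" by linarith
    thus ?thesis unfolding lhs rhs using ne 3 assms(1) by cases auto
  next
    case 4
    define c where "c = 2 * n - 1 - p"
    have c: "refl_edge n p = Suc c" "Suc c < n" "cell_of n (Suc c) = Suc c" "cell_of n p = c"
      using 4 assms(2) by (auto simp: refl_edge_def cell_of_def c_def)
    have eq: "(p = 2 * n - 1 - k) = (k = c)" "(p = 2 * n - k) = (k = Suc c)" "p \<noteq> k" "Suc k < n \<Longrightarrow> p \<noteq> Suc k"
      using 4 assms by (auto simp: c_def)
    have "Suc c < 2 * n" using c(2) by simp
    from at[OF this] have lhs: "label_at n (refl_edge n p) k = (if k < Suc c then Before else if k = Suc c then At False else After)"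
      unfolding c(1,3) using c(2) by simp
    have rhs: "label_at n p k = (if k < c then Before else if k = c then At True else After)"
      unfolding at[OF assms(2)] c(4) using 4 by simp
    consider "k < c" | "k = c" | "k = Suc c" | "Suc c < k" by linarith
    thus ?thesis unfolding lhs rhs eq(1,2) using eq(3,4) c(2) by cases auto
  qed
qed

lemma edge_labels:
  assumes j: "Suc j < n" and p: "p \<le> 2 * n + 1"
  shows "label_at n p j = At True \<and> label_at n p (Suc j) = After \<longleftrightarrow> p = 2 * n - 1 - j"
    and "label_at n p j = Before \<and> label_at n p (Suc j) = At False \<longleftrightarrow> p = Suc j"
proof -
  show "label_at n p j = At True \<and> label_at n p (Suc j) = After \<longleftrightarrow> p = 2 * n - 1 - j"
  proof
    assume "label_at n p j = At True \<and> label_at n p (Suc j) = After"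
    thus "p = 2 * n - 1 - j" using label_at_At_iff[of j n p True] j p by (simp add: slot_def)
  next
    assume pj: "p = 2 * n - 1 - j"
    hence "n \<le> p" "p < 2 * n" "cell_of n p = j" using j by (auto simp: cell_of_def)
    thus "label_at n p j = At True \<and> label_at n p (Suc j) = After" by (simp add: label_at_def)
  qed
  show "label_at n p j = Before \<and> label_at n p (Suc j) = At False \<longleftrightarrow> p = Suc j"
  proof
    assume "label_at n p j = Before \<and> label_at n p (Suc j) = At False"
    thus "p = Suc j" using label_at_At_iff[of "Suc j" n p False] j p by (simp add: slot_def)
  next
    assume "p = Suc j"
    hence "\<not> n \<le> p" "p < 2 * n" "cell_of n p = Suc j" using j by (auto simp: cell_of_def)
    thus "label_at n p j = Before \<and> label_at n p (Suc j) = At False" by (simp add: label_at_def)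
  qed
qed

text \<open>The border between the two cells plays the part that a single cell plays in \<open>realizes_turn\<close>.\<close>

lemma realizes_cross:
  assumes M: "M \<noteq> {}" "M \<subseteq> {..m}"
    and D: "\<And>\<omega> k. \<lbrakk>\<omega> \<in> states m; Suc k < run_len \<omega>;
        (\<forall>i\<in>M. pos \<omega> i = 2 * run_len \<omega> - 1 - k) \<or> (\<forall>i\<in>M. pos \<omega> i = Suc k)\<rbrakk>
      \<Longrightarrow> D (encode_cell \<omega> k) (encode_cell \<omega> (Suc k)) = C \<omega>"
  shows "\<exists>F. realizes_on m F (move_if refl_edge M C)"
proof (rule exI, rule machine.realizes_edge_rule[where act = "crossing M D" and f = "cross_left M" and g = "cross_right M"])
  obtain i0 where i0: "i0 \<in> M" using M(1) by blast
  show "cross_left M a b \<in> cells m \<and> cross_right M a b \<in> cells m"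
    if "a \<in> cells m" "b \<in> cells m" "crossing M D a b" for a b
    using that M(2) by (auto simp: cells_def cross_left_def cross_right_def crossing_def)
  show "linked m z (cross_left M a b) = linked m z a" if "crossing M D a b" for a b z
  proof -
    have "labels (cross_left M a b) i \<noteq> After \<longleftrightarrow> labels a i \<noteq> After" for i
      using that i0 by (auto simp: crossing_def cross_left_def)
    moreover have "0 \<in> M \<Longrightarrow> labels a 0 \<noteq> After" using that by (auto simp: crossing_def)
    moreover have "0 \<notin> M \<Longrightarrow> clear_after (cross_left M a b) = clear_after a"
      "clear_before (cross_left M a b) = clear_before a" "blank (cross_left M a b) = blank a"
      by (auto simp: cross_left_def blank_def)
    ultimately show ?thesis unfolding linked_def by (cases "0 \<in> M") auto
  qed
  show "linked m (cross_right M a b) z = linked m b z" if "crossing M D a b" for a b z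
  proof -
    have "labels (cross_right M a b) i = Before \<longleftrightarrow> labels b i = Before" for i
      using that i0 by (auto simp: crossing_def cross_right_def)
    moreover have "0 \<in> M \<Longrightarrow> labels b 0 \<noteq> Before" using that by (auto simp: crossing_def)
    moreover have "0 \<notin> M \<Longrightarrow> clear_before (cross_right M a b) = clear_before b"
      "clear_after (cross_right M a b) = clear_after b" "blank (cross_right M a b) = blank b"
      by (auto simp: cross_right_def blank_def)
    ultimately show ?thesis unfolding linked_def by (cases "0 \<in> M") auto
  qed
  fix \<omega> assume \<omega>: "\<omega> \<in> states m"
  show "move_if refl_edge M C \<omega> \<in> states m"
    by (rule move_if_states[OF \<omega> M(2)]) (auto simp: refl_edge_def)
  show "length (encode (move_if refl_edge M C \<omega>)) = length (encode \<omega>)" by simp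
  fix k assume "k < length (encode \<omega>)"
  define n where "n = run_len \<omega>"
  define \<omega>' where "\<omega>' = move_if refl_edge M C \<omega>"
  have k: "k < n" using \<open>k < length (encode \<omega>)\<close> by (simp add: n_def)
  let ?e = "encode_cell \<omega>"
  \<comment> \<open>The rule acts on the border between \<open>j\<close> and \<open>j + 1\<close> exactly if the heads are in one of its two slots.\<close>
  have cr: "crossing M D (?e j) (?e (Suc j)) \<longleftrightarrow>
      C \<omega> \<and> ((\<forall>i\<in>M. pos \<omega> i = 2 * n - 1 - j) \<or> (\<forall>i\<in>M. pos \<omega> i = Suc j))" if j: "Suc j < n" for j
  proof -
    have l: "labels (?e j) i = label_at n (pos \<omega> i) j" for i j by (simp add: encode_cell_def n_def)
    have p: "pos \<omega> i \<le> 2 * n + 1" for i using pos_le[OF \<omega>] by (simp add: n_def)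
    note 1 = edge_labels(1)[OF j p] and 2 = edge_labels(2)[OF j p]
    have "D (?e j) (?e (Suc j)) = C \<omega>" if "(\<forall>i\<in>M. pos \<omega> i = 2 * n - 1 - j) \<or> (\<forall>i\<in>M. pos \<omega> i = Suc j)"
      using D[OF \<omega> j[unfolded n_def]] that unfolding n_def .
    thus ?thesis unfolding crossing_def l 1 2 by blast
  qed
  define BB where "BB j = (\<forall>i<j. blank_at \<omega> i)" for j
  define BA where "BA j = (\<forall>i. j < i \<and> i < n \<longrightarrow> blank_at \<omega> i)" for j
  have BB: "BB (Suc j) \<longleftrightarrow> BB j \<and> blank_at \<omega> j" for j by (auto simp: BB_def less_Suc_eq)
  have BA: "BA j \<longleftrightarrow> BA (Suc j) \<and> blank_at \<omega> (Suc j)" if "Suc j < n" for j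
    unfolding BA_def using that by (metis Suc_lessI less_Suc_eq not_less_eq)
  have e: "?e j = Cell (\<lambda>i. label_at n (pos \<omega> i) j) (j \<in> lit \<omega>) (2 * n - 1 - j \<in> lit \<omega>)
      (label_at n (pos \<omega> 0) j \<noteq> After \<and> free_before \<omega> \<and> BB j) (label_at n (pos \<omega> 0) j \<noteq> Before \<and> free_after \<omega> \<and> BA j)" for j
    by (simp add: encode_cell_def BB_def BA_def n_def)
  have e': "encode_cell \<omega>' k = Cell (\<lambda>i. if i \<in> M then label_at n (refl_edge n p) k else label_at n (pos \<omega> i) k)
      (k \<in> lit \<omega>) (2 * n - 1 - k \<in> lit \<omega>)
      ((if 0 \<in> M then label_at n (refl_edge n p) k else label_at n (pos \<omega> 0) k) \<noteq> After \<and> free_before \<omega> \<and> BB k)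
      ((if 0 \<in> M then label_at n (refl_edge n p) k else label_at n (pos \<omega> 0) k) \<noteq> Before \<and> free_after \<omega> \<and> BA k)"
    if "C \<omega>" "p < 2 * n" "\<forall>i\<in>M. pos \<omega> i = p" for p
  proof -
    have "gathered M \<omega>" using that by (auto simp: gathered_def n_def)
    hence \<omega>': "\<omega>' = with_pos \<omega> (\<lambda>i. if i \<in> M then refl_edge n (pos \<omega> i) else pos \<omega> i)"
      unfolding \<omega>'_def move_if_def n_def using that(1) by simp
    have l: "label_at n (pos \<omega>' i) k = (if i \<in> M then label_at n (refl_edge n p) k else label_at n (pos \<omega> i) k)" for i
      using that(3) by (simp add: \<omega>')
    have "run_len \<omega>' = n" "lit \<omega>' = lit \<omega>" "free_before \<omega>' = free_before \<omega>" "free_after \<omega>' = free_after \<omega>"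
      "blank_at \<omega>' = blank_at \<omega>" by (simp_all add: \<omega>' n_def)
    thus ?thesis by (simp only: encode_cell_def l BB_def BA_def)
  qed
  have bl: "blank (?e j) = blank_at \<omega> j" for j by (rule blank_encode_cell)
  let ?r = "if Suc k < n then Some (?e (Suc k)) else None"
  let ?l = "if k = 0 then None else Some (?e (k - 1))"
  let ?R = "machine.edge_rule (crossing M D) (cross_left M) (cross_right M)"
  have val: "?R ?l (?e k) ?r = (if Suc k < n \<and> crossing M D (?e k) (?e (Suc k)) then cross_left M (?e k) (?e (Suc k))
      else if 0 < k \<and> crossing M D (?e (k - 1)) (?e k) then cross_right M (?e (k - 1)) (?e k) else ?e k)"
    unfolding machine.edge_rule_def by (cases "k = 0"; cases "Suc k < n") simp_all
  have RA: "Suc k < n \<and> crossing M D (?e k) (?e (Suc k)) \<longleftrightarrow>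
      Suc k < n \<and> C \<omega> \<and> ((\<forall>i\<in>M. pos \<omega> i = 2 * n - 1 - k) \<or> (\<forall>i\<in>M. pos \<omega> i = Suc k))"
    using cr[of k] by blast
  have LA: "0 < k \<and> crossing M D (?e (k - 1)) (?e k) \<longleftrightarrow>
      0 < k \<and> C \<omega> \<and> ((\<forall>i\<in>M. pos \<omega> i = 2 * n - k) \<or> (\<forall>i\<in>M. pos \<omega> i = k))"
    using cr[of "k - 1"] k by (cases k) simp_all
  have "encode_cell \<omega>' k = ?R ?l (?e k) ?r"
  proof (cases "C \<omega> \<and> gathered M \<omega>")
    case False
    have g: "gathered M \<omega>" if "\<forall>i\<in>M. pos \<omega> i = p" "p < 2 * n" for p
      using that unfolding gathered_def n_def by blast
    have no: "\<not> (C \<omega> \<and> ((\<forall>i\<in>M. pos \<omega> i = p) \<or> (\<forall>i\<in>M. pos \<omega> i = q)))" if "p < 2 * n" "q < 2 * n" for p q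
      using g[of p] g[of q] that False by blast
    have "\<not> (Suc k < n \<and> crossing M D (?e k) (?e (Suc k)))"
    proof
      assume "Suc k < n \<and> crossing M D (?e k) (?e (Suc k))"
      thus False unfolding RA using no[of "2 * n - 1 - k" "Suc k"] by simp
    qed
    moreover have "\<not> (0 < k \<and> crossing M D (?e (k - 1)) (?e k))"
    proof
      assume "0 < k \<and> crossing M D (?e (k - 1)) (?e k)"
      thus False unfolding LA using no[of "2 * n - k" k] k by simp
    qed
    ultimately have "\<not> (Suc k < n \<and> crossing M D (?e k) (?e (Suc k)))" "\<not> (0 < k \<and> crossing M D (?e (k - 1)) (?e k))"
      by blast+
    hence "?R ?l (?e k) ?r = ?e k" unfolding val by (simp only: if_False)
    moreover have "\<omega>' = \<omega>" unfolding \<omega>'_def move_if_def using False by (simp only: if_False)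
    ultimately show ?thesis by simp
  next
    case True
    then obtain p where p: "p < 2 * n" "\<And>i. i \<in> M \<Longrightarrow> pos \<omega> i = p" by (auto simp: gathered_def n_def)
    have C: "C \<omega>" using True by blast
    have all: "(\<forall>i\<in>M. pos \<omega> i = q) \<longleftrightarrow> p = q" for q using p(2) i0 by auto
    have "\<forall>i\<in>M. pos \<omega> i = p" using p(2) by blast
    note e'p = e'[OF C p(1) this]
    note lp = label_at_refl_edge[OF k p(1)]
    have lM: "(\<forall>i\<in>M. labels (?e j) i = s) \<longleftrightarrow> label_at n p j = s" for j s
      using p(2) i0 by (auto simp: e)
    have p0: "0 \<in> M \<Longrightarrow> pos \<omega> 0 = p" using p(2) by blast
    show ?thesis
    proof (cases "Suc k < n \<and> (p = 2 * n - 1 - k \<or> p = Suc k)")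
      case act: True
      hence R: "?R ?l (?e k) ?r = cross_left M (?e k) (?e (Suc k))" unfolding val RA using C all by simp
      show ?thesis
      proof (cases "p = 2 * n - 1 - k")
        case fwd: True
        have "label_at n p k = At True" using fwd act by (auto simp: label_at_def cell_of_def)
        moreover have "label_at n (refl_edge n p) k = Before" using lp fwd act by simp
        ultimately show ?thesis
          unfolding R cross_left_def lM e'p using p0 by (intro cell.expand) (auto simp: e)
      next
        case bwd: False
        hence "p = Suc k" using act by blast
        hence "label_at n p k = Before" "label_at n p (Suc k) = At False" using act by (auto simp: label_at_def cell_of_def)
        moreover have "label_at n (refl_edge n p) k = At True" using lp bwd act by simp
        ultimately show ?thesis
          unfolding R cross_left_def lM e'p bl using p0 BA[of k] act by (intro cell.expand) (auto simp: e)
      qed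
    next
      case nR: False
      show ?thesis
      proof (cases "0 < k \<and> (p = 2 * n - k \<or> p = k)")
        case act: True
        hence R: "?R ?l (?e k) ?r = cross_right M (?e (k - 1)) (?e k)"
        proof -
          have "\<not> (Suc k < n \<and> crossing M D (?e k) (?e (Suc k)))" unfolding RA all using nR by blast
          moreover have "0 < k \<and> crossing M D (?e (k - 1)) (?e k)" unfolding LA all using act C by blast
          ultimately show ?thesis unfolding val by (simp only: simp_thms if_True if_False)
        qed
        obtain k' where k': "k = Suc k'" using act by (cases k) auto
        show ?thesis
        proof (cases "p = k")
          case bwd: True
          have "label_at n p (k - 1) = Before" "label_at n p k = At False"
            using bwd act k by (auto simp: label_at_def cell_of_def)
          moreover have "label_at n (refl_edge n p) k = After" using lp bwd act nR k by auto
          ultimately show ?thesis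
            unfolding R cross_right_def lM e'p using p0 by (intro cell.expand) (auto simp: e)
        next
          case fwd: False
          hence "p = 2 * n - k" using act by blast
          hence "label_at n p (k - 1) = At True" "label_at n p k = After"
            using act k by (auto simp: label_at_def cell_of_def)
          moreover have "label_at n (refl_edge n p) k = At False" using lp fwd act nR k by auto
          ultimately show ?thesis
            unfolding R cross_right_def lM e'p bl using p0 BB[of k'] k' by (intro cell.expand) (auto simp: e)
        qed
      next
        case nL: False
        have R: "?R ?l (?e k) ?r = ?e k"
        proof -
          have "\<not> (Suc k < n \<and> crossing M D (?e k) (?e (Suc k)))" unfolding RA all using nR by blast
          moreover have "\<not> (0 < k \<and> crossing M D (?e (k - 1)) (?e k))" unfolding LA all using nL by blast
          ultimately show ?thesis unfolding val by (simp only: simp_thms if_False)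
        qed
        have "label_at n (refl_edge n p) k = label_at n p k" using lp nR nL by auto
        thus ?thesis unfolding R e'p using p by (intro cell.expand) (auto simp: e fun_eq_iff)
      qed
    qed
  qed
  moreover have "encode \<omega>' ! k = encode_cell \<omega>' k" using k by (simp add: \<omega>'_def n_def)
  moreover have "(if k = 0 then None else Some (encode \<omega> ! (k - 1))) = ?l" using k by (cases k) (simp_all add: n_def)
  moreover have "encode \<omega> ! k = ?e k" using k by (simp add: n_def)
  moreover have "(if Suc k < length (encode \<omega>) then Some (encode \<omega> ! Suc k) else None) = ?r" by (simp add: n_def)
  ultimately show "encode (move_if refl_edge M C \<omega>) ! k = machine.edge_rule (crossing M D) (cross_left M) (cross_right M)
     (if k = 0 then None else Some (encode \<omega> ! (k - 1))) (encode \<omega> ! k)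
     (if Suc k < length (encode \<omega>) then Some (encode \<omega> ! Suc k) else None)"
    by (simp only: \<omega>'_def)
qed

definition toggle :: "state \<Rightarrow> state" where
  "toggle \<omega> = (if pos \<omega> 0 < 2 * run_len \<omega>
     then State (run_len \<omega>) (pos \<omega>) (lit \<omega> - {pos \<omega> 0} \<union> ({pos \<omega> 0} - lit \<omega>)) (free_before \<omega>) (free_after \<omega>) else \<omega>)"

definition toggle_rule :: "cell \<Rightarrow> cell" where
  "toggle_rule a = Cell (labels a) (lamp_up a = (labels a 0 \<noteq> At False)) (lamp_dn a = (labels a 0 \<noteq> At True))
     (clear_before a) (clear_after a)"

lemma run_len_toggle [simp]: "run_len (toggle \<omega>) = run_len \<omega>"
  by (simp add: toggle_def)

text \<open>The lamps of the cell of head \<open>0\<close> do not enter any meaningful flag: \<open>clear_before\<close> is meaningful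
  only in cells up to this one, and \<open>clear_after\<close> only from it on.  So flags need no update.\<close>

lemma realizes_toggle: "\<exists>F. realizes_on m F toggle"
proof (rule exI, rule machine.realizes_cell_rule)
  show "toggle_rule a \<in> cells m" if "a \<in> cells m" for a
    using that by (simp add: cells_def toggle_rule_def)
  have bl: "blank (toggle_rule a) = blank a" if "labels a 0 = Before \<or> labels a 0 = After" for a
    using that by (auto simp: blank_def toggle_rule_def)
  show "linked m (toggle_rule a) (toggle_rule b) = linked m a b" for a b
  proof (cases "\<forall>i\<le>m. labels a i = Before \<longleftrightarrow> labels b i \<noteq> After")
    case True
    thus ?thesis
      using bl[of a] bl[of b] by (auto simp: linked_def toggle_rule_def)
  next
    case False
    thus ?thesis by (simp add: linked_def toggle_rule_def) blast
  qed
  fix \<omega> assume \<omega>: "\<omega> \<in> states m"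
  show "toggle \<omega> \<in> states m" using \<omega> by (auto simp: states_def toggle_def)
  define n where "n = run_len \<omega>"
  have "encode_cell (toggle \<omega>) k = toggle_rule (encode_cell \<omega> k)" if k: "k < n" for k
  proof (cases "pos \<omega> 0 < 2 * n")
    case True
    have lab: "labels (encode_cell \<omega> k) 0 = At s \<longleftrightarrow> pos \<omega> 0 = slot n k s" for s
      using label_at_At_iff[OF k] pos_le[OF \<omega>] by (simp add: encode_cell_def n_def)
    have t: "run_len (toggle \<omega>) = n" "pos (toggle \<omega>) = pos \<omega>" "free_before (toggle \<omega>) = free_before \<omega>"
      "free_after (toggle \<omega>) = free_after \<omega>" "p \<in> lit (toggle \<omega>) \<longleftrightarrow> (p \<in> lit \<omega>) = (p \<noteq> pos \<omega> 0)" for p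
      using True by (auto simp: toggle_def n_def)
    have bl: "blank_at (toggle \<omega>) j = blank_at \<omega> j" if "j \<noteq> cell_of n (pos \<omega> 0)" "j < n" for j
    proof -
      have "pos \<omega> 0 \<noteq> j" "pos \<omega> 0 \<noteq> 2 * n - 1 - j" using that True by (auto simp: cell_of_def split: if_splits)
      thus ?thesis unfolding blank_at_def t using n_def by auto
    qed
    have "(\<forall>j<k. blank_at (toggle \<omega>) j) = (\<forall>j<k. blank_at \<omega> j)" if "label_at n (pos \<omega> 0) k \<noteq> After"
    proof -
      have "k \<le> cell_of n (pos \<omega> 0)" using that True by (auto simp: label_at_def split: if_splits)
      thus ?thesis using bl k by auto
    qed
    moreover have "(\<forall>j. k < j \<and> j < n \<longrightarrow> blank_at (toggle \<omega>) j) = (\<forall>j. k < j \<and> j < n \<longrightarrow> blank_at \<omega> j)"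
      if "label_at n (pos \<omega> 0) k \<noteq> Before"
    proof -
      have "cell_of n (pos \<omega> 0) \<le> k" using that True by (auto simp: label_at_def split: if_splits)
      thus ?thesis using bl by auto
    qed
    moreover have "(k \<in> lit (toggle \<omega>)) = ((k \<in> lit \<omega>) = (labels (encode_cell \<omega> k) 0 \<noteq> At False))"
      "(2 * n - 1 - k \<in> lit (toggle \<omega>)) = ((2 * n - 1 - k \<in> lit \<omega>) = (labels (encode_cell \<omega> k) 0 \<noteq> At True))"
      unfolding t lab slot_def by auto
    ultimately show ?thesis
      unfolding toggle_rule_def encode_cell_def[of "toggle \<omega>"] t
      unfolding encode_cell_def cell.sel n_def[symmetric] by (intro cell.expand) auto
  next
    case False
    hence "labels (encode_cell \<omega> k) 0 \<noteq> At s" for s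
      using label_at_At_iff[OF k, of "pos \<omega> 0" s] pos_le[OF \<omega>, of 0] k by (auto simp: encode_cell_def n_def slot_def)
    hence "toggle_rule (encode_cell \<omega> k) = encode_cell \<omega> k" by (simp add: toggle_rule_def)
    thus ?thesis using False by (simp add: toggle_def n_def)
  qed
  thus "encode (toggle \<omega>) = map toggle_rule (encode \<omega>)"
    by (simp add: encode_def n_def) 
qed

section \<open>A criterion for embedding wreath products in groups of run permutations\<close>

context run_system
begin

lemma run_perm_closed: "\<pi> \<in> run_perms \<Longrightarrow> \<omega> \<in> \<Omega> \<Longrightarrow> \<pi> \<omega> \<in> \<Omega>"
  unfolding run_perms_def Bij_def bij_betw_def by blast

lemma run_mult_apply: "\<pi> \<in> run_perms \<Longrightarrow> \<sigma> \<in> run_perms \<Longrightarrow> \<omega> \<in> \<Omega> \<Longrightarrow> (\<pi> \<otimes>\<^bsub>run_group\<^esub> \<sigma>) \<omega> = \<pi> (\<sigma> \<omega>)"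
  by (simp add: mult_run_group compose_eq)

lemma run_one_apply: "\<omega> \<in> \<Omega> \<Longrightarrow> \<one>\<^bsub>run_group\<^esub> \<omega> = \<omega>"
  by (simp add: run_group_def BijGroup_def)

lemma run_inv:
  assumes "\<pi> \<in> run_perms"
  shows "inv\<^bsub>run_group\<^esub> \<pi> \<in> run_perms"
    "\<omega> \<in> \<Omega> \<Longrightarrow> \<pi> ((inv\<^bsub>run_group\<^esub> \<pi>) \<omega>) = \<omega>" "\<omega> \<in> \<Omega> \<Longrightarrow> (inv\<^bsub>run_group\<^esub> \<pi>) (\<pi> \<omega>) = \<omega>"
proof -
  interpret G: group run_group by (rule group_run_group)
  have \<pi>: "\<pi> \<in> carrier run_group" using assms by (simp add: carrier_run_group)
  show i: "inv\<^bsub>run_group\<^esub> \<pi> \<in> run_perms" using G.inv_closed[OF \<pi>] by (simp add: carrier_run_group)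
  show "\<pi> ((inv\<^bsub>run_group\<^esub> \<pi>) \<omega>) = \<omega>" if "\<omega> \<in> \<Omega>"
    using run_mult_apply[OF assms i that] G.r_inv[OF \<pi>] run_one_apply[OF that] by simp
  show "(inv\<^bsub>run_group\<^esub> \<pi>) (\<pi> \<omega>) = \<omega>" if "\<omega> \<in> \<Omega>"
    using run_mult_apply[OF i assms that] G.l_inv[OF \<pi>] run_one_apply[OF that] by simp
qed

lemma run_eqI:
  assumes "\<pi> \<in> run_perms" "\<sigma> \<in> run_perms" "\<And>\<omega>. \<omega> \<in> \<Omega> \<Longrightarrow> \<pi> \<omega> = \<sigma> \<omega>"
  shows "\<pi> = \<sigma>"
proof (rule extensionalityI[of _ \<Omega>])
  show "\<pi> \<in> extensional \<Omega>" "\<sigma> \<in> extensional \<Omega>" using assms(1,2) by (auto simp: run_perms_def Bij_def)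
qed (rule assms(3))

text \<open>The conjugate of \<open>\<kappa> b\<close> by \<open>\<rho> x\<close> applies the same map \<open>\<tau> b\<close>, but under the condition \<open>C\<close> moved by \<open>x\<close>.  Since the
  conditions are invariant under all \<open>\<tau> a\<close>, these maps commute.  For injectivity take as \<open>Q\<close> the stabilizer
  of a state in which \<open>C\<close> holds while all the moved conditions fail.\<close>

theorem wreath_on_runs:
  fixes K :: "('k, 'm) monoid_scheme" and H :: "('h, 'n) monoid_scheme"
  assumes K: "group K" and H: "group H" and \<rho>: "\<rho> \<in> hom H run_group" and \<kappa>: "\<kappa> \<in> hom K run_group"
    and \<kappa>_eq: "\<And>a \<omega>. a \<in> carrier K \<Longrightarrow> \<omega> \<in> \<Omega> \<Longrightarrow> \<kappa> a \<omega> = (if C \<omega> then \<tau> a \<omega> else \<omega>)"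
    and \<tau>: "\<And>a \<omega>. a \<in> carrier K \<Longrightarrow> \<omega> \<in> \<Omega> \<Longrightarrow> \<tau> a \<omega> \<in> \<Omega>"
    and \<tau>_comm: "\<And>a b \<omega>. \<lbrakk>a \<in> carrier K; b \<in> carrier K; \<omega> \<in> \<Omega>\<rbrakk> \<Longrightarrow> \<tau> a (\<tau> b \<omega>) = \<tau> b (\<tau> a \<omega>)"
    and C: "\<And>a \<omega>. a \<in> carrier K \<Longrightarrow> \<omega> \<in> \<Omega> \<Longrightarrow> C (\<tau> a \<omega>) = C \<omega>"
    and \<rho>\<tau>: "\<And>h a \<omega>. \<lbrakk>h \<in> carrier H; a \<in> carrier K; \<omega> \<in> \<Omega>\<rbrakk> \<Longrightarrow> \<rho> h (\<tau> a \<omega>) = \<tau> a (\<rho> h \<omega>)"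
    and nontriv: "carrier K \<noteq> {\<one>\<^bsub>K\<^esub>}"
    and sep: "\<And>F a. \<lbrakk>finite F; F \<subseteq> carrier H; a \<in> carrier K; a \<noteq> \<one>\<^bsub>K\<^esub>\<rbrakk> \<Longrightarrow>
      \<exists>\<omega>\<in>\<Omega>. C \<omega> \<and> \<tau> a \<omega> \<noteq> \<omega> \<and> (\<forall>h\<in>F - {\<one>\<^bsub>H\<^esub>}. \<not> C (\<rho> h \<omega>))"
  shows "\<exists>\<Phi>. \<Phi> \<in> mon (K \<wreath> H) run_group"
proof -
  interpret K: group K by fact
  interpret H: group H by fact
  interpret G: group run_group by (rule group_run_group)
  interpret \<rho>: group_hom H run_group \<rho> by unfold_locales (rule \<rho>)
  interpret \<kappa>: group_hom K run_group \<kappa> by unfold_locales (rule \<kappa>)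
  have \<rho>_mem: "\<rho> h \<in> run_perms" if "h \<in> carrier H" for h using \<rho>.hom_closed[OF that] by (simp add: carrier_run_group)
  have \<kappa>_mem: "\<kappa> a \<in> run_perms" if "a \<in> carrier K" for a using \<kappa>.hom_closed[OF that] by (simp add: carrier_run_group)
  define \<beta> where "\<beta> x b = \<rho> x \<otimes>\<^bsub>run_group\<^esub> \<kappa> b \<otimes>\<^bsub>run_group\<^esub> inv\<^bsub>run_group\<^esub> \<rho> x" for x b
  have \<beta>_mem: "\<beta> x b \<in> run_perms" if "x \<in> carrier H" "b \<in> carrier K" for x b
    using that by (simp add: \<beta>_def flip: carrier_run_group)
  \<comment> \<open>Conjugating \<open>\<kappa> b\<close> only moves the set on which \<open>\<tau> b\<close> is applied.\<close>
  have \<beta>: "\<beta> x b \<omega> = (if C (\<rho> (inv\<^bsub>H\<^esub> x) \<omega>) then \<tau> b \<omega> else \<omega>)"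
    if x: "x \<in> carrier H" and b: "b \<in> carrier K" and \<omega>: "\<omega> \<in> \<Omega>" for x b \<omega>
  proof -
    have ix: "inv\<^bsub>H\<^esub> x \<in> carrier H" using x by simp
    have inv: "inv\<^bsub>run_group\<^esub> \<rho> x = \<rho> (inv\<^bsub>H\<^esub> x)" using x by simp
    define \<omega>' where "\<omega>' = \<rho> (inv\<^bsub>H\<^esub> x) \<omega>"
    have \<omega>': "\<omega>' \<in> \<Omega>" unfolding \<omega>'_def by (rule run_perm_closed[OF \<rho>_mem[OF ix] \<omega>])
    have ret: "\<rho> x \<omega>' = \<omega>" unfolding \<omega>'_def inv[symmetric] by (rule run_inv(2)[OF \<rho>_mem[OF x] \<omega>])
    have xk: "\<rho> x \<otimes>\<^bsub>run_group\<^esub> \<kappa> b \<in> run_perms"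
      using x b by (simp flip: carrier_run_group)
    have "\<beta> x b \<omega> = \<rho> x (\<kappa> b \<omega>')"
      unfolding \<beta>_def inv \<omega>'_def run_mult_apply[OF xk \<rho>_mem[OF ix] \<omega>]
      by (rule run_mult_apply[OF \<rho>_mem[OF x] \<kappa>_mem[OF b] \<omega>'[unfolded \<omega>'_def]])
    also have "\<dots> = (if C \<omega>' then \<tau> b \<omega> else \<omega>)"
      using \<kappa>_eq[OF b \<omega>'] \<rho>\<tau>[OF x b \<omega>'] ret by simp
    finally show ?thesis by (simp only: \<omega>'_def)
  qed
  have comm: "\<kappa> a \<otimes>\<^bsub>run_group\<^esub> \<beta> x b = \<beta> x b \<otimes>\<^bsub>run_group\<^esub> \<kappa> a"
    if x: "x \<in> carrier H" and a: "a \<in> carrier K" and b: "b \<in> carrier K" for x a b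
  proof (rule run_eqI)
    show "\<kappa> a \<otimes>\<^bsub>run_group\<^esub> \<beta> x b \<in> run_perms" "\<beta> x b \<otimes>\<^bsub>run_group\<^esub> \<kappa> a \<in> run_perms"
      using \<kappa>_mem[OF a] \<beta>_mem[OF x b] by (simp_all flip: carrier_run_group)
    fix \<omega> assume \<omega>: "\<omega> \<in> \<Omega>"
    have ix: "inv\<^bsub>H\<^esub> x \<in> carrier H" using x by simp
    define D where "D \<omega> = C (\<rho> (inv\<^bsub>H\<^esub> x) \<omega>)" for \<omega>
    have D: "D (\<tau> a \<omega>) = D \<omega>"
      unfolding D_def \<rho>\<tau>[OF ix a \<omega>] by (rule C[OF a run_perm_closed[OF \<rho>_mem[OF ix] \<omega>]])
    have "\<beta> x b \<omega> \<in> \<Omega>" "\<kappa> a \<omega> \<in> \<Omega>" using run_perm_closed \<beta>_mem[OF x b] \<kappa>_mem[OF a] \<omega> by blast+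
    have "(\<kappa> a \<otimes>\<^bsub>run_group\<^esub> \<beta> x b) \<omega> = \<kappa> a (\<beta> x b \<omega>)"
      by (rule run_mult_apply[OF \<kappa>_mem[OF a] \<beta>_mem[OF x b] \<omega>])
    also have "\<dots> = \<beta> x b (\<kappa> a \<omega>)"
      unfolding \<kappa>_eq[OF a \<open>\<beta> x b \<omega> \<in> \<Omega>\<close>] \<beta>[OF x b \<open>\<kappa> a \<omega> \<in> \<Omega>\<close>] unfolding \<kappa>_eq[OF a \<omega>] \<beta>[OF x b \<omega>]
      using D C[OF b \<omega>] \<tau>_comm[OF a b \<omega>] by (simp flip: D_def)
    also have "\<dots> = (\<beta> x b \<otimes>\<^bsub>run_group\<^esub> \<kappa> a) \<omega>"
      by (rule run_mult_apply[OF \<beta>_mem[OF x b] \<kappa>_mem[OF a] \<omega>, symmetric])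
    finally show "(\<kappa> a \<otimes>\<^bsub>run_group\<^esub> \<beta> x b) \<omega> = (\<beta> x b \<otimes>\<^bsub>run_group\<^esub> \<kappa> a) \<omega>" .
  qed
  show ?thesis
  proof (rule wreath_hom_exists[OF G.is_group K H \<rho> \<kappa>])
    show "\<kappa> a \<otimes>\<^bsub>run_group\<^esub> (\<rho> x \<otimes>\<^bsub>run_group\<^esub> \<kappa> b \<otimes>\<^bsub>run_group\<^esub> inv\<^bsub>run_group\<^esub> \<rho> x)
      = \<rho> x \<otimes>\<^bsub>run_group\<^esub> \<kappa> b \<otimes>\<^bsub>run_group\<^esub> inv\<^bsub>run_group\<^esub> \<rho> x \<otimes>\<^bsub>run_group\<^esub> \<kappa> a"
      if "x \<in> carrier H" "a \<in> carrier K" "b \<in> carrier K" for x a b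
      using comm[OF that] unfolding \<beta>_def .
  next
  fix \<Phi> assume \<Phi>: "\<Phi> \<in> hom (K \<wreath> H) run_group"
    "\<And>h. h \<in> carrier H \<Longrightarrow> \<Phi> (\<one>\<^bsub>base_group K H\<^esub>, h) = \<rho> h"
    "\<And>x a. \<lbrakk>x \<in> carrier H; a \<in> carrier K\<rbrakk> \<Longrightarrow>
       \<Phi> (point_mass H K x a, \<one>\<^bsub>H\<^esub>) = \<rho> x \<otimes>\<^bsub>run_group\<^esub> \<kappa> a \<otimes>\<^bsub>run_group\<^esub> inv\<^bsub>run_group\<^esub> \<rho> x"
  have "\<Phi> \<in> mon (K \<wreath> H) run_group"
  proof (rule wreath_hom_inj[OF G.is_group K H \<rho> \<kappa> \<Phi>(1)])
    show "\<Phi> (\<one>\<^bsub>base_group K H\<^esub>, h) = \<rho> h" if "h \<in> carrier H" for h by (rule \<Phi>(2)[OF that])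
    show "\<Phi> (point_mass H K x a, \<one>\<^bsub>H\<^esub>) = \<rho> x \<otimes>\<^bsub>run_group\<^esub> \<kappa> a \<otimes>\<^bsub>run_group\<^esub> inv\<^bsub>run_group\<^esub> \<rho> x"
      if "x \<in> carrier H" "a \<in> carrier K" for x a by (rule \<Phi>(3)[OF that])
    show "carrier K \<noteq> {\<one>\<^bsub>K\<^esub>}" by (rule nontriv)
    fix F a assume F: "finite F" "F \<subseteq> carrier H" and a: "a \<in> carrier K" "a \<noteq> \<one>\<^bsub>K\<^esub>"
    have "finite ((\<lambda>x. inv\<^bsub>H\<^esub> x) ` F)" "(\<lambda>x. inv\<^bsub>H\<^esub> x) ` F \<subseteq> carrier H" using F by auto
    from sep[OF this a] obtain \<omega> where \<omega>: "\<omega> \<in> \<Omega>" "C \<omega>" "\<tau> a \<omega> \<noteq> \<omega>"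
      "\<forall>h \<in> (\<lambda>x. inv\<^bsub>H\<^esub> x) ` F - {\<one>\<^bsub>H\<^esub>}. \<not> C (\<rho> h \<omega>)" by blast
    define Q where "Q = {\<pi> \<in> run_perms. \<pi> \<omega> = \<omega>}"
    have "subgroup Q run_group"
    proof (rule G.subgroupI)
      show "Q \<subseteq> carrier run_group" by (auto simp: Q_def carrier_run_group)
      have "\<one>\<^bsub>run_group\<^esub> \<in> Q" using G.one_closed run_one_apply[OF \<omega>(1)] by (simp add: Q_def carrier_run_group)
      thus "Q \<noteq> {}" by blast
    next
      fix \<pi> assume "\<pi> \<in> Q"
      thus "inv\<^bsub>run_group\<^esub> \<pi> \<in> Q" using run_inv(1)[of \<pi>] run_inv(3)[of \<pi> \<omega>] \<omega>(1) by (simp add: Q_def)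
    next
      fix \<pi> \<sigma> assume "\<pi> \<in> Q" "\<sigma> \<in> Q"
      thus "\<pi> \<otimes>\<^bsub>run_group\<^esub> \<sigma> \<in> Q"
        using run_mult_apply[of \<pi> \<sigma> \<omega>] \<omega>(1) G.m_closed[of \<pi> \<sigma>] by (simp add: Q_def carrier_run_group)
    qed
    moreover have "\<kappa> a \<notin> Q" using \<kappa>_eq[OF a(1) \<omega>(1)] \<omega> by (simp add: Q_def)
    moreover have "\<beta> x b \<in> Q" if "x \<in> F - {\<one>\<^bsub>H\<^esub>}" "b \<in> carrier K" for x b
    proof -
      have x: "x \<in> carrier H" "x \<noteq> \<one>\<^bsub>H\<^esub>" using that F by auto
      hence "inv\<^bsub>H\<^esub> x \<noteq> \<one>\<^bsub>H\<^esub>" by simp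
      hence "\<not> C (\<rho> (inv\<^bsub>H\<^esub> x) \<omega>)" using \<omega>(4) that by blast
      thus ?thesis using \<beta>[OF x(1) that(2) \<omega>(1)] \<beta>_mem[OF x(1) that(2)] by (simp add: Q_def)
    qed
    ultimately show "\<exists>Q. subgroup Q run_group \<and> \<kappa> a \<notin> Q \<and> (\<forall>x\<in>F - {\<one>\<^bsub>H\<^esub>}. \<forall>b\<in>carrier K.
        \<rho> x \<otimes>\<^bsub>run_group\<^esub> \<kappa> b \<otimes>\<^bsub>run_group\<^esub> inv\<^bsub>run_group\<^esub> \<rho> x \<in> Q)"
      unfolding \<beta>_def by blast
  qed
  thus "\<exists>\<Phi>. \<Phi> \<in> mon (K \<wreath> H) run_group" by blast
  qed
qed

end

lemma hom_integer_group_in_subgroup: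
  assumes G: "group G" and \<phi>: "\<phi> \<in> hom integer_group G" and Q: "subgroup Q G" and one: "\<phi> 1 \<in> Q"
  shows "\<phi> a \<in> Q"
proof -
  interpret G: group G by fact
  interpret Q: subgroup Q G by fact
  have add: "\<phi> (x + y) = \<phi> x \<otimes>\<^bsub>G\<^esub> \<phi> y" for x y using hom_mult[OF \<phi>, of x y] by (simp add: integer_group_def)
  have car: "\<phi> x \<in> carrier G" for x using hom_in_carrier[OF \<phi>, of x] by (simp add: integer_group_def)
  have zero: "\<phi> 0 = \<one>\<^bsub>G\<^esub>" using add[of 0 0] car[of 0] G.r_cancel_one'[of "\<phi> 0" "\<phi> 0"] by simp
  have "\<phi> (- 1) \<otimes>\<^bsub>G\<^esub> \<phi> 1 = \<one>\<^bsub>G\<^esub>" using add[of "- 1" 1] zero by simp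
  hence m: "\<phi> (- 1) \<in> Q" using G.inv_equality[OF _ car car] Q.m_inv_closed[OF one] by metis
  show ?thesis
  proof (induction a rule: int_induct[where k = 0])
    case base
    show ?case by (simp add: zero)
  next
    case (step1 i)
    thus ?case using add[of i 1] one by simp
  next
    case (step2 i)
    thus ?case using add[of i "- 1"] m by simp
  qed
qed

lemma hom_Z2:
  assumes G: "group G" and t: "t \<in> carrier G" "t \<otimes>\<^bsub>G\<^esub> t = \<one>\<^bsub>G\<^esub>"
  shows "(\<lambda>a. if a = 0 then \<one>\<^bsub>G\<^esub> else t) \<in> hom (integer_mod_group 2) G"
proof -
  interpret G: group G by fact
  have car: "a \<in> carrier (integer_mod_group 2) \<longleftrightarrow> a = 0 \<or> a = 1" for a
    by (auto simp: carrier_integer_mod_group)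
  show ?thesis
    by (rule homI) (use t in \<open>auto simp: car mult_integer_mod_group\<close>)
qed

text \<open>A wreath product is generated by its top group and its single lamps.\<close>

lemma wreath_hom_in_subgroup:
  assumes K: "group K" and H: "group H" and P: "group P" and \<Phi>: "\<Phi> \<in> hom (K \<wreath> H) P" and Q: "subgroup Q P"
    and h: "\<And>h. h \<in> carrier H \<Longrightarrow> \<Phi> (\<one>\<^bsub>base_group K H\<^esub>, h) \<in> Q"
    and pt: "\<And>x a. \<lbrakk>x \<in> carrier H; a \<in> carrier K\<rbrakk> \<Longrightarrow> \<Phi> (point_mass H K x a, \<one>\<^bsub>H\<^esub>) \<in> Q"
    and w: "w \<in> carrier (K \<wreath> H)"
  shows "\<Phi> w \<in> Q"
proof -
  interpret H: group H by fact
  interpret N: group "base_group K H" using K by simp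
  interpret Q: subgroup Q P by fact
  obtain u g where ug: "w = (u, g)" "u \<in> carrier (base_group K H)" "g \<in> carrier H"
    using w by (auto simp: carrier_wreath)
  have "\<Phi> (u, \<one>\<^bsub>H\<^esub>) \<in> Q"
    using K ug(2) H P \<Phi> by (rule wreath_base_induct) (simp_all add: pt)
  moreover have "\<Phi> w = \<Phi> (u, \<one>\<^bsub>H\<^esub>) \<otimes>\<^bsub>P\<^esub> \<Phi> (\<one>\<^bsub>base_group K H\<^esub>, g)"
  proof -
    have "(u, \<one>\<^bsub>H\<^esub>) \<in> carrier (K \<wreath> H)" "(\<one>\<^bsub>base_group K H\<^esub>, g) \<in> carrier (K \<wreath> H)"
      using ug N.one_closed by (simp_all add: carrier_wreath del: one_sum_group)
    from hom_mult[OF \<Phi> this] show ?thesis unfolding ug(1) by (simp only: wreath_split[OF K H ug(2,3), symmetric])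
  qed
  ultimately show ?thesis using h[OF ug(3)] Q.m_closed by simp
qed

section \<open>Rotations of the circle\<close>

definition perm :: "nat \<Rightarrow> (state \<Rightarrow> state) \<Rightarrow> state \<Rightarrow> state" where
  "perm m \<pi> = restrict \<pi> (states m)"

lemma perm_apply [simp]: "\<omega> \<in> states m \<Longrightarrow> perm m \<pi> \<omega> = \<pi> \<omega>"
  by (simp add: perm_def)

lemma perm_cong: "(\<And>\<omega>. \<omega> \<in> states m \<Longrightarrow> \<pi> \<omega> = \<sigma> \<omega>) \<Longrightarrow> perm m \<pi> = perm m \<sigma>"
  unfolding perm_def by (rule restrict_ext)

lemma perm_of_involution:
  assumes "\<exists>F. realizes_on m F \<pi>" "\<And>\<omega>. \<omega> \<in> states m \<Longrightarrow> \<pi> (\<pi> \<omega>) = \<omega>"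
  shows "perm m \<pi> \<in> machine_perms m"
  unfolding perm_def
  by (rule machine.involution_run_perms) (use assms in \<open>simp_all add: machine.realizable_def\<close>)

lemma perm_mult:
  assumes "perm m \<pi> \<in> machine_perms m" "perm m \<sigma> \<in> machine_perms m"
  shows "perm m \<pi> \<otimes>\<^bsub>machine_group m\<^esub> perm m \<sigma> = perm m (\<lambda>\<omega>. \<pi> (\<sigma> \<omega>))"
proof -
  have "\<sigma> \<omega> \<in> states m" if "\<omega> \<in> states m" for \<omega>
    using machine.run_perm_closed[OF assms(2) that] that by simp
  thus ?thesis
    unfolding machine.mult_run_group[OF assms] by (auto simp: compose_def perm_def fun_eq_iff)
qed

lemma perm_comp:
  assumes "perm m \<pi> \<in> machine_perms m" "perm m \<sigma> \<in> machine_perms m"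
  shows "perm m (\<lambda>\<omega>. \<pi> (\<sigma> \<omega>)) \<in> machine_perms m"
proof -
  interpret G: group "machine_group m" by (rule machine.group_run_group)
  show ?thesis
    using G.m_closed[of "perm m \<pi>" "perm m \<sigma>"] assms perm_mult[OF assms]
    by (simp add: machine.carrier_run_group)
qed

lemma perm_id: "perm m (\<lambda>\<omega>. \<omega>) \<in> machine_perms m" "\<one>\<^bsub>machine_group m\<^esub> = perm m (\<lambda>\<omega>. \<omega>)"
proof -
  interpret G: group "machine_group m" by (rule machine.group_run_group)
  show "\<one>\<^bsub>machine_group m\<^esub> = perm m (\<lambda>\<omega>. \<omega>)"
    by (simp add: machine.run_group_def BijGroup_def perm_def)
  thus "perm m (\<lambda>\<omega>. \<omega>) \<in> machine_perms m"
    using G.one_closed by (simp add: machine.carrier_run_group)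
qed

text \<open>Only the generator has to be realized by a local rule; its powers then lie in the subgroup.\<close>

lemma integer_action_perms:
  fixes \<pi> :: "int \<Rightarrow> state \<Rightarrow> state"
  assumes closed: "\<And>a \<omega>. \<omega> \<in> states m \<Longrightarrow> \<pi> a \<omega> \<in> states m"
    and add: "\<And>a b \<omega>. \<omega> \<in> states m \<Longrightarrow> \<pi> a (\<pi> b \<omega>) = \<pi> (a + b) \<omega>"
    and zero: "\<And>\<omega>. \<omega> \<in> states m \<Longrightarrow> \<pi> 0 \<omega> = \<omega>"
    and one: "perm m (\<pi> 1) \<in> machine_perms m"
  shows "perm m (\<pi> a) \<in> machine_perms m" "(\<lambda>a. perm m (\<pi> a)) \<in> hom integer_group (machine_group m)"
proof -
  have bij: "perm m (\<pi> a) \<in> Bij (states m)" for a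
  proof -
    have "bij_betw (\<pi> a) (states m) (states m)"
      by (rule bij_betwI[of _ _ _ "\<pi> (- a)"]) (use closed add zero in auto)
    hence "bij_betw (perm m (\<pi> a)) (states m) (states m)" by (simp cong: bij_betw_cong)
    thus ?thesis by (simp add: Bij_def perm_def)
  qed
  have "(\<lambda>a. perm m (\<pi> a)) \<in> hom integer_group (BijGroup (states m))"
  proof (rule homI)
    fix a show "perm m (\<pi> a) \<in> carrier (BijGroup (states m))" using bij by (simp add: BijGroup_def)
  next
    fix a b
    have "perm m (\<pi> a) \<otimes>\<^bsub>BijGroup (states m)\<^esub> perm m (\<pi> b) = compose (states m) (perm m (\<pi> a)) (perm m (\<pi> b))"
      using bij by (simp add: BijGroup_def)
    also have "\<dots> = perm m (\<pi> (a \<otimes>\<^bsub>integer_group\<^esub> b))"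
      using closed add by (auto simp: compose_def perm_def fun_eq_iff)
    finally show "perm m (\<pi> (a \<otimes>\<^bsub>integer_group\<^esub> b)) = perm m (\<pi> a) \<otimes>\<^bsub>BijGroup (states m)\<^esub> perm m (\<pi> b)" by simp
  qed
  from hom_integer_group_in_subgroup[OF group_BijGroup this machine.subgroup_run_perms one]
  show mem: "perm m (\<pi> a) \<in> machine_perms m" for a .
  show "(\<lambda>a. perm m (\<pi> a)) \<in> hom integer_group (machine_group m)"
  proof (rule homI)
    fix a show "perm m (\<pi> a) \<in> carrier (machine_group m)" using mem by (simp add: machine.carrier_run_group)
  next
    fix a b
    show "perm m (\<pi> (a \<otimes>\<^bsub>integer_group\<^esub> b)) = perm m (\<pi> a) \<otimes>\<^bsub>machine_group m\<^esub> perm m (\<pi> b)"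
      unfolding perm_mult[OF mem mem] using add by (intro perm_cong) simp
  qed
qed

text \<open>The positions \<open>2 n\<close> and \<open>2 n + 1\<close> of missing heads are not on the circle.\<close>

definition shift_pos :: "nat \<Rightarrow> int \<Rightarrow> nat \<Rightarrow> nat" where
  "shift_pos n a p = (if p < 2 * n then nat ((int p + a) mod (2 * int n)) else p)"

lemma shift_pos_less_iff [simp]: "shift_pos n a p < 2 * n \<longleftrightarrow> p < 2 * n"
proof (cases "p < 2 * n")
  case True
  hence "n > 0" by simp
  hence "(int p + a) mod (2 * int n) < 2 * int n" by simp
  thus ?thesis using True by (simp add: shift_pos_def nat_less_iff)
qed (simp add: shift_pos_def)

lemma shift_pos_out: "\<not> p < 2 * n \<Longrightarrow> shift_pos n a p = p"
  by (simp add: shift_pos_def)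

lemma shift_pos_0 [simp]: "shift_pos n 0 p = p"
  by (simp add: shift_pos_def nat_mod_distrib)

lemma shift_pos_add: "shift_pos n a (shift_pos n b p) = shift_pos n (a + b) p"
proof (cases "p < 2 * n")
  case True
  have s: "int (shift_pos n b p) = (int p + b) mod (2 * int n)"
    using True by (simp add: shift_pos_def)
  have "(int (shift_pos n b p) + a) mod (2 * int n) = (int p + (a + b)) mod (2 * int n)"
    unfolding s mod_add_left_eq by (simp add: ac_simps)
  moreover have "shift_pos n b p < 2 * n" using True by simp
  ultimately show ?thesis unfolding shift_pos_def[of n a] shift_pos_def[of n "a + b"] using True by simp
qed (simp add: shift_pos_out)

lemma shift_pos_small: "p < 2 * n \<Longrightarrow> 0 \<le> int p + a \<Longrightarrow> int p + a < 2 * int n \<Longrightarrow> shift_pos n a p = nat (int p + a)"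
  by (simp add: shift_pos_def)

lemma refl_edge_refl_cell:
  assumes "p < 2 * n"
  shows "refl_edge n (refl_cell n p) = shift_pos n 1 p"
proof (cases "p = 2 * n - 1")
  case True
  hence "int p + 1 = 2 * int n" using assms by auto
  thus ?thesis using assms True by (simp add: shift_pos_def refl_edge_def refl_cell_def)
next
  case False
  hence "shift_pos n 1 p = nat (int p + 1)" using assms by (intro shift_pos_small) auto
  also have "\<dots> = p + 1" by simp
  finally show ?thesis using assms False by (simp add: refl_edge_def refl_cell_def)
qed

definition rotate_heads :: "(nat \<Rightarrow> int) \<Rightarrow> state \<Rightarrow> state" where
  "rotate_heads x \<omega> = with_pos \<omega> (\<lambda>i. shift_pos (run_len \<omega>) (x i) (pos \<omega> i))"

lemma rotate_sel [simp]: "run_len (rotate_heads x \<omega>) = run_len \<omega>"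
  "pos (rotate_heads x \<omega>) i = shift_pos (run_len \<omega>) (x i) (pos \<omega> i)"
  "lit (rotate_heads x \<omega>) = lit \<omega>" "free_before (rotate_heads x \<omega>) = free_before \<omega>" "free_after (rotate_heads x \<omega>) = free_after \<omega>"
  by (simp_all add: rotate_heads_def)

lemma shift_pos_states:
  assumes \<omega>: "\<omega> \<in> states m"
    and \<omega>': "run_len \<omega>' = run_len \<omega>" "\<And>i. pos \<omega>' i = shift_pos (run_len \<omega>) (x i) (pos \<omega> i)"
    "lit \<omega>' \<subseteq> {..<2 * run_len \<omega>}" "free_before \<omega>' = free_before \<omega>" "free_after \<omega>' = free_after \<omega>"
  shows "\<omega>' \<in> states m"
proof -
  define n where "n = run_len \<omega>"
  have pos: "pos \<omega>' i = pos \<omega> i \<or> pos \<omega>' i < 2 * n \<and> pos \<omega> i < 2 * n" for i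
    unfolding \<omega>'(2) n_def[symmetric] by (cases "pos \<omega> i < 2 * n") (simp_all add: shift_pos_out)
  have "pos \<omega>' i \<le> 2 * n + 1" for i
    using pos[of i] pos_le[OF \<omega>, of i] unfolding n_def[symmetric] by linarith
  moreover have "pos \<omega>' i = 2 * n \<longleftrightarrow> pos \<omega> i = 2 * n" "pos \<omega>' i = 2 * n + 1 \<longleftrightarrow> pos \<omega> i = 2 * n + 1" for i
    using pos[of i] by linarith+
  ultimately show ?thesis
    using \<omega> \<omega>'(1,3,4,5) by (simp add: states_def flip: n_def)
qed

lemma rotate_states: "\<omega> \<in> states m \<Longrightarrow> rotate_heads x \<omega> \<in> states m"
  by (rule shift_pos_states) (auto simp: states_def)

lemma rotate_rotate: "rotate_heads x (rotate_heads y \<omega>) = rotate_heads (\<lambda>i. x i + y i) \<omega>"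
  by (rule state.expand) (simp add: shift_pos_add fun_eq_iff)

lemma rotate_0: "rotate_heads (\<lambda>_. 0) \<omega> = \<omega>"
  by (rule state.expand) (simp add: fun_eq_iff)

definition single :: "nat \<Rightarrow> int \<Rightarrow> nat \<Rightarrow> int" where "single k a i = (if i = k then a else 0)"

text \<open>As for any two reflections, the product is a rotation; the axes are half a slot apart, so it is by one slot.\<close>

lemma two_reflections:
  "move_if refl_edge {k} (\<lambda>_. True) (move_if refl_cell {k} (\<lambda>_. True) \<omega>) = rotate_heads (single k 1) \<omega>"
proof (cases "pos \<omega> k < 2 * run_len \<omega>")
  case True
  define n where "n = run_len \<omega>"
  define \<omega>' where "\<omega>' = with_pos \<omega> (\<lambda>i. if i \<in> {k} then refl_cell n (pos \<omega> i) else pos \<omega> i)"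
  have "move_if refl_cell {k} (\<lambda>_. True) \<omega> = \<omega>'"
    using True unfolding move_if_def \<omega>'_def n_def by (simp add: gathered_def)
  moreover have rl: "run_len \<omega>' = n" by (simp add: \<omega>'_def n_def)
  moreover have "gathered {k} \<omega>'" using True by (simp add: gathered_def \<omega>'_def refl_cell_def n_def)
  hence "move_if refl_edge {k} (\<lambda>_. True) \<omega>' = with_pos \<omega>' (\<lambda>i. if i \<in> {k} then refl_edge n (pos \<omega>' i) else pos \<omega>' i)"
    unfolding move_if_def rl by (simp only: simp_thms if_True)
  moreover have "(\<lambda>i. if i \<in> {k} then refl_edge n (pos \<omega>' i) else pos \<omega>' i) = (\<lambda>i. shift_pos n (single k 1 i) (pos \<omega> i))"
    using refl_edge_refl_cell[OF True] by (auto simp: \<omega>'_def single_def n_def)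
  ultimately show ?thesis by (simp add: rotate_heads_def \<omega>'_def n_def)
next
  case False
  hence g: "\<not> gathered {k} \<omega>" by (simp add: gathered_def)
  have "rotate_heads (single k 1) \<omega> = \<omega>"
    using False by (intro state.expand) (auto simp: single_def shift_pos_out)
  thus ?thesis using g by (simp add: move_if_def)
qed

lemma perm_refl_cell:
  assumes "k \<le> m"
  shows "perm m (move_if refl_cell {k} (\<lambda>_. True)) \<in> machine_perms m"
proof (rule perm_of_involution)
  show "\<exists>F. realizes_on m F (move_if refl_cell {k} (\<lambda>_. True))"
    by (rule realizes_turn[where D = "\<lambda>_. True"]) (use assms in auto)
  show "move_if refl_cell {k} (\<lambda>_. True) (move_if refl_cell {k} (\<lambda>_. True) \<omega>) = \<omega>" for \<omega>
    by (rule move_if_involution) (auto simp: refl_cell_def)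
qed

lemma perm_refl_edge:
  assumes "k \<le> m"
  shows "perm m (move_if refl_edge {k} (\<lambda>_. True)) \<in> machine_perms m"
proof (rule perm_of_involution)
  show "\<exists>F. realizes_on m F (move_if refl_edge {k} (\<lambda>_. True))"
    by (rule realizes_cross[where D = "\<lambda>_ _. True"]) (use assms in auto)
  show "move_if refl_edge {k} (\<lambda>_. True) (move_if refl_edge {k} (\<lambda>_. True) \<omega>) = \<omega>" for \<omega>
    by (rule move_if_involution) (auto simp: refl_edge_def)
qed

lemma perm_rotate_single:
  assumes "k \<le> m"
  shows "perm m (rotate_heads (single k a)) \<in> machine_perms m"
    "(\<lambda>a. perm m (rotate_heads (single k a))) \<in> hom integer_group (machine_group m)"
proof -
  have "(\<lambda>i. single k a i + single k b i) = single k (a + b)" for a b by (auto simp: single_def)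
  hence add: "rotate_heads (single k a) (rotate_heads (single k b) \<omega>) = rotate_heads (single k (a + b)) \<omega>" for a b \<omega>
    by (simp add: rotate_rotate)
  have "single k 0 = (\<lambda>_. 0)" by (auto simp: single_def)
  hence zero: "rotate_heads (single k 0) \<omega> = \<omega>" for \<omega> by (simp add: rotate_0)
  have one: "perm m (rotate_heads (single k 1)) \<in> machine_perms m"
    using perm_comp[OF perm_refl_edge[OF assms] perm_refl_cell[OF assms]] by (simp add: two_reflections)
  show "perm m (rotate_heads (single k a)) \<in> machine_perms m"
    by (rule integer_action_perms(1)[where \<pi> = "\<lambda>a. rotate_heads (single k a)"]) (simp_all add: rotate_states add zero one)
  show "(\<lambda>a. perm m (rotate_heads (single k a))) \<in> hom integer_group (machine_group m)"
    by (rule integer_action_perms(2)[where \<pi> = "\<lambda>a. rotate_heads (single k a)"]) (simp_all add: rotate_states add zero one)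
qed

lemma perm_rotate:
  assumes x: "\<And>i. i > m \<Longrightarrow> x i = 0"
  shows "perm m (rotate_heads x) \<in> machine_perms m"
proof -
  have "perm m (rotate_heads (\<lambda>i. if i < j then x i else 0)) \<in> machine_perms m" if "j \<le> Suc m" for j
    using that
  proof (induction j)
    case 0
    show ?case using perm_id(1) by (simp add: rotate_0[abs_def])
  next
    case (Suc j)
    have "(\<lambda>i. single j (x j) i + (if i < j then x i else 0)) = (\<lambda>i. if i < Suc j then x i else 0)"
      by (rule ext) (auto simp: single_def less_Suc_eq)
    thus ?case
      using perm_comp[OF perm_rotate_single(1)[of j m "x j"] Suc.IH] Suc.prems by (simp add: rotate_rotate)
  qed
  from this[of "Suc m"] have "perm m (rotate_heads (\<lambda>i. if i < Suc m then x i else 0)) \<in> machine_perms m" by simp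
  moreover have "(\<lambda>i. if i < Suc m then x i else 0) = x" using x by (auto simp: fun_eq_iff)
  ultimately show ?thesis by simp
qed

lemma toggle_toggle: "toggle (toggle \<omega>) = \<omega>"
  by (rule state.expand) (auto simp: toggle_def)

lemma perm_toggle: "perm m toggle \<in> machine_perms m"
  by (rule perm_of_involution[OF realizes_toggle]) (rule toggle_toggle)

section \<open>Conditional rotations\<close>

text \<open>The free values belong to this notion because all that a cell knows about the lamps of other cells is
  in its flags, and these are \<open>False\<close> if the free values are.\<close>

definition clean :: "state \<Rightarrow> bool" where
  "clean \<omega> \<longleftrightarrow> lit \<omega> = {} \<and> free_before \<omega> \<and> free_after \<omega>"

lemma all_blank_iff:
  assumes "\<omega> \<in> states m"
  shows "(\<forall>j<run_len \<omega>. blank_at \<omega> j) \<longleftrightarrow> lit \<omega> = {}"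
proof
  assume b: "\<forall>j<run_len \<omega>. blank_at \<omega> j"
  have "p \<notin> lit \<omega>" for p
  proof (cases "p < run_len \<omega>")
    case True
    thus ?thesis using b by (simp add: blank_at_def)
  next
    case False
    show ?thesis
    proof
      assume p: "p \<in> lit \<omega>"
      hence "p < 2 * run_len \<omega>" using assms by (auto simp: states_def)
      hence "2 * run_len \<omega> - 1 - p < run_len \<omega>" "2 * run_len \<omega> - 1 - (2 * run_len \<omega> - 1 - p) = p"
        using False by auto
      thus False using b p unfolding blank_at_def by metis
    qed
  qed
  thus "lit \<omega> = {}" by blast
qed (simp add: blank_at_def)

definition clean_cell :: "cell \<Rightarrow> bool" where
  "clean_cell a \<longleftrightarrow> blank a \<and> clear_before a \<and> clear_after a"

text \<open>The purpose of the flags: at head \<open>0\<close> one cell knows whether the whole run is dark.\<close>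

lemma clean_cell_encode:
  assumes \<omega>: "\<omega> \<in> states m" and k: "k < run_len \<omega>" and lab: "pos \<omega> 0 = slot (run_len \<omega>) k s"
  shows "clean_cell (encode_cell \<omega> k) = clean \<omega>"
proof -
  have "label_at (run_len \<omega>) (pos \<omega> 0) k = At s" using label_at_At_iff[OF k pos_le[OF \<omega>]] lab by blast
  hence "clean_cell (encode_cell \<omega> k) \<longleftrightarrow> blank_at \<omega> k \<and> (free_before \<omega> \<and> (\<forall>j<k. blank_at \<omega> j)) \<and>
      free_after \<omega> \<and> (\<forall>j. k < j \<and> j < run_len \<omega> \<longrightarrow> blank_at \<omega> j)"
    unfolding clean_cell_def blank_encode_cell by (simp add: encode_cell_def)
  also have "\<dots> \<longleftrightarrow> (\<forall>j<run_len \<omega>. blank_at \<omega> j) \<and> free_before \<omega> \<and> free_after \<omega>"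
    using k by (metis linorder_neqE_nat order_less_trans)
  finally show ?thesis unfolding all_blank_iff[OF \<omega>] clean_def .
qed

text \<open>The same test when head \<open>0\<close> is about to cross a border.  The left cell looks to the left and the right cell to
  the right.  Both flags are meaningful wherever head \<open>0\<close> is in these two cells, so the test has the same
  result before and after the move.\<close>

lemma clean_edge_encode:
  assumes \<omega>: "\<omega> \<in> states m" and k: "Suc k < run_len \<omega>"
    and p: "pos \<omega> 0 = 2 * run_len \<omega> - 1 - k \<or> pos \<omega> 0 = Suc k"
  shows "(blank (encode_cell \<omega> k) \<and> blank (encode_cell \<omega> (Suc k)) \<and> clear_before (encode_cell \<omega> k) \<and>
    clear_after (encode_cell \<omega> (Suc k))) = clean \<omega>"
proof -
  have "label_at (run_len \<omega>) (pos \<omega> 0) k \<noteq> After" "label_at (run_len \<omega>) (pos \<omega> 0) (Suc k) \<noteq> Before"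
    using edge_labels[OF k pos_le[OF \<omega>], of 0] p by auto
  hence "(blank (encode_cell \<omega> k) \<and> blank (encode_cell \<omega> (Suc k)) \<and> clear_before (encode_cell \<omega> k) \<and>
    clear_after (encode_cell \<omega> (Suc k))) \<longleftrightarrow> blank_at \<omega> k \<and> blank_at \<omega> (Suc k) \<and> (free_before \<omega> \<and> (\<forall>j<k. blank_at \<omega> j)) \<and>
      free_after \<omega> \<and> (\<forall>j. Suc k < j \<and> j < run_len \<omega> \<longrightarrow> blank_at \<omega> j)"
    unfolding blank_encode_cell by (simp add: encode_cell_def)
  also have "\<dots> \<longleftrightarrow> (\<forall>j<run_len \<omega>. blank_at \<omega> j) \<and> free_before \<omega> \<and> free_after \<omega>"
    using k by (metis Suc_lessD Suc_lessI linorder_neqE_nat order_less_trans)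
  finally show ?thesis unfolding all_blank_iff[OF \<omega>] clean_def .
qed

definition aligned :: "nat \<Rightarrow> state \<Rightarrow> bool" where
  "aligned m \<omega> \<longleftrightarrow> pos \<omega> 0 < 2 * run_len \<omega> \<and> (\<forall>i\<le>m. pos \<omega> i = pos \<omega> 0) \<and> clean \<omega>"

lemma aligned_iff: "aligned m \<omega> \<longleftrightarrow> clean \<omega> \<and> gathered {..m} \<omega>"
proof
  assume "aligned m \<omega>"
  thus "clean \<omega> \<and> gathered {..m} \<omega>" unfolding aligned_def gathered_def by blast
next
  assume *: "clean \<omega> \<and> gathered {..m} \<omega>"
  then obtain p where p: "p < 2 * run_len \<omega>" "\<And>i. i \<le> m \<Longrightarrow> pos \<omega> i = p" unfolding gathered_def by blast
  thus "aligned m \<omega>" unfolding aligned_def using * p(2)[of 0] by simp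
qed

text \<open>Applied only to dark runs, where there is no lamp to rotate; rotating the lamps as well makes it commute
  with toggling on all states.\<close>

definition spin :: "int \<Rightarrow> state \<Rightarrow> state" where
  "spin a \<omega> = State (run_len \<omega>) (\<lambda>i. shift_pos (run_len \<omega>) a (pos \<omega> i)) (shift_pos (run_len \<omega>) a ` lit \<omega>)
     (free_before \<omega>) (free_after \<omega>)"

lemma spin_sel [simp]: "run_len (spin a \<omega>) = run_len \<omega>"
  "pos (spin a \<omega>) i = shift_pos (run_len \<omega>) a (pos \<omega> i)" "lit (spin a \<omega>) = shift_pos (run_len \<omega>) a ` lit \<omega>"
  "free_before (spin a \<omega>) = free_before \<omega>" "free_after (spin a \<omega>) = free_after \<omega>"
  by (simp_all add: spin_def)

lemma spin_states: "\<omega> \<in> states m \<Longrightarrow> spin a \<omega> \<in> states m"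
  by (rule shift_pos_states) (auto simp: states_def)

lemma spin_spin: "spin a (spin b \<omega>) = spin (a + b) \<omega>"
  by (rule state.expand) (simp add: shift_pos_add fun_eq_iff image_image)

lemma spin_0: "spin 0 \<omega> = \<omega>"
  by (rule state.expand) (simp add: fun_eq_iff)

lemma shift_pos_inj: "shift_pos n a p = shift_pos n a p' \<longleftrightarrow> p = p'"
proof
  assume "shift_pos n a p = shift_pos n a p'"
  hence "shift_pos n (- a) (shift_pos n a p) = shift_pos n (- a) (shift_pos n a p')" by simp
  thus "p = p'" by (simp add: shift_pos_add)
qed simp

lemma aligned_spin: "aligned m (spin a \<omega>) = aligned m \<omega>"
  unfolding aligned_def clean_def spin_sel shift_pos_inj shift_pos_less_iff by simp

lemma rotate_spin: "rotate_heads x (spin a \<omega>) = spin a (rotate_heads x \<omega>)"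
  by (rule state.expand) (simp add: shift_pos_add fun_eq_iff add.commute)

lemma toggle_sel [simp]: "pos (toggle \<omega>) = pos \<omega>" "free_before (toggle \<omega>) = free_before \<omega>"
  "free_after (toggle \<omega>) = free_after \<omega>"
  "lit (toggle \<omega>) = (if pos \<omega> 0 < 2 * run_len \<omega> then lit \<omega> - {pos \<omega> 0} \<union> ({pos \<omega> 0} - lit \<omega>) else lit \<omega>)"
  by (simp_all add: toggle_def)

lemma toggle_spin: "toggle (spin a \<omega>) = spin a (toggle \<omega>)"
  by (rule state.expand) (auto simp: shift_pos_inj)

definition spin_if :: "nat \<Rightarrow> int \<Rightarrow> state \<Rightarrow> state" where
  "spin_if m a \<omega> = (if aligned m \<omega> then spin a \<omega> else \<omega>)"

text \<open>On a dark run \<open>spin 1\<close> merely moves all heads together by one slot, which again is a product of two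
  reflections.\<close>

lemma spin_if_one:
  assumes \<omega>: "\<omega> \<in> states m"
  shows "move_if refl_edge {..m} clean (move_if refl_cell {..m} clean \<omega>) = spin_if m 1 \<omega>"
proof (cases "aligned m \<omega>")
  case True
  define n where "n = run_len \<omega>"
  define \<omega>' where "\<omega>' = with_pos \<omega> (\<lambda>i. if i \<in> {..m} then refl_cell n (pos \<omega> i) else pos \<omega> i)"
  have p: "pos \<omega> i = pos \<omega> 0" "pos \<omega> 0 < 2 * n" if "i \<le> m" for i
    using True that unfolding aligned_def n_def by blast+
  have cl: "clean \<omega>" "gathered {..m} \<omega>" using True by (auto simp: aligned_iff)
  hence "move_if refl_cell {..m} clean \<omega> = \<omega>'" unfolding move_if_def \<omega>'_def n_def by simp
  moreover have "clean \<omega>'" using cl by (simp add: clean_def \<omega>'_def)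
  moreover have "gathered {..m} \<omega>'"
    unfolding gathered_def
  proof (intro exI[of _ "refl_cell n (pos \<omega> 0)"] conjI ballI)
    show "refl_cell n (pos \<omega> 0) < 2 * run_len \<omega>'" using p(2)[of 0] by (simp add: refl_cell_def \<omega>'_def n_def)
    fix i assume "i \<in> {..m}"
    hence "pos \<omega> i = pos \<omega> 0" using p(1)[of i] by simp
    thus "pos \<omega>' i = refl_cell n (pos \<omega> 0)" using \<open>i \<in> {..m}\<close> by (simp add: \<omega>'_def)
  qed
  moreover have rl: "run_len \<omega>' = n" by (simp add: \<omega>'_def n_def)
  ultimately have "move_if refl_edge {..m} clean (move_if refl_cell {..m} clean \<omega>)
    = with_pos \<omega>' (\<lambda>i. if i \<in> {..m} then refl_edge n (pos \<omega>' i) else pos \<omega>' i)"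
    unfolding move_if_def[of refl_edge] by (simp only: rl simp_thms if_True)
  also have "(\<lambda>i. if i \<in> {..m} then refl_edge n (pos \<omega>' i) else pos \<omega>' i) = (\<lambda>i. shift_pos n 1 (pos \<omega> i))"
  proof
    fix i
    show "(if i \<in> {..m} then refl_edge n (pos \<omega>' i) else pos \<omega>' i) = shift_pos n 1 (pos \<omega> i)"
    proof (cases "i \<le> m")
      case True
      thus ?thesis using refl_edge_refl_cell[of "pos \<omega> i" n] p[OF True] by (simp add: \<omega>'_def)
    next
      case False
      thus ?thesis using \<omega> by (simp add: \<omega>'_def states_def n_def shift_pos_out)
    qed
  qed
  also have "with_pos \<omega>' (\<lambda>i. shift_pos n 1 (pos \<omega> i)) = spin 1 \<omega>"
    using cl(1) by (intro state.expand) (simp add: \<omega>'_def n_def clean_def fun_eq_iff)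
  finally show ?thesis using True by (simp add: spin_if_def)
next
  case False
  hence "\<not> (clean \<omega> \<and> gathered {..m} \<omega>)" by (simp add: aligned_iff)
  hence "move_if r {..m} clean \<omega> = \<omega>" for r unfolding move_if_def by (simp only: if_False)
  thus ?thesis using False by (simp add: spin_if_def)
qed

lemma clean_move_if: "clean \<omega> \<Longrightarrow> clean (move_if r M C \<omega>)"
  by (simp add: move_if_def clean_def)

lemma perm_spin_if:
  "perm m (spin_if m a) \<in> machine_perms m" "(\<lambda>a. perm m (spin_if m a)) \<in> hom integer_group (machine_group m)"
proof -
  have "perm m (move_if refl_cell {..m} clean) \<in> machine_perms m"
  proof (rule perm_of_involution)
    show "\<exists>F. realizes_on m F (move_if refl_cell {..m} clean)"
      by (rule realizes_turn[where D = clean_cell]) (use clean_cell_encode in auto)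
    show "move_if refl_cell {..m} clean (move_if refl_cell {..m} clean \<omega>) = \<omega>" for \<omega>
      by (rule move_if_involution) (auto simp: refl_cell_def clean_move_if)
  qed
  moreover have "perm m (move_if refl_edge {..m} clean) \<in> machine_perms m"
  proof (rule perm_of_involution)
    show "\<exists>F. realizes_on m F (move_if refl_edge {..m} clean)"
    proof (rule realizes_cross[where D = "\<lambda>a b. blank a \<and> blank b \<and> clear_before a \<and> clear_after b"])
      fix \<omega> k assume "\<omega> \<in> states m" "Suc k < run_len \<omega>"
        "(\<forall>i\<in>{..m}. pos \<omega> i = 2 * run_len \<omega> - 1 - k) \<or> (\<forall>i\<in>{..m}. pos \<omega> i = Suc k)"
      thus "(blank (encode_cell \<omega> k) \<and> blank (encode_cell \<omega> (Suc k)) \<and> clear_before (encode_cell \<omega> k) \<and>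
        clear_after (encode_cell \<omega> (Suc k))) = clean \<omega>"
        by (intro clean_edge_encode) auto
    qed auto
    show "move_if refl_edge {..m} clean (move_if refl_edge {..m} clean \<omega>) = \<omega>" for \<omega>
      by (rule move_if_involution) (auto simp: refl_edge_def clean_move_if)
  qed
  ultimately have "perm m (\<lambda>\<omega>. move_if refl_edge {..m} clean (move_if refl_cell {..m} clean \<omega>)) \<in> machine_perms m"
    by (rule perm_comp[rotated])
  moreover have "perm m (\<lambda>\<omega>. move_if refl_edge {..m} clean (move_if refl_cell {..m} clean \<omega>)) = perm m (spin_if m 1)"
    by (rule perm_cong) (rule spin_if_one)
  ultimately have one: "perm m (spin_if m 1) \<in> machine_perms m" by simp
  have *: "spin_if m a \<omega> \<in> states m" if "\<omega> \<in> states m" for a \<omega>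
    using that spin_states by (simp add: spin_if_def)
  have add: "spin_if m a (spin_if m b \<omega>) = spin_if m (a + b) \<omega>" for a b \<omega>
    by (simp add: spin_if_def aligned_spin spin_spin)
  have zero: "spin_if m 0 \<omega> = \<omega>" for \<omega> by (simp add: spin_if_def spin_0)
  show "perm m (spin_if m a) \<in> machine_perms m"
    by (rule integer_action_perms(1)[where \<pi> = "spin_if m"]) (simp_all add: * add zero one)
  show "(\<lambda>a. perm m (spin_if m a)) \<in> hom integer_group (machine_group m)"
    by (rule integer_action_perms(2)[where \<pi> = "spin_if m"]) (simp_all add: * add zero one)
qed

text \<open>Heads \<open>0\<close> and \<open>1\<close> only have to share the cell, not the slot, so that the condition is not affected when
  head \<open>1\<close> changes the slot.\<close>

definition met :: "state \<Rightarrow> bool" where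
  "met \<omega> \<longleftrightarrow> pos \<omega> 0 < 2 * run_len \<omega> \<and> pos \<omega> 1 < 2 * run_len \<omega> \<and>
     cell_of (run_len \<omega>) (pos \<omega> 0) = cell_of (run_len \<omega>) (pos \<omega> 1) \<and> clean \<omega>"

definition flip :: "state \<Rightarrow> state" where "flip = move_if refl_cell {1} (\<lambda>_. True)"

definition flip_if :: "state \<Rightarrow> state" where "flip_if = move_if refl_cell {1} met"

lemma flip_flip: "flip (flip \<omega>) = \<omega>"
  unfolding flip_def by (rule move_if_involution) (auto simp: refl_cell_def)

lemma flip_states: "m \<ge> 1 \<Longrightarrow> \<omega> \<in> states m \<Longrightarrow> flip \<omega> \<in> states m"
  unfolding flip_def by (rule move_if_states) (auto simp: refl_cell_def)

lemma flip_if_eq: "flip_if \<omega> = (if met \<omega> then flip \<omega> else \<omega>)"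
  by (simp add: flip_if_def flip_def move_if_def)

lemma flip_sel:
  "run_len (flip \<omega>) = run_len \<omega>" "lit (flip \<omega>) = lit \<omega>" "free_before (flip \<omega>) = free_before \<omega>"
  "free_after (flip \<omega>) = free_after \<omega>"
  "pos (flip \<omega>) i = (if i = 1 \<and> pos \<omega> 1 < 2 * run_len \<omega> then 2 * run_len \<omega> - 1 - pos \<omega> 1 else pos \<omega> i)"
  by (simp_all add: flip_def move_if_def gathered_def refl_cell_def)

lemma met_flip: "met (flip \<omega>) = met \<omega>"
  by (auto simp: met_def flip_sel clean_def cell_of_def)

lemma perm_flip_if:
  assumes m: "m \<ge> 1"
  shows "perm m flip_if \<in> machine_perms m"
proof (rule perm_of_involution)
  show "\<exists>F. realizes_on m F flip_if"
    unfolding flip_if_def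
  proof (rule realizes_turn[where D = "\<lambda>a. (\<exists>s. labels a 0 = At s) \<and> clean_cell a"])
    fix \<omega> k s assume \<omega>: "\<omega> \<in> states m" and k: "k < run_len \<omega>" and p: "\<forall>i\<in>{1}. pos \<omega> i = slot (run_len \<omega>) k s"
    define n where "n = run_len \<omega>"
    have p1: "pos \<omega> 1 < 2 * n" "cell_of n (pos \<omega> 1) = k"
      using p k by (auto simp: slot_def cell_of_def n_def)
    have "(\<exists>t. labels (encode_cell \<omega> k) 0 = At t) \<longleftrightarrow> (\<exists>t. pos \<omega> 0 = slot n k t)"
      using label_at_At_iff[OF k pos_le[OF \<omega>], of 0] by (simp add: encode_cell_def n_def)
    also have "\<dots> \<longleftrightarrow> pos \<omega> 0 < 2 * n \<and> cell_of n (pos \<omega> 0) = k"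
    proof
      assume "\<exists>t. pos \<omega> 0 = slot n k t"
      thus "pos \<omega> 0 < 2 * n \<and> cell_of n (pos \<omega> 0) = k" using k by (auto simp: slot_def cell_of_def n_def)
    next
      assume "pos \<omega> 0 < 2 * n \<and> cell_of n (pos \<omega> 0) = k"
      hence "pos \<omega> 0 = slot n k (n \<le> pos \<omega> 0)" by (auto simp: slot_def cell_of_def split: if_splits)
      thus "\<exists>t. pos \<omega> 0 = slot n k t" by blast
    qed
    finally have lab: "(\<exists>t. labels (encode_cell \<omega> k) 0 = At t) \<longleftrightarrow> pos \<omega> 0 < 2 * n \<and> cell_of n (pos \<omega> 0) = k" .
    have "clean_cell (encode_cell \<omega> k) = clean \<omega>" if "\<exists>t. labels (encode_cell \<omega> k) 0 = At t"
    proof -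
      obtain t where "labels (encode_cell \<omega> k) 0 = At t" using \<open>\<exists>t. _\<close> by blast
      hence "pos \<omega> 0 = slot (run_len \<omega>) k t"
        using label_at_At_iff[OF k pos_le[OF \<omega>], of 0 t] by (simp add: encode_cell_def)
      thus ?thesis by (rule clean_cell_encode[OF \<omega> k])
    qed
    thus "((\<exists>t. labels (encode_cell \<omega> k) 0 = At t) \<and> clean_cell (encode_cell \<omega> k)) = met \<omega>"
      using lab p1 unfolding met_def n_def[symmetric] by auto
  qed (use m in auto)
  show "flip_if (flip_if \<omega>) = \<omega>" for \<omega>
    by (simp add: flip_if_eq met_flip flip_flip)
qed

section \<open>The wreath products\<close>

text \<open>The circle has \<open>4 B + 4\<close> slots and all heads are in slot \<open>B\<close>.  A rotation by at most \<open>B\<close> leads to one of the slots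
  \<open>0, \<dots>, 2 B\<close>; it does not wrap around, and these slots are upper slots of different cells.\<close>

definition base_state :: "nat \<Rightarrow> nat \<Rightarrow> state" where
  "base_state m B = State (2 * B + 2) (\<lambda>i. if i \<le> m then B else 2 * (2 * B + 2)) {} True True"

lemma base_state_states: "base_state m B \<in> states m"
  by (simp add: base_state_def states_def)

lemma base_state_aligned: "aligned m (base_state m B)"
  by (simp add: base_state_def aligned_def clean_def)

lemma base_state_shift: "\<bar>a\<bar> \<le> int B \<Longrightarrow> shift_pos (2 * B + 2) a B = nat (int B + a)"
  by (rule shift_pos_small) auto

lemma base_state_spin:
  assumes "\<bar>a\<bar> \<le> int B" "a \<noteq> 0"
  shows "spin a (base_state m B) \<noteq> base_state m B"
proof
  assume "spin a (base_state m B) = base_state m B"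
  from arg_cong[OF this, of "\<lambda>\<omega>. pos \<omega> 0"] have "nat (int B + a) = B"
    using base_state_shift[OF assms(1)] by (simp add: base_state_def)
  thus False using assms by auto
qed

lemma finite_int_bound:
  assumes "finite (X :: int set)"
  shows "\<exists>B::nat. \<forall>x\<in>X. \<bar>x\<bar> \<le> int B"
proof (intro exI ballI)
  fix x assume "x \<in> X"
  hence "nat \<bar>x\<bar> \<le> (\<Sum>x\<in>X. nat \<bar>x\<bar>)" using assms by (intro member_le_sum) auto
  thus "\<bar>x\<bar> \<le> int (\<Sum>x\<in>X. nat \<bar>x\<bar>)" by linarith
qed

lemma shift_pos_eqD:
  assumes p: "p < 2 * n" and ab: "\<bar>a - b\<bar> < 2 * int n" and eq: "shift_pos n a p = shift_pos n b p"
  shows "a = b"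
proof -
  have "int (shift_pos n a p) = int (shift_pos n b p)" using eq by simp
  hence "(int p + a) mod (2 * int n) = (int p + b) mod (2 * int n)" using p by (simp add: shift_pos_def)
  hence "2 * int n dvd a - b" by (simp add: mod_eq_dvd_iff)
  thus ?thesis using ab dvd_imp_le_int[of "a - b" "2 * int n"] by force
qed

lemma integer_group_nontrivial: "carrier integer_group \<noteq> {\<one>\<^bsub>integer_group\<^esub>}"
proof
  assume "carrier integer_group = {\<one>\<^bsub>integer_group\<^esub>}"
  moreover have "(1::int) \<in> carrier integer_group" by simp
  ultimately have "(1::int) \<in> {\<one>\<^bsub>integer_group\<^esub>}" by (simp only:)
  thus False by simp
qed

definition track_speeds :: "nat \<Rightarrow> (nat \<Rightarrow> int) \<Rightarrow> nat \<Rightarrow> int" where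
  "track_speeds n x i = (if 0 < i \<and> i \<le> n then x (i - 1) else 0)"

text \<open>Head \<open>0\<close> stays in place, and coordinate \<open>i\<close> of \<open>\<int>\<^sup>n\<close> rotates head \<open>i + 1\<close>.  Any nonzero element separates some head from
  head \<open>0\<close>.\<close>

theorem Z_wreath_free_abelian:
  "\<exists>\<Phi>. \<Phi> \<in> mon (integer_group \<wreath> product_group {..<n} (\<lambda>_. integer_group)) (machine_group n)"
proof -
  let ?H = "product_group {..<n} (\<lambda>_. integer_group)"
  have mem: "perm n (rotate_heads (track_speeds n x)) \<in> machine_perms n" for x
    by (rule perm_rotate) (simp add: track_speeds_def)
  show ?thesis
  proof (rule machine.wreath_on_runs[where C = "aligned n" and \<tau> = spin and \<kappa> = "\<lambda>a. perm n (spin_if n a)"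
        and \<rho> = "\<lambda>x. perm n (rotate_heads (track_speeds n x))"])
    show "group integer_group" "group ?H" by simp_all
    show "(\<lambda>x. perm n (rotate_heads (track_speeds n x))) \<in> hom ?H (machine_group n)"
    proof (rule homI)
      fix x show "perm n (rotate_heads (track_speeds n x)) \<in> carrier (machine_group n)"
        using mem by (simp add: machine.carrier_run_group)
    next
      fix x y
      have "track_speeds n (x \<otimes>\<^bsub>?H\<^esub> y) = (\<lambda>i. track_speeds n x i + track_speeds n y i)"
        by (auto simp: track_speeds_def fun_eq_iff)
      thus "perm n (rotate_heads (track_speeds n (x \<otimes>\<^bsub>?H\<^esub> y)))
        = perm n (rotate_heads (track_speeds n x)) \<otimes>\<^bsub>machine_group n\<^esub> perm n (rotate_heads (track_speeds n y))"
        unfolding perm_mult[OF mem mem] by (simp only: rotate_rotate)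
    qed
    show "(\<lambda>a. perm n (spin_if n a)) \<in> hom integer_group (machine_group n)" by (rule perm_spin_if(2))
    show "perm n (spin_if n a) \<omega> = (if aligned n \<omega> then spin a \<omega> else \<omega>)" if "\<omega> \<in> states n" for a \<omega>
      using that by (simp add: spin_if_def)
    show "spin a \<omega> \<in> states n" if "\<omega> \<in> states n" for a \<omega> using that by (rule spin_states)
    show "spin a (spin b \<omega>) = spin b (spin a \<omega>)" for a b \<omega> by (simp add: spin_spin add.commute)
    show "aligned n (spin a \<omega>) = aligned n \<omega>" for a \<omega> by (rule aligned_spin)
    show "perm n (rotate_heads (track_speeds n x)) (spin a \<omega>) = spin a (perm n (rotate_heads (track_speeds n x)) \<omega>)"
      if "\<omega> \<in> states n" for x a \<omega> using that spin_states[OF that] by (simp add: rotate_spin)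
    show "carrier integer_group \<noteq> {\<one>\<^bsub>integer_group\<^esub>}" by (rule integer_group_nontrivial)
  next
    fix F a assume F: "finite F" "F \<subseteq> carrier ?H" and a: "a \<noteq> \<one>\<^bsub>integer_group\<^esub>"
    have "finite (insert a ((\<lambda>(x, i). x i) ` (F \<times> {..<n})))" using F(1) by simp
    from finite_int_bound[OF this] obtain B
      where B: "\<And>c. c \<in> insert a ((\<lambda>(x, i). x i) ` (F \<times> {..<n})) \<Longrightarrow> \<bar>c\<bar> \<le> int B" by blast
    define \<omega> where "\<omega> = base_state n B"
    have "\<omega> \<in> states n" unfolding \<omega>_def by (rule base_state_states)
    moreover have "aligned n \<omega>" unfolding \<omega>_def by (rule base_state_aligned)
    moreover have "spin a \<omega> \<noteq> \<omega>" unfolding \<omega>_def using B[of a] a by (intro base_state_spin) auto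
    moreover have "\<not> aligned n (perm n (rotate_heads (track_speeds n x)) \<omega>)" if x: "x \<in> F - {\<one>\<^bsub>?H\<^esub>}" for x
    proof
      assume al: "aligned n (perm n (rotate_heads (track_speeds n x)) \<omega>)"
      have "x \<in> {..<n} \<rightarrow>\<^sub>E UNIV" using x F(2) by auto
      hence "\<exists>i<n. x i \<noteq> 0" using x by (auto simp: fun_eq_iff PiE_def extensional_def split: if_splits)
      then obtain i where i: "i < n" "x i \<noteq> 0" by blast
      have bound: "\<bar>x i\<bar> \<le> int B" by (rule B) (use x i in auto)
      have "aligned n (rotate_heads (track_speeds n x) \<omega>)" using al \<open>\<omega> \<in> states n\<close> by simp
      hence "\<forall>j\<le>n. pos (rotate_heads (track_speeds n x) \<omega>) j = pos (rotate_heads (track_speeds n x) \<omega>) 0"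
        unfolding aligned_def by blast
      from this[THEN spec, of "Suc i", THEN mp, OF Suc_leI[OF i(1)]]
      have "nat (int B + x i) = B"
        using i(1) base_state_shift[OF bound] by (simp add: \<omega>_def base_state_def track_speeds_def)
      thus False using bound i(2) by auto
    qed
    ultimately show "\<exists>\<omega>\<in>states n. aligned n \<omega> \<and> spin a \<omega> \<noteq> \<omega> \<and>
        (\<forall>x\<in>F - {\<one>\<^bsub>?H\<^esub>}. \<not> aligned n (perm n (rotate_heads (track_speeds n x)) \<omega>))" by blast
  qed
qed

abbreviation lamplighter :: "((int \<Rightarrow> int) \<times> int) monoid" where
  "lamplighter \<equiv> integer_mod_group 2 \<wreath> integer_group"

lemma Z2_cases: "a \<in> carrier (integer_mod_group 2) \<longleftrightarrow> a = 0 \<or> a = 1"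
  by (auto simp: carrier_integer_mod_group)

lemma Z2_nontrivial: "carrier (integer_mod_group 2) \<noteq> {\<one>\<^bsub>integer_mod_group 2\<^esub>}"
proof
  assume eq: "carrier (integer_mod_group 2) = {\<one>\<^bsub>integer_mod_group 2\<^esub>}"
  have "(1::int) \<in> carrier (integer_mod_group 2)" by (simp add: Z2_cases)
  hence "(1::int) \<in> {\<one>\<^bsub>integer_mod_group 2\<^esub>}" unfolding eq .
  thus False by simp
qed

text \<open>The action of a single lamp at \<open>x\<close>: the conjugate of the toggle by a rotation.\<close>

definition toggle_at :: "int \<Rightarrow> state \<Rightarrow> state" where
  "toggle_at x \<omega> = rotate_heads (single 0 x) (toggle (rotate_heads (single 0 (- x)) \<omega>))"

lemma toggle_at_sel:
  "run_len (toggle_at x \<omega>) = run_len \<omega>" "pos (toggle_at x \<omega>) = pos \<omega>"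
  "free_before (toggle_at x \<omega>) = free_before \<omega>" "free_after (toggle_at x \<omega>) = free_after \<omega>"
  "pos \<omega> 0 < 2 * run_len \<omega> \<Longrightarrow> p \<in> lit (toggle_at x \<omega>) \<longleftrightarrow> (p \<in> lit \<omega>) = (p \<noteq> shift_pos (run_len \<omega>) (- x) (pos \<omega> 0))"
  "\<not> pos \<omega> 0 < 2 * run_len \<omega> \<Longrightarrow> lit (toggle_at x \<omega>) = lit \<omega>"
  by (auto simp: toggle_at_def shift_pos_add single_def fun_eq_iff shift_pos_out)

lemma toggle_at_commute: "toggle (toggle_at x \<omega>) = toggle_at x (toggle \<omega>)"
proof (rule state.expand, intro conjI)
  show "lit (toggle (toggle_at x \<omega>)) = lit (toggle_at x (toggle \<omega>))"
    by (cases "pos \<omega> 0 < 2 * run_len \<omega>") (auto simp: toggle_at_sel)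
qed (simp_all add: toggle_at_sel)

text \<open>The maps \<open>toggle_at x\<close> commute, which is all that \<open>wreath_hom_exists\<close> asks for.\<close>

lemma lamplighter_action:
  obtains \<rho> where "\<rho> \<in> hom lamplighter (machine_group m)"
    "\<And>a. \<rho> (\<one>\<^bsub>base_group (integer_mod_group 2) integer_group\<^esub>, a) = perm m (rotate_heads (single 0 a))"
    "\<And>x. \<rho> (point_mass integer_group (integer_mod_group 2) x 1, 0) = perm m (toggle_at x)"
proof -
  interpret G: group "machine_group m" by (rule machine.group_run_group)
  define R where "R a = perm m (rotate_heads (single 0 a))" for a
  define T where "T = perm m toggle"
  define \<kappa> where "\<kappa> a = (if a = 0 then \<one>\<^bsub>machine_group m\<^esub> else T)" for a :: int
  have R_mem: "R a \<in> machine_perms m" for a unfolding R_def by (rule perm_rotate_single(1)) simp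
  have T_mem: "T \<in> machine_perms m" unfolding T_def by (rule perm_toggle)
  have R_hom: "R \<in> hom integer_group (machine_group m)"
    unfolding R_def[abs_def] by (rule perm_rotate_single(2)) simp
  have R_inv: "inv\<^bsub>machine_group m\<^esub> R x = R (- x)" for x
  proof (rule G.inv_equality)
    have "R (- x) \<otimes>\<^bsub>machine_group m\<^esub> R x = R (- x + x)" using hom_mult[OF R_hom, of "- x" x] by simp
    also have "R (- x + x) = \<one>\<^bsub>machine_group m\<^esub>"
      using hom_one[OF R_hom group_integer_group G.is_group] by simp
    finally show "R (- x) \<otimes>\<^bsub>machine_group m\<^esub> R x = \<one>\<^bsub>machine_group m\<^esub>" .
  qed (use R_mem in \<open>simp_all add: machine.carrier_run_group\<close>)
  have conj: "R x \<otimes>\<^bsub>machine_group m\<^esub> T \<otimes>\<^bsub>machine_group m\<^esub> inv\<^bsub>machine_group m\<^esub> R x = perm m (toggle_at x)"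
    and conj_mem: "perm m (toggle_at x) \<in> machine_perms m" for x
  proof -
    have 1: "R x \<otimes>\<^bsub>machine_group m\<^esub> T = perm m (\<lambda>\<omega>. rotate_heads (single 0 x) (toggle \<omega>))"
      unfolding R_def T_def by (rule perm_mult) (fact R_mem[unfolded R_def] T_mem[unfolded T_def])+
    have 2: "perm m (\<lambda>\<omega>. rotate_heads (single 0 x) (toggle \<omega>)) \<in> machine_perms m"
      by (rule perm_comp) (fact R_mem[unfolded R_def] T_mem[unfolded T_def])+
    show "R x \<otimes>\<^bsub>machine_group m\<^esub> T \<otimes>\<^bsub>machine_group m\<^esub> inv\<^bsub>machine_group m\<^esub> R x = perm m (toggle_at x)"
      unfolding 1 R_inv unfolding R_def perm_mult[OF 2 R_mem[unfolded R_def]] toggle_at_def[abs_def] ..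
    show "perm m (toggle_at x) \<in> machine_perms m"
      using perm_comp[OF 2 R_mem[unfolded R_def]] unfolding toggle_at_def[abs_def] .
  qed
  have TT: "T \<otimes>\<^bsub>machine_group m\<^esub> T = \<one>\<^bsub>machine_group m\<^esub>"
    unfolding T_def perm_mult[OF perm_toggle perm_toggle] toggle_toggle perm_id(2) ..
  have \<kappa>: "\<kappa> \<in> hom (integer_mod_group 2) (machine_group m)"
    unfolding \<kappa>_def[abs_def] by (rule hom_Z2) (use T_mem TT in \<open>simp_all add: machine.carrier_run_group\<close>)
  have car: "R x \<in> carrier (machine_group m)" "T \<in> carrier (machine_group m)" for x
    using R_mem T_mem by (simp_all add: machine.carrier_run_group)
  have comm: "\<kappa> a \<otimes>\<^bsub>machine_group m\<^esub> (R x \<otimes>\<^bsub>machine_group m\<^esub> \<kappa> b \<otimes>\<^bsub>machine_group m\<^esub> inv\<^bsub>machine_group m\<^esub> R x)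
     = (R x \<otimes>\<^bsub>machine_group m\<^esub> \<kappa> b \<otimes>\<^bsub>machine_group m\<^esub> inv\<^bsub>machine_group m\<^esub> R x) \<otimes>\<^bsub>machine_group m\<^esub> \<kappa> a" for x a b
  proof (cases "a = 0 \<or> b = 0")
    case True
    thus ?thesis using car by (auto simp: \<kappa>_def)
  next
    case False
    have "T \<otimes>\<^bsub>machine_group m\<^esub> perm m (toggle_at x) = perm m (toggle_at x) \<otimes>\<^bsub>machine_group m\<^esub> T"
      unfolding T_def perm_mult[OF perm_toggle conj_mem] perm_mult[OF conj_mem perm_toggle] toggle_at_commute ..
    thus ?thesis using False by (simp add: \<kappa>_def conj)
  qed
  show thesis
  proof (rule wreath_hom_exists[OF G.is_group group_integer_mod_group group_integer_group R_hom \<kappa> comm])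
    fix \<Phi> assume \<Phi>: "\<Phi> \<in> hom lamplighter (machine_group m)"
      "\<And>h. h \<in> carrier integer_group \<Longrightarrow> \<Phi> (\<one>\<^bsub>base_group (integer_mod_group 2) integer_group\<^esub>, h) = R h"
      "\<And>x a. \<lbrakk>x \<in> carrier integer_group; a \<in> carrier (integer_mod_group 2)\<rbrakk> \<Longrightarrow>
        \<Phi> (point_mass integer_group (integer_mod_group 2) x a, \<one>\<^bsub>integer_group\<^esub>) =
        R x \<otimes>\<^bsub>machine_group m\<^esub> \<kappa> a \<otimes>\<^bsub>machine_group m\<^esub> inv\<^bsub>machine_group m\<^esub> R x"
    show thesis
    proof (rule that[OF \<Phi>(1)])
      show "\<Phi> (\<one>\<^bsub>base_group (integer_mod_group 2) integer_group\<^esub>, a) = perm m (rotate_heads (single 0 a))" for a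
        using \<Phi>(2)[of a] by (simp add: R_def)
      show "\<Phi> (point_mass integer_group (integer_mod_group 2) x 1, 0) = perm m (toggle_at x)" for x
        using \<Phi>(3)[of x 1] conj[of x] by (simp add: \<kappa>_def)
    qed
  qed
qed

locale lamplighter_machine =
  fixes m :: nat and \<rho> :: "(int \<Rightarrow> int) \<times> int \<Rightarrow> state \<Rightarrow> state"
  assumes m: "m \<ge> 1"
    and \<rho>: "\<rho> \<in> hom lamplighter (machine_group m)"
    and \<rho>_rotate: "\<rho> (\<one>\<^bsub>base_group (integer_mod_group 2) integer_group\<^esub>, a) = perm m (rotate_heads (single 0 a))"
    and \<rho>_toggle: "\<rho> (point_mass integer_group (integer_mod_group 2) x 1, 0) = perm m (toggle_at x)"
begin

abbreviation "N \<equiv> base_group (integer_mod_group 2) integer_group"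

lemma group_lamplighter: "group lamplighter"
  by (rule group_wreath_product) simp_all

lemma \<rho>_mem: "w \<in> carrier lamplighter \<Longrightarrow> \<rho> w \<in> machine_perms m"
  using hom_in_carrier[OF \<rho>] by (simp add: machine.carrier_run_group)

lemma N_value: "u \<in> carrier N \<Longrightarrow> u x = 0 \<or> u x = 1"
  using carrier_base_group[of "integer_mod_group 2" u integer_group] Z2_cases by auto

lemma N_finite: "u \<in> carrier N \<Longrightarrow> finite {x. u x \<noteq> 0}"
  using carrier_base_group[of "integer_mod_group 2" u integer_group] by simp

text \<open>The permutations that commute with \<open>\<tau>\<close> form a subgroup, so it is enough to check generators.\<close>

lemma \<rho>_commutes:
  assumes \<tau>: "\<And>\<omega>. \<omega> \<in> states m \<Longrightarrow> \<tau> \<omega> \<in> states m"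
    and rot: "\<And>a \<omega>. \<omega> \<in> states m \<Longrightarrow> rotate_heads (single 0 a) (\<tau> \<omega>) = \<tau> (rotate_heads (single 0 a) \<omega>)"
    and tog: "\<And>\<omega>. \<omega> \<in> states m \<Longrightarrow> toggle (\<tau> \<omega>) = \<tau> (toggle \<omega>)"
    and w: "w \<in> carrier lamplighter" and \<omega>: "\<omega> \<in> states m"
  shows "\<rho> w (\<tau> \<omega>) = \<tau> (\<rho> w \<omega>)"
proof -
  interpret G: group "machine_group m" by (rule machine.group_run_group)
  define Q where "Q = {\<pi> \<in> machine_perms m. \<forall>\<omega>\<in>states m. \<pi> (\<tau> \<omega>) = \<tau> (\<pi> \<omega>)}"
  have Q: "subgroup Q (machine_group m)"
  proof (rule G.subgroupI)
    show "Q \<subseteq> carrier (machine_group m)" by (auto simp: Q_def machine.carrier_run_group)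
    have "perm m (\<lambda>\<omega>. \<omega>) \<in> Q" using perm_id(1) \<tau> by (simp add: Q_def)
    thus "Q \<noteq> {}" by blast
  next
    fix \<pi> assume "\<pi> \<in> Q"
    hence \<pi>: "\<pi> \<in> machine_perms m" "\<And>\<omega>. \<omega> \<in> states m \<Longrightarrow> \<pi> (\<tau> \<omega>) = \<tau> (\<pi> \<omega>)" by (simp_all add: Q_def)
    note inv = machine.run_inv[OF \<pi>(1)]
    have "(inv\<^bsub>machine_group m\<^esub> \<pi>) (\<tau> \<omega>) = \<tau> ((inv\<^bsub>machine_group m\<^esub> \<pi>) \<omega>)" if \<omega>: "\<omega> \<in> states m" for \<omega>
    proof -
      define \<omega>' where "\<omega>' = (inv\<^bsub>machine_group m\<^esub> \<pi>) \<omega>"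
      have \<omega>': "\<omega>' \<in> states m" unfolding \<omega>'_def by (rule machine.run_perm_closed[OF inv(1) \<omega>])
      have "\<tau> \<omega> = \<pi> (\<tau> \<omega>')" using \<pi>(2)[OF \<omega>'] inv(2)[OF \<omega>] by (simp add: \<omega>'_def)
      thus ?thesis using inv(3)[OF \<tau>[OF \<omega>']] by (simp add: \<omega>'_def)
    qed
    thus "inv\<^bsub>machine_group m\<^esub> \<pi> \<in> Q" using inv(1) by (simp add: Q_def)
  next
    fix \<pi> \<sigma> assume "\<pi> \<in> Q" "\<sigma> \<in> Q"
    hence *: "\<pi> \<in> machine_perms m" "\<sigma> \<in> machine_perms m" "\<And>\<omega>. \<omega> \<in> states m \<Longrightarrow> \<pi> (\<tau> \<omega>) = \<tau> (\<pi> \<omega>)"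
      "\<And>\<omega>. \<omega> \<in> states m \<Longrightarrow> \<sigma> (\<tau> \<omega>) = \<tau> (\<sigma> \<omega>)" by (simp_all add: Q_def)
    have "(\<pi> \<otimes>\<^bsub>machine_group m\<^esub> \<sigma>) (\<tau> \<omega>) = \<tau> ((\<pi> \<otimes>\<^bsub>machine_group m\<^esub> \<sigma>) \<omega>)" if \<omega>: "\<omega> \<in> states m" for \<omega>
      using machine.run_mult_apply[OF *(1,2) \<omega>] machine.run_mult_apply[OF *(1,2) \<tau>[OF \<omega>]]
        *(3)[OF machine.run_perm_closed[OF *(2) \<omega>]] *(4)[OF \<omega>] by simp
    moreover have "\<pi> \<otimes>\<^bsub>machine_group m\<^esub> \<sigma> \<in> machine_perms m"
      using G.m_closed[of \<pi> \<sigma>] *(1,2) by (simp add: machine.carrier_run_group)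
    ultimately show "\<pi> \<otimes>\<^bsub>machine_group m\<^esub> \<sigma> \<in> Q" by (simp add: Q_def)
  qed
  have "\<rho> w \<in> Q"
  proof (rule wreath_hom_in_subgroup[OF group_integer_mod_group group_integer_group G.is_group \<rho> Q _ _ w])
    fix h
    show "\<rho> (\<one>\<^bsub>N\<^esub>, h) \<in> Q"
      unfolding \<rho>_rotate using perm_rotate_single(1)[of 0 m h] rot \<tau> by (simp add: Q_def)
  next
    fix x a assume a: "a \<in> carrier (integer_mod_group 2)"
    have pm: "point_mass integer_group (integer_mod_group 2) x 0 = \<one>\<^bsub>N\<^esub>" by (auto simp: point_mass_def fun_eq_iff)
    have "\<rho> (point_mass integer_group (integer_mod_group 2) x a, 0) \<in> machine_perms m"
    proof (rule \<rho>_mem)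
      have "point_mass integer_group (integer_mod_group 2) x a \<in> carrier N" by (rule point_mass_closed[OF _ a]) simp
      moreover have "0 \<in> carrier integer_group" by simp
      ultimately show "(point_mass integer_group (integer_mod_group 2) x a, 0) \<in> carrier lamplighter"
        by (simp only: carrier_wreath mem_Sigma_iff simp_thms)
    qed
    moreover have "toggle_at x (\<tau> \<omega>) = \<tau> (toggle_at x \<omega>)" if \<omega>: "\<omega> \<in> states m" for \<omega>
    proof -
      have 1: "rotate_heads (single 0 (- x)) \<omega> \<in> states m" by (rule rotate_states[OF \<omega>])
      have 2: "toggle (rotate_heads (single 0 (- x)) \<omega>) \<in> states m"
        using machine.run_perm_closed[OF perm_toggle 1] 1 by simp
      show ?thesis unfolding toggle_at_def rot[OF \<omega>] tog[OF 1] rot[OF 2] ..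
    qed
    ultimately show "\<rho> (point_mass integer_group (integer_mod_group 2) x a, \<one>\<^bsub>integer_group\<^esub>) \<in> Q"
    proof (cases "a = 0")
      case True
      have "\<rho> (\<one>\<^bsub>N\<^esub>, 0) \<in> Q"
        unfolding \<rho>_rotate using perm_rotate_single(1)[of 0 m 0] rot \<tau> by (simp add: Q_def)
      thus ?thesis using pm True by simp
    next
      case False
      hence "a = 1" using a Z2_cases by blast
      thus ?thesis using \<open>\<rho> (point_mass _ _ x a, 0) \<in> _\<close> \<open>\<And>\<omega>. \<omega> \<in> states m \<Longrightarrow> toggle_at x (\<tau> \<omega>) = _\<close> \<rho>_toggle[of x] \<tau>
        by (simp add: Q_def)
    qed
  qed
  thus ?thesis using \<omega> by (simp add: Q_def)
qed

text \<open>A finite set of lamps, placed relative to head \<open>0\<close>, becomes visible on a dark run.  The injectivity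
  assumption excludes that two of them fall into one slot of the circle and cancel.\<close>

lemma \<rho>_lamps:
  assumes u: "u \<in> carrier N" and \<omega>: "\<omega> \<in> states m" "pos \<omega> 0 < 2 * run_len \<omega>"
    and inj: "inj_on (\<lambda>x. shift_pos (run_len \<omega>) (- x) (pos \<omega> 0)) {x. u x \<noteq> 0}"
  shows "run_len (\<rho> (u, 0) \<omega>) = run_len \<omega> \<and> pos (\<rho> (u, 0) \<omega>) = pos \<omega> \<and>
    (lit \<omega> = {} \<longrightarrow> lit (\<rho> (u, 0) \<omega>) = (\<lambda>x. shift_pos (run_len \<omega>) (- x) (pos \<omega> 0)) ` {x. u x \<noteq> 0})"
  using group_integer_mod_group u inj
proof (induction rule: base_group_induct)
  case one
  have "\<rho> (\<one>\<^bsub>N\<^esub>, 0) = perm m (rotate_heads (\<lambda>_. 0))"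
    using \<rho>_rotate[of 0] by (simp add: single_def[abs_def])
  thus ?case using \<omega> by (simp only: rotate_0 perm_apply) simp
next
  case (point x a u)
  let ?s = "\<lambda>x. shift_pos (run_len \<omega>) (- x) (pos \<omega> 0)"
  let ?pm = "point_mass integer_group (integer_mod_group 2) x a"
  have a: "a = 1" using point(2,3) Z2_cases by auto
  have val: "(?pm \<otimes>\<^bsub>N\<^esub> u) y = (if y = x then 1 else u y)" for y
    using point(5) N_value[OF point(4), of y] by (auto simp: point_mass_def a)
  have supp: "{y. (?pm \<otimes>\<^bsub>N\<^esub> u) y \<noteq> 0} = insert x {y. u y \<noteq> 0}" unfolding val by auto
  have x: "x \<notin> {y. u y \<noteq> 0}" using point(5) by simp
  have inj: "inj_on ?s (insert x {y. u y \<noteq> 0})" using point(7) unfolding supp .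
  have pm: "?pm \<in> carrier N" by (rule point_mass_closed) (use point(2) in simp_all)
  have mem: "(?pm, 0) \<in> carrier lamplighter" "(u, 0) \<in> carrier lamplighter"
    using pm point(4) by (simp_all add: carrier_wreath)
  define \<omega>' where "\<omega>' = \<rho> (u, 0) \<omega>"
  have \<omega>': "\<omega>' \<in> states m" unfolding \<omega>'_def by (rule machine.run_perm_closed[OF \<rho>_mem[OF mem(2)] \<omega>(1)])
  have IH: "run_len \<omega>' = run_len \<omega>" "pos \<omega>' = pos \<omega>" "lit \<omega> = {} \<Longrightarrow> lit \<omega>' = ?s ` {y. u y \<noteq> 0}"
    using point(6) inj by (simp_all add: \<omega>'_def)
  have "\<rho> (?pm \<otimes>\<^bsub>N\<^esub> u, 0) = \<rho> ((?pm, 0) \<otimes>\<^bsub>lamplighter\<^esub> (u, 0))"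
    using wreath_base_mult[OF group_integer_mod_group group_integer_group pm point(4)] by simp
  also have "\<dots> = \<rho> (?pm, 0) \<otimes>\<^bsub>machine_group m\<^esub> \<rho> (u, 0)" by (rule hom_mult[OF \<rho> mem])
  finally have "\<rho> (?pm \<otimes>\<^bsub>N\<^esub> u, 0) \<omega> = \<rho> (?pm, 0) \<omega>'"
    using machine.run_mult_apply[OF \<rho>_mem[OF mem(1)] \<rho>_mem[OF mem(2)] \<omega>(1)] by (simp add: \<omega>'_def)
  also have "\<dots> = toggle_at x \<omega>'" using \<rho>_toggle[of x] \<omega>' by (simp add: a)
  finally have eq: "\<rho> (?pm \<otimes>\<^bsub>N\<^esub> u, 0) \<omega> = toggle_at x \<omega>'" .
  have "lit (toggle_at x \<omega>') = ?s ` insert x {y. u y \<noteq> 0}" if "lit \<omega> = {}"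
  proof -
    have "?s x \<notin> ?s ` {y. u y \<noteq> 0}" using inj x by (auto simp: inj_on_def)
    moreover have "p \<in> lit (toggle_at x \<omega>') \<longleftrightarrow> (p \<in> ?s ` {y. u y \<noteq> 0}) = (p \<noteq> ?s x)" for p
      using toggle_at_sel(5)[of \<omega>' p x] \<omega>(2) IH that by simp
    moreover have "X = insert t Y" if "t \<notin> Y" "\<And>p. p \<in> X \<longleftrightarrow> (p \<in> Y) = (p \<noteq> t)" for X Y :: "nat set" and t
    proof (rule Set.set_eqI)
      fix p show "p \<in> X \<longleftrightarrow> p \<in> insert t Y" using that(1) that(2)[of p] by (cases "p = t") simp_all
    qed
    ultimately show ?thesis unfolding image_insert by blast
  qed
  thus ?case unfolding eq supp toggle_at_sel(1,2) IH(1,2) by blast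
qed

text \<open>Take \<open>B\<close> above all the numbers that occur in elements of \<open>F\<close>.  Then \<open>(u, a)\<close> first moves head \<open>0\<close> by
  \<open>a\<close> and afterwards lights the lamps of \<open>u\<close>.  If \<open>a \<noteq> 0\<close>, head \<open>0\<close> is not in the cell of head \<open>1\<close>; if
  \<open>a = 0\<close> and \<open>u\<close> is nontrivial, some lamp is lit.\<close>

lemma \<rho>_separates:
  assumes F: "finite F" "F \<subseteq> carrier lamplighter"
  shows "\<exists>B. \<bar>b\<bar> \<le> int B \<and> (\<forall>w\<in>F - {\<one>\<^bsub>lamplighter\<^esub>}. \<not> met (\<rho> w (base_state m B)))"
proof -
  have "finite (insert b (snd ` F \<union> (\<Union>w\<in>F. {x. fst w x \<noteq> 0})))"
    using F N_finite by (auto simp: carrier_wreath)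
  from finite_int_bound[OF this] obtain B
    where B: "\<And>c. c \<in> insert b (snd ` F \<union> (\<Union>w\<in>F. {x. fst w x \<noteq> 0})) \<Longrightarrow> \<bar>c\<bar> \<le> int B" by blast
  have "\<not> met (\<rho> w (base_state m B))" if w: "w \<in> F" "w \<noteq> \<one>\<^bsub>lamplighter\<^esub>" for w
  proof -
    obtain u a where ua: "w = (u, a)" "u \<in> carrier N" using w F by (auto simp: carrier_wreath)
    have "a \<in> snd ` F" using w(1) ua(1) by (metis image_eqI snd_conv)
    hence a: "\<bar>a\<bar> \<le> int B" by (intro B) simp
    have u: "\<bar>x\<bar> \<le> int B" if "u x \<noteq> 0" for x
    proof -
      have "x \<in> {x. fst w x \<noteq> 0}" using that ua(1) by simp
      hence "x \<in> (\<Union>w\<in>F. {x. fst w x \<noteq> 0})" using w(1) by (rule UN_I[rotated])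
      thus ?thesis by (intro B) simp
    qed
    define \<omega> where "\<omega> = base_state m B"
    have \<omega>: "\<omega> \<in> states m" unfolding \<omega>_def by (rule base_state_states)
    define \<omega>' where "\<omega>' = rotate_heads (single 0 a) \<omega>"
    have \<omega>': "\<omega>' \<in> states m" unfolding \<omega>'_def by (rule rotate_states[OF \<omega>])
    have pos': "run_len \<omega>' = 2 * B + 2" "pos \<omega>' 0 = nat (int B + a)" "pos \<omega>' 1 = B" "lit \<omega>' = {}"
      using base_state_shift[OF a] m by (simp_all add: \<omega>'_def \<omega>_def base_state_def single_def)
    have less: "pos \<omega>' 0 < 2 * run_len \<omega>'" using pos' a by simp
    interpret Nn: group N by simp
    have mem: "(u, 0) \<in> carrier lamplighter" "(\<one>\<^bsub>N\<^esub>, a) \<in> carrier lamplighter"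
      using ua(2) Nn.one_closed by (simp_all add: carrier_wreath del: one_sum_group)
    have "w = (u, \<one>\<^bsub>integer_group\<^esub>) \<otimes>\<^bsub>lamplighter\<^esub> (\<one>\<^bsub>N\<^esub>, a)"
      unfolding ua(1) by (rule wreath_split) (use ua(2) in simp_all)
    hence "\<rho> w = \<rho> (u, 0) \<otimes>\<^bsub>machine_group m\<^esub> \<rho> (\<one>\<^bsub>N\<^esub>, a)"
      using hom_mult[OF \<rho> mem] by simp
    hence eq: "\<rho> w \<omega> = \<rho> (u, 0) \<omega>'"
      using machine.run_mult_apply[OF \<rho>_mem[OF mem(1)] \<rho>_mem[OF mem(2)] \<omega>] \<rho>_rotate[of a] \<omega>
      by (simp add: \<omega>'_def)
    have inj: "inj_on (\<lambda>x. shift_pos (run_len \<omega>') (- x) (pos \<omega>' 0)) {x. u x \<noteq> 0}"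
    proof (rule inj_onI)
      fix x y assume "x \<in> {x. u x \<noteq> 0}" "y \<in> {x. u x \<noteq> 0}"
        and eq: "shift_pos (run_len \<omega>') (- x) (pos \<omega>' 0) = shift_pos (run_len \<omega>') (- y) (pos \<omega>' 0)"
      hence "\<bar>x\<bar> \<le> int B" "\<bar>y\<bar> \<le> int B" using u by blast+
      hence "\<bar>- x - - y\<bar> < 2 * int (run_len \<omega>')" using pos'(1) by linarith
      from shift_pos_eqD[OF less this eq] show "x = y" by simp
    qed
    note lamps = \<rho>_lamps[OF ua(2) \<omega>' less inj]
    show ?thesis
    proof (cases "a = 0")
      case False
      hence "nat (int B + a) \<noteq> B" "nat (int B + a) < 2 * B + 2" using a by auto
      thus ?thesis using lamps pos' unfolding eq[unfolded \<omega>_def] met_def by (auto simp: cell_of_def)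
    next
      case True
      have "u \<noteq> \<one>\<^bsub>N\<^esub>" using w(2) True ua(1) by (simp add: one_wreath del: one_sum_group)
      then obtain x where "u x \<noteq> 0" by (auto simp: fun_eq_iff)
      hence "lit (\<rho> (u, 0) \<omega>') \<noteq> {}" using lamps pos'(4) by auto
      thus ?thesis unfolding eq[unfolded \<omega>_def] met_def clean_def by blast
    qed
  qed
  hence "\<forall>w\<in>F - {\<one>\<^bsub>lamplighter\<^esub>}. \<not> met (\<rho> w (base_state m B))" by simp
  moreover have "\<bar>b\<bar> \<le> int B" by (rule B) (rule insertI1)
  ultimately show ?thesis by (intro exI conjI)
qed

lemma aligned_imp_met:
  assumes "aligned m \<omega>"
  shows "met \<omega>"
proof -
  have "pos \<omega> 1 = pos \<omega> 0" "pos \<omega> 0 < 2 * run_len \<omega>" "clean \<omega>"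
    using assms m unfolding aligned_def by blast+
  thus ?thesis by (simp only: met_def simp_thms)
qed

theorem Z_wreath_lamplighter: "\<exists>\<Phi>. \<Phi> \<in> mon (integer_group \<wreath> lamplighter) (machine_group m)"
proof (rule machine.wreath_on_runs[where C = "aligned m" and \<tau> = spin and \<kappa> = "\<lambda>a. perm m (spin_if m a)" and \<rho> = \<rho>])
  show "group integer_group" by simp
  show "group lamplighter" by (rule group_lamplighter)
  show "\<rho> \<in> hom lamplighter (machine_group m)" by (rule \<rho>)
  show "(\<lambda>a. perm m (spin_if m a)) \<in> hom integer_group (machine_group m)" by (rule perm_spin_if(2))
  show "perm m (spin_if m a) \<omega> = (if aligned m \<omega> then spin a \<omega> else \<omega>)" if "\<omega> \<in> states m" for a \<omega>
    using that by (simp add: spin_if_def)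
  show "spin a \<omega> \<in> states m" if "\<omega> \<in> states m" for a \<omega> using that by (rule spin_states)
  show "spin a (spin b \<omega>) = spin b (spin a \<omega>)" for a b \<omega> by (simp add: spin_spin add.commute)
  show "aligned m (spin a \<omega>) = aligned m \<omega>" for a \<omega> by (rule aligned_spin)
  show "\<rho> w (spin a \<omega>) = spin a (\<rho> w \<omega>)" if "w \<in> carrier lamplighter" "\<omega> \<in> states m" for w a \<omega>
    by (rule \<rho>_commutes[OF _ _ _ that]) (simp_all add: spin_states rotate_spin toggle_spin)
  show "carrier integer_group \<noteq> {\<one>\<^bsub>integer_group\<^esub>}" by (rule integer_group_nontrivial)
next
  fix F a assume F: "finite F" "F \<subseteq> carrier lamplighter" and a: "a \<noteq> \<one>\<^bsub>integer_group\<^esub>"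
  obtain B where B: "\<bar>a\<bar> \<le> int B" "\<forall>w\<in>F - {\<one>\<^bsub>lamplighter\<^esub>}. \<not> met (\<rho> w (base_state m B))"
    using \<rho>_separates[OF F, of a] by (elim exE conjE)
  have "spin a (base_state m B) \<noteq> base_state m B" using B(1) a by (intro base_state_spin) simp_all
  thus "\<exists>\<omega>\<in>states m. aligned m \<omega> \<and> spin a \<omega> \<noteq> \<omega> \<and> (\<forall>w\<in>F - {\<one>\<^bsub>lamplighter\<^esub>}. \<not> aligned m (\<rho> w \<omega>))"
    using base_state_states[of m B] base_state_aligned[of m B] B(2) aligned_imp_met by blast
qed

theorem Z2_wreath_lamplighter: "\<exists>\<Phi>. \<Phi> \<in> mon (integer_mod_group 2 \<wreath> lamplighter) (machine_group m)"
proof -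
  interpret G: group "machine_group m" by (rule machine.group_run_group)
  have mem: "perm m flip_if \<in> machine_perms m" by (rule perm_flip_if[OF m])
  have invol: "perm m flip_if \<otimes>\<^bsub>machine_group m\<^esub> perm m flip_if = \<one>\<^bsub>machine_group m\<^esub>"
    unfolding perm_mult[OF mem mem] perm_id(2) by (rule perm_cong) (simp add: flip_if_eq met_flip flip_flip)
  have rot: "rotate_heads (single 0 a) (flip \<omega>) = flip (rotate_heads (single 0 a) \<omega>)" for a \<omega>
    by (rule state.expand) (auto simp: flip_sel single_def fun_eq_iff)
  have tog: "toggle (flip \<omega>) = flip (toggle \<omega>)" for \<omega>
    by (rule state.expand) (auto simp: flip_sel fun_eq_iff)
  let ?\<tau> = "\<lambda>a::int. if a = 0 then (\<lambda>\<omega>. \<omega>) else flip"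
  show ?thesis
  proof (rule machine.wreath_on_runs[where C = met and \<tau> = ?\<tau> and \<rho> = \<rho>
        and \<kappa> = "\<lambda>a. if a = 0 then \<one>\<^bsub>machine_group m\<^esub> else perm m flip_if"])
    show "group (integer_mod_group 2)" by simp
    show "group lamplighter" by (rule group_lamplighter)
    show "\<rho> \<in> hom lamplighter (machine_group m)" by (rule \<rho>)
    show "(\<lambda>a. if a = 0 then \<one>\<^bsub>machine_group m\<^esub> else perm m flip_if) \<in> hom (integer_mod_group 2) (machine_group m)"
      by (rule hom_Z2[OF G.is_group]) (use mem invol in \<open>simp_all add: machine.carrier_run_group\<close>)
    show "(if a = 0 then \<one>\<^bsub>machine_group m\<^esub> else perm m flip_if) \<omega> = (if met \<omega> then ?\<tau> a \<omega> else \<omega>)"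
      if "\<omega> \<in> states m" for a \<omega> using that by (simp add: perm_id(2) flip_if_eq)
    show "?\<tau> a \<omega> \<in> states m" if "\<omega> \<in> states m" for a \<omega> using that flip_states[OF m] by simp
    show "?\<tau> a (?\<tau> b \<omega>) = ?\<tau> b (?\<tau> a \<omega>)" for a b \<omega> by simp
    show "met (?\<tau> a \<omega>) = met \<omega>" for a \<omega> by (simp add: met_flip)
    show "\<rho> w (?\<tau> a \<omega>) = ?\<tau> a (\<rho> w \<omega>)" if "w \<in> carrier lamplighter" "\<omega> \<in> states m" for w a \<omega>
      by (rule \<rho>_commutes[OF _ _ _ that]) (simp_all add: flip_states[OF m] rot tog)
    show "carrier (integer_mod_group 2) \<noteq> {\<one>\<^bsub>integer_mod_group 2\<^esub>}" by (rule Z2_nontrivial)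
  next
    fix F a assume F: "finite F" "F \<subseteq> carrier lamplighter" and a: "a \<noteq> \<one>\<^bsub>integer_mod_group 2\<^esub>"
    obtain B where B: "\<forall>w\<in>F - {\<one>\<^bsub>lamplighter\<^esub>}. \<not> met (\<rho> w (base_state m B))"
      using \<rho>_separates[OF F, of 0] by (elim exE conjE)
    have "pos (flip (base_state m B)) 1 \<noteq> pos (base_state m B) 1"
      using m by (simp add: flip_sel base_state_def)
    hence "flip (base_state m B) \<noteq> base_state m B" by (rule contrapos_nn) (erule arg_cong)
    moreover have "a \<noteq> 0" using a by simp
    ultimately have "?\<tau> a (base_state m B) \<noteq> base_state m B" by (simp only: if_False simp_thms)
    with base_state_states[of m B] aligned_imp_met[OF base_state_aligned[of m B]] B
    show "\<exists>\<omega>\<in>states m. met \<omega> \<and> ?\<tau> a \<omega> \<noteq> \<omega> \<and> (\<forall>w\<in>F - {\<one>\<^bsub>lamplighter\<^esub>}. \<not> met (\<rho> w \<omega>))"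
      by (intro bexI conjI)
  qed
qed

end

lemma shift_Aut_class_machine:
  assumes "finite A" "card A \<ge> 2" "group G" "\<exists>\<Phi>. \<Phi> \<in> mon G (machine_group m)"
  shows "G \<in> shift_Aut_class A"
proof -
  obtain \<Phi> where \<Phi>: "\<Phi> \<in> mon G (machine_group m)" using assms(4) by blast
  obtain \<psi> where \<psi>: "\<psi> \<in> mon (machine_group m) (shift_Aut A)"
    using machine.run_group_embeds[OF finite_cells assms(1,2)] by blast
  have "\<Phi> ` carrier G \<subseteq> carrier (machine_group m)" using \<Phi> by (auto simp: mon_def hom_def)
  hence "inj_on (\<psi> \<circ> \<Phi>) (carrier G)"
    using \<Phi> \<psi> by (intro comp_inj_on) (auto simp: mon_def intro: inj_on_subset)
  moreover have "\<psi> \<circ> \<Phi> \<in> hom G (shift_Aut A)"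
    using \<Phi> \<psi> by (intro hom_compose) (auto simp: mon_def)
  ultimately show ?thesis using assms(3) by (auto simp: shift_Aut_class_def mon_def)
qed

theorem corollary1:
  fixes A :: "'a set"
  assumes "finite A" and "card A \<ge> 2"
  shows "(\<forall>n::nat. integer_group \<wreath> product_group {..<n} (\<lambda>_. integer_group) \<in> shift_Aut_class A) \<and>
         integer_mod_group 2 \<wreath> (integer_mod_group 2 \<wreath> integer_group) \<in> shift_Aut_class A \<and>
         integer_group \<wreath> (integer_mod_group 2 \<wreath> integer_group) \<in> shift_Aut_class A"
proof -
  obtain \<rho> where \<rho>: "\<rho> \<in> hom lamplighter (machine_group 1)"
    "\<And>a. \<rho> (\<one>\<^bsub>base_group (integer_mod_group 2) integer_group\<^esub>, a) = perm 1 (rotate_heads (single 0 a))"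
    "\<And>x. \<rho> (point_mass integer_group (integer_mod_group 2) x 1, 0) = perm 1 (toggle_at x)"
    using lamplighter_action[of 1] by blast
  interpret lamplighter_machine 1 \<rho>
    by unfold_locales (rule order_refl, rule \<rho>(1), rule \<rho>(2), rule \<rho>(3))
  show ?thesis
  proof (intro conjI allI)
    fix n :: nat show "integer_group \<wreath> product_group {..<n} (\<lambda>_. integer_group) \<in> shift_Aut_class A"
      by (rule shift_Aut_class_machine[OF assms _ Z_wreath_free_abelian]) (simp add: group_wreath_product)
  next
    show "integer_mod_group 2 \<wreath> lamplighter \<in> shift_Aut_class A"
      by (rule shift_Aut_class_machine[OF assms _ Z2_wreath_lamplighter]) (simp add: group_wreath_product)
  next
    show "integer_group \<wreath> lamplighter \<in> shift_Aut_class A"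
      by (rule shift_Aut_class_machine[OF assms _ Z_wreath_lamplighter]) (simp add: group_wreath_product)
  qed
qed

end
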